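(* Let $\Phi=(G,\mathbb{T},\varphi)$ be a complex unit gain graph whose underlying graph $G$ is connected. Then $r(G,\varphi)=2m(G)-2c(G)$ if and only if all of the following hold: (i) the cycles (if any) of $G$ are pairwise vertex-disjoint; (ii) for each cycle (if any) $C_l=u_1u_2\cdots u_lu_1$ of $G$, $l$ is even and $\varphi(C_l)=(-1)^{l/2}$; (iii) $m(T_G)=m(G-O(G))$, where $O(G)$ is the set of vertices lying on cycles of $G$.
   Context: $G=(V,E)$ is a simple graph with $V=\{v_1,\dots,v_n\}$; $e_{i,j}$ denotes the ordered pair $(v_i,v_j)$ for $v_iv_j\in E$, and $\overrightarrow{E}=\{e_{i,j},e_{j,i}: v_iv_j\in E\}$. $\mathbb{T}=\{z\in\mathbb{C}:|z|=1\}$. A complex unit gain graph $(G,\varphi)$ is $G$ together with a map $\varphi:\overrightarrow{E}\to\mathbb{T}$ with $\varphi(e_{i,j})=\varphi(e_{j,i})^{-1}$. Its adjacency matrix is the $n\times n$ Hermitian matrix $H(G,\varphi)=(a_{i,j})$ with $a_{i,j}=\varphi(e_{i,j})$ if $v_iv_j\in E$ and $a_{i,j}=0$ otherwise; $r(G,\varphi)$ is the rank of $H(G,\varphi)$. $m(G)$ is the matching number and $c(G)=|E(G)|-|V(G)|+\omega(G)$ the cyclomatic number ($\omega(G)$ = number of components). For a cycle $C_l=u_1u_2\cdots u_lu_1$, its gain is $\varphi(C_l)=\varphi(u_1u_2)\varphi(u_2u_3)\cdots\varphi(u_{l-1}u_l)\varphi(u_lu_1)$, where $\varphi(u_iu_j)$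 denotes the value of $\varphi$ on the ordered pair $(u_i,u_j)$ (reversing the direction gives the complex conjugate). $T_G$ is the graph obtained from $G$ by contracting each cycle of $G$ into a single vertex. $G-S$ denotes the subgraph induced by $V\setminus S$. *)

theory Defs
  imports "Graph_Theory.Graph_Theory" "Jordan_Normal_Form.DL_Rank" "HOL-Library.Disjoint_Sets"
begin

text \<open>
  A finite simple graph is a \<^locale>\<open>pair_graph\<close>: a finite, loop-free, symmetric digraph without
  parallel arcs. Its arcs are the oriented edges, so \<^term>\<open>parcs G\<close> is the set
  $\overrightarrow{E}$ on which the gain function lives.
\<close>

locale gain_graph = pair_graph G for G :: "'a pair_pre_digraph" +
  fixes \<phi> :: "'a \<times> 'a \<Rightarrow> complex"
  assumes gain_unit: "(u, v) \<in> parcs G \<Longrightarrow> cmod (\<phi> (u, v)) = 1"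
    and gain_inverse: "(u, v) \<in> parcs G \<Longrightarrow> \<phi> (u, v) = inverse (\<phi> (v, u))"

text \<open>The list \<open>vs\<close> is the enumeration $v_1,\dots,v_n$ of the vertices.\<close>

definition adjacency_matrix ::
  "'a pair_pre_digraph \<Rightarrow> ('a \<times> 'a \<Rightarrow> complex) \<Rightarrow> 'a list \<Rightarrow> complex mat" where
  "adjacency_matrix G \<phi> vs = mat (length vs) (length vs)
     (\<lambda>(i, j). if (vs ! i, vs ! j) \<in> parcs G then \<phi> (vs ! i, vs ! j) else 0)"

definition gain_rank :: "'a pair_pre_digraph \<Rightarrow> ('a \<times> 'a \<Rightarrow> complex) \<Rightarrow> 'a list \<Rightarrow> nat" where
  "gain_rank G \<phi> vs = vec_space.rank (length vs) (adjacency_matrix G \<phi> vs)"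

definition undirected :: "('a \<times> 'a) set \<Rightarrow> 'a set set" where
  "undirected A = (\<lambda>(u, v). {u, v}) ` A"

definition edges :: "('a, 'b) pre_digraph \<Rightarrow> 'a set set" where
  "edges G = undirected (arcs_ends G)"

definition matching :: "('a, 'b) pre_digraph \<Rightarrow> 'a set set \<Rightarrow> bool" where
  "matching G M \<longleftrightarrow> M \<subseteq> edges G \<and> disjoint M"

definition matching_number :: "('a, 'b) pre_digraph \<Rightarrow> nat" where
  "matching_number G = Max {card M | M. matching G M}"

text \<open>
  In a symmetric digraph the strongly connected components are the connected components.
\<close>

definition cyclomatic_number :: "('a, 'b) pre_digraph \<Rightarrow> int" where
  "cyclomatic_number G =
     int (card (edges G)) - int (card (verts G)) + int (card (pre_digraph.sccs_verts G))"

text \<open>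
  A cycle $u_1u_2\cdots u_lu_1$ is the list of arcs $(u_1,u_2),\dots,(u_l,u_1)$. The notion
  \<^const>\<open>pre_digraph.cycle\<close> also admits the closed walks $u_1u_2u_1$, which are not cycles of a
  simple graph; hence the bound on the length. One cycle is represented by several lists, one
  for each starting point and direction; these are exactly the lists with the same undirected
  edges.
\<close>

definition graph_cycle :: "'a pair_pre_digraph \<Rightarrow> ('a \<times> 'a) list \<Rightarrow> bool" where
  "graph_cycle G p \<longleftrightarrow> pre_digraph.cycle (with_proj G) p \<and> 3 \<le> length p"

definition cycle_verts :: "('a \<times> 'a) list \<Rightarrow> 'a set" where
  "cycle_verts p = fst ` set p"

definition cycle_gain :: "('a \<times> 'a \<Rightarrow> complex) \<Rightarrow> ('a \<times> 'a) list \<Rightarrow> complex" where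
  "cycle_gain \<phi> p = prod_list (map \<phi> p)"

definition cycles_disjoint :: "'a pair_pre_digraph \<Rightarrow> bool" where
  "cycles_disjoint G \<longleftrightarrow> (\<forall>p q. graph_cycle G p \<and> graph_cycle G q \<and>
     undirected (set p) \<noteq> undirected (set q) \<longrightarrow> cycle_verts p \<inter> cycle_verts q = {})"

definition on_cycles :: "'a pair_pre_digraph \<Rightarrow> 'a set" where
  "on_cycles G = (\<Union>p\<in>{p. graph_cycle G p}. cycle_verts p)"

definition same_cycle :: "'a pair_pre_digraph \<Rightarrow> 'a rel" where
  "same_cycle G = {(u, v). \<exists>p. graph_cycle G p \<and> u \<in> cycle_verts p \<and> v \<in> cycle_verts p}"

text \<open>
  The vertices of $T_G$ are the classes of the equivalence relation generated by lying on a
  common cycle. If the cycles are pairwise vertex-disjoint, these are the vertex sets of the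
  cycles and the singletons of the vertices on no cycle; taking the generated equivalence
  relation gives the contraction of all cycles a meaning for every graph. Loops are dropped
  and parallel edges identified.
\<close>

definition contract_cycles :: "'a pair_pre_digraph \<Rightarrow> 'a set pair_pre_digraph" where
  "contract_cycles G = (let V = pverts G // (same_cycle G)\<^sup>* in
     \<lparr> pverts = V,
       parcs = {(A, B). A \<in> V \<and> B \<in> V \<and> A \<noteq> B \<and> (\<exists>a\<in>A. \<exists>b\<in>B. (a, b) \<in> parcs G)} \<rparr>)"

definition delete_verts :: "'a pair_pre_digraph \<Rightarrow> 'a set \<Rightarrow> ('a, 'a \<times> 'a) pre_digraph" where
  "delete_verts G S = with_proj G \<restriction> (pverts G - S)"

end

theory Submission
  imports Defs "HOL-Number_Theory.Cong"
begin

text \<open>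
  The bound $2m - 2c \le r$ follows by induction: deleting a vertex on a cycle does not raise $r$ and
  lowers $m$ by at most $1$ and $c$ by at least $1$, while removing a pendant vertex together with its
  neighbour lowers $r$ by at least $2$ and $m$ by at most $1$. In the case of equality each of these
  estimates is sharp. Two cycles with a common vertex would allow $c$ to drop by $2$. Deleting down to
  a single cycle $C$ with no pendant vertices leaves a kernel vector of $C$, which forces
  $\varphi(C) = (-1)^{l/2}$, and on the way back no maximum matching can use an edge leaving a cycle.
  Hence $m(G) \le m(G - O(G)) + |O(G)|/2$. Conversely a matching of $T_G$ meets each cycle in at most
  one vertex $s$; deleting the successor of $s$ on each cycle and filling up the remaining even paths
  gives $m(G) \ge m(T_G) + |O(G)|/2$, so (iii) holds.

  For the other direction, $T_G$ is a forest, so it has a vertex cover $K$ of size $m(T_G)$. By (iii)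
  some matching of this size avoids the contracted vertices, hence so does $K$, and $G - K$
  consists of isolated vertices and of cycles of rank $l - 2$.
\<close>

section \<open>Rank as the least length of a factorization\<close>

text \<open>Deletions disconnect the graph and shrink its matrix. Therefore everything is stated for
  symmetric arc sets on a fixed vertex set, and the rank is the least number of products
  \<open>f i a * g i b\<close> that sum to the entry function. Connectedness enters when T_G is
  shown to be a forest.

  The value (-1)^(l/2) comes from the kernel equations of a cycle: with g_i the gain from u_i to
  u_(i+1) they read x(u_i) = -g_i g_(i+1) x(u_(i+2)). For even l the even and the odd positions
  decouple, and either half closes up with nonzero entries exactly when the gain of the cycle is
  (-1)^(l/2). So one kernel vector forces this value, and the value supplies two independent ones,
  which brings the rank down to l - 2.

  On the way down to a single cycle C the deleted vertices must spare C. This works because in a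
  graph attaining the bound the neighbour of a pendant vertex lies on no cycle, and every other
  cycle is disjoint from C and can lose a vertex.

  That T_G is a forest is obtained by counting its vertices and edges; no cycle of T_G is lifted to
  G.\<close>

definition rank_le :: "('a \<Rightarrow> 'b \<Rightarrow> 'k::field) \<Rightarrow> nat \<Rightarrow> bool" where
  "rank_le h k \<longleftrightarrow> (\<exists>f g. \<forall>a b. h a b = (\<Sum>i<k. f i a * g i b))"

lemma rank_leI:
  assumes "finite I" "card I \<le> k" "\<And>a b. h a b = (\<Sum>i\<in>I. f i a * g i b)"
  shows "rank_le h k"
proof -
  obtain e where e: "bij_betw e {..<card I} I"
    using ex_bij_betw_nat_finite[OF assms(1)] by (auto simp: atLeast0LessThan)
  define f' where "f' = (\<lambda>i a. if i < card I then f (e i) a else 0)"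
  have "h a b = (\<Sum>i<k. f' i a * g (e i) b)" for a b
  proof -
    have "h a b = (\<Sum>i<card I. f (e i) a * g (e i) b)"
      unfolding assms(3) by (rule sum.reindex_bij_betw[OF e, symmetric])
    also have "\<dots> = (\<Sum>i<k. f' i a * g (e i) b)"
      using assms(2) by (intro sum.mono_neutral_cong_left) (auto simp: f'_def)
    finally show ?thesis .
  qed
  then show ?thesis unfolding rank_le_def
    by (intro exI[of _ f'] exI[of _ "\<lambda>i. g (e i)"]) auto
qed

lemma rank_le_add:
  assumes "rank_le h k" "rank_le h' k'"
  shows "rank_le (\<lambda>a b. h a b + h' a b) (k + k')"
proof -
  obtain f g f' g' where *: "\<And>a b. h a b = (\<Sum>i<k. f i a * g i b)"
    "\<And>a b. h' a b = (\<Sum>i<k'. f' i a * g' i b)"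
    using assms unfolding rank_le_def by blast
  show ?thesis
  proof (rule rank_leI)
    show "finite ({..<k} <+> {..<k'})" "card ({..<k} <+> {..<k'}) \<le> k + k'"
      by (simp_all add: card_Plus)
    show "h a b + h' a b = (\<Sum>i\<in>{..<k} <+> {..<k'}.
        case_sum f f' i a * case_sum g g' i b)" for a b
      by (subst sum.Plus) (auto simp: * o_def)
  qed
qed

lemma rank_le_sum:
  assumes "finite I" "\<And>i. i \<in> I \<Longrightarrow> rank_le (h i) (k i)"
  shows "rank_le (\<lambda>a b. \<Sum>i\<in>I. h i a b) (\<Sum>i\<in>I. k i)"
  using assms
proof (induction I rule: finite_induct)
  case empty
  show ?case by (auto simp: rank_le_def)
next
  case (insert x I)
  then show ?case using rank_le_add[of "h x" "k x" "\<lambda>a b. \<Sum>i\<in>I. h i a b"] by simp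
qed

lemma rank_le_scale:
  assumes "rank_le h k"
  shows "rank_le (\<lambda>a b. p a * h a b * q b) k"
proof -
  obtain f g where "\<And>a b. h a b = (\<Sum>i<k. f i a * g i b)"
    using assms unfolding rank_le_def by blast
  then show ?thesis
    by (intro rank_leI[of "{..<k}" _ _ "\<lambda>i a. p a * f i a" "\<lambda>i b. g i b * q b"])
      (auto simp: sum_distrib_left sum_distrib_right mult.assoc)
qed

lemma rank_le_transpose:
  fixes h :: "'a \<Rightarrow> 'a \<Rightarrow> 'k::field"
  shows "rank_le (\<lambda>a b. h b a) k \<longleftrightarrow> rank_le h k"
proof -
  have "rank_le (\<lambda>a b. h b a) k" if *: "rank_le h k" for h :: "'a \<Rightarrow> 'a \<Rightarrow> 'k"
  proof -
    obtain f g where "\<And>a b. h a b = (\<Sum>i<k. f i a * g i b)"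
      using * unfolding rank_le_def by blast
    then show ?thesis by (intro rank_leI[of "{..<k}" _ _ g f]) (auto simp: mult.commute)
  qed
  from this[of h] this[of "\<lambda>a b. h b a"] show ?thesis by blast
qed

text \<open>Some term \<open>j\<close> has \<open>f j u \<noteq> 0\<close>. The equations
  \<open>h u b = 0\<close> then express \<open>g j b\<close> through the other \<open>g i b\<close>
  for every \<open>b \<noteq> w\<close>, so once column \<open>w\<close> is cleared the term
  \<open>j\<close> can be eliminated.\<close>

lemma rank_le_zero_column:
  assumes "rank_le h k" "h u w \<noteq> 0" "\<And>b. b \<noteq> w \<Longrightarrow> h u b = 0"
  shows "rank_le (\<lambda>a b. if b = w then 0 else h a b) (k - 1)"
proof -
  obtain f g where fg: "\<And>a b. h a b = (\<Sum>i<k. f i a * g i b)"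
    using assms unfolding rank_le_def by blast
  obtain j where j: "j < k" "f j u \<noteq> 0"
  proof -
    have "\<exists>i\<in>{..<k}. f i u * g i w \<noteq> 0"
      using assms(2) unfolding fg by (rule contrapos_np) (auto intro!: sum.neutral)
    then show ?thesis using that by auto
  qed
  let ?I = "{..<k} - {j}"
  have split: "(\<Sum>i<k. F i) = F j + (\<Sum>i\<in>?I. F i)" for F :: "nat \<Rightarrow> 'c"
    using j(1) by (simp add: sum.remove)
  show ?thesis
  proof (rule rank_leI)
    show "finite ?I" "card ?I \<le> k - 1" using j(1) by auto
    fix a b
    \<comment> \<open>Substituting for \<open>g j b\<close> subtracts from each \<open>f i\<close>
      the multiple of \<open>f j\<close> that makes it vanish at \<open>u\<close>.\<close>
    show "(if b = w then 0 else h a b) = (\<Sum>i\<in>?I. (f i a - f j a * f i u / f j u) *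
        (if b = w then 0 else g i b))"
    proof (cases "b = w")
      case False
      have "f j u * g j b = - (\<Sum>i\<in>?I. f i u * g i b)"
        using assms(3)[OF False] unfolding fg split by (simp add: eq_neg_iff_add_eq_0)
      then have "g j b = - (\<Sum>i\<in>?I. f i u * g i b) / f j u"
        using j(2) by (simp add: field_simps)
      then have "h a b = - f j a * (\<Sum>i\<in>?I. f i u * g i b) / f j u + (\<Sum>i\<in>?I. f i a * g i b)"
        unfolding fg split by simp
      also have "\<dots> = (\<Sum>i\<in>?I. (f i a - f j a * f i u / f j u) * g i b)"
        by (simp add: left_diff_distrib sum_subtractf sum_distrib_left sum_divide_distrib mult.assoc sum_negf)
      finally show ?thesis using False by simp
    qed simp
  qed
qed

section \<open>Kernel vectors, and comparison with the rank of a matrix\<close>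

text \<open>Gaussian elimination: an equation with a nonzero coefficient at \<open>v\<close>
  determines \<open>x v\<close> from the other unknowns, and dropping both the equation and
  \<open>v\<close> keeps more unknowns than equations.\<close>

lemma homogeneous_system_solution:
  fixes g :: "nat \<Rightarrow> 'b \<Rightarrow> 'k::field"
  assumes "finite V" "k < card V"
  shows "\<exists>x. (\<exists>v\<in>V. x v \<noteq> 0) \<and> (\<forall>i<k. (\<Sum>v\<in>V. g i v * x v) = 0)"
  using assms
proof (induction k arbitrary: V g)
  case 0
  then obtain v where "v \<in> V" by fastforce
  then show ?case by (intro exI[of _ "\<lambda>_. 1"]) auto
next
  case (Suc k)
  show ?case
  proof (cases "\<exists>v\<in>V. g k v \<noteq> 0")
    case False
    obtain x where "\<exists>v\<in>V. x v \<noteq> 0" "\<forall>i<k. (\<Sum>v\<in>V. g i v * x v) = 0"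
      using Suc.IH[of V g] Suc.prems by auto
    then show ?thesis using False by (intro exI[of _ x]) (auto simp: less_Suc_eq)
  next
    case True
    then obtain v where v: "v \<in> V" "g k v \<noteq> 0" by blast
    let ?V = "V - {v}"
    have "finite ?V" "k < card ?V" using Suc.prems v(1) by auto
    from Suc.IH[OF this, of "\<lambda>i w. g i w - g i v * g k w / g k v"]
    obtain x where x: "\<exists>w\<in>?V. x w \<noteq> 0"
      "\<And>i. i < k \<Longrightarrow> (\<Sum>w\<in>?V. (g i w - g i v * g k w / g k v) * x w) = 0"
      by blast
    define c where "c = - (\<Sum>w\<in>?V. g k w * x w) / g k v"
    define y where "y = x(v := c)"
    have split: "(\<Sum>w\<in>V. g i w * y w) = g i v * c + (\<Sum>w\<in>?V. g i w * x w)" for i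
      using Suc.prems(1) v(1) by (simp add: sum.remove y_def)
    have "(\<Sum>w\<in>V. g i w * y w) = 0" if "i < Suc k" for i
    proof (cases "i = k")
      case True
      then show ?thesis using v(2) by (simp add: split c_def)
    next
      case False
      then have "i < k" using that by simp
      from x(2)[OF this] have "(\<Sum>w\<in>?V. g i w * x w) = (\<Sum>w\<in>?V. g i v * g k w / g k v * x w)"
        by (simp add: left_diff_distrib sum_subtractf)
      also have "\<dots> = - g i v * c"
        by (simp add: c_def sum_distrib_left sum_divide_distrib mult.assoc sum_negf)
      finally show ?thesis by (simp add: split)
    qed
    moreover have "\<exists>w\<in>V. y w \<noteq> 0" using x(1) by (auto simp: y_def)
    ultimately show ?thesis by blast
  qed
qed

text \<open>A vector annihilated by the \<open>k\<close> functionals \<open>g i\<close> is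
  annihilated by every row at once.\<close>

lemma rank_le_kernel_vector:
  assumes "rank_le h k" "finite V" "k < card V"
  shows "\<exists>x. (\<exists>v\<in>V. x v \<noteq> 0) \<and> (\<forall>a. (\<Sum>b\<in>V. h a b * x b) = 0)"
proof -
  obtain f g where fg: "\<And>a b. h a b = (\<Sum>i<k. f i a * g i b)"
    using assms unfolding rank_le_def by blast
  obtain x where x: "\<exists>v\<in>V. x v \<noteq> 0" "\<And>i. i < k \<Longrightarrow> (\<Sum>v\<in>V. g i v * x v) = 0"
    using homogeneous_system_solution[OF assms(2,3), of g] by blast
  have "(\<Sum>b\<in>V. h a b * x b) = 0" for a
  proof -
    have "(\<Sum>b\<in>V. h a b * x b) = (\<Sum>i<k. f i a * (\<Sum>b\<in>V. g i b * x b))"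
      unfolding fg sum_distrib_right sum_distrib_left mult.assoc by (rule sum.swap)
    then show ?thesis using x(2) by simp
  qed
  then show ?thesis using x(1) by blast
qed

text \<open>Each product term is a matrix of rank at most 1, and the rank is subadditive.\<close>

lemma rank_le_imp_mat_rank_le:
  fixes h :: "'a \<Rightarrow> 'a \<Rightarrow> complex"
  assumes "rank_le h k"
  shows "vec_space.rank (length vs) (mat (length vs) (length vs) (\<lambda>(i, j). h (vs ! i) (vs ! j))) \<le> k"
proof -
  let ?n = "length vs"
  interpret vec_space "TYPE(complex)" ?n .
  obtain f g where fg: "\<And>a b. h a b = (\<Sum>i<k. f i a * g i b)"
    using assms unfolding rank_le_def by blast
  have "rank (mat ?n ?n (\<lambda>(i, j). \<Sum>l<m. f l (vs ! i) * g l (vs ! j))) \<le> m" for m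
  proof (induction m)
    case 0
    have "mat ?n ?n (\<lambda>(i, j). \<Sum>l<0. f l (vs ! i) * g l (vs ! j)) = 0\<^sub>m ?n ?n"
      by (intro eq_matI) auto
    then show ?case using rank_0I[of ?n] by (simp only:)
  next
    case (Suc m)
    let ?A = "mat ?n ?n (\<lambda>(i, j). \<Sum>l<m. f l (vs ! i) * g l (vs ! j))"
    let ?B = "mat ?n ?n (\<lambda>(i, j). f m (vs ! i) * g m (vs ! j))"
    have eq: "mat ?n ?n (\<lambda>(i, j). \<Sum>l<Suc m. f l (vs ! i) * g l (vs ! j)) = ?A + ?B"
      by (intro eq_matI) auto
    have "rank ?B \<le> 1"
      by (rule rank_le_1_product_entries[of _ ?n "\<lambda>i. f m (vs ! i)" "\<lambda>j. g m (vs ! j)"]) auto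
    then show ?case
      using rank_subadditive[of ?A ?n ?B] Suc.IH unfolding eq by auto
  qed
  from this[of k] show ?thesis unfolding fg .
qed

text \<open>A maximal independent set \<open>S\<close> of columns spans all columns: the entries of
  the vectors in \<open>S\<close> are the left factors, the coefficients of the columns with respect
  to \<open>S\<close> the right ones. Distinctness of \<open>vs\<close> makes the position
  \<open>idx a\<close> of a vertex well defined.\<close>

lemma rank_le_mat_rank:
  fixes h :: "'a \<Rightarrow> 'a \<Rightarrow> complex"
  assumes vs: "distinct vs" and h: "\<And>a b. h a b \<noteq> 0 \<Longrightarrow> a \<in> set vs \<and> b \<in> set vs"
  shows "rank_le h (vec_space.rank (length vs)
    (mat (length vs) (length vs) (\<lambda>(i, j). h (vs ! i) (vs ! j))))"
proof -
  let ?n = "length vs"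
  interpret vec_space "TYPE(complex)" ?n .
  let ?M = "mat ?n ?n (\<lambda>(i, j). h (vs ! i) (vs ! j))"
  have cols: "set (cols ?M) \<subseteq> carrier_vec ?n" using cols_dim[of ?M] by simp
  obtain S where S: "maximal S (\<lambda>T. T \<subseteq> set (cols ?M) \<and> lin_indpt T)" "finite S"
  proof -
    have "lin_indpt {}" using finite_basis_exists[OF fin_dim] subset_li_is_li
      unfolding basis_def by blast
    then show ?thesis
      using maximal_exists_superset[of "set (cols ?M)" "\<lambda>T. T \<subseteq> set (cols ?M) \<and> lin_indpt T" "{}"]
        that by blast
  qed
  have SM: "S \<subseteq> set (cols ?M)" and li: "lin_indpt S" using S(1) by (auto simp: maximal_def)
  have Sc: "S \<subseteq> carrier_vec ?n" using SM cols by blast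
  have rank: "rank ?M = card S" using rank_card_indpt[OF _ S(1), of ?n] by simp
  have "c \<in> span S" if c: "c \<in> set (cols ?M)" for c
  proof (rule ccontr)
    assume c': "c \<notin> span S"
    have cc: "c \<in> carrier_vec ?n" using c cols by blast
    have "c \<notin> S" using c' Sc span_mem by auto
    moreover have "lin_indpt (insert c S)"
      using lin_dep_iff_in_span[OF Sc li cc \<open>c \<notin> S\<close>] c' by simp
    ultimately show False using S(1) c SM unfolding maximal_def
      by blast
  qed
  then have "\<exists>a. lincomb a S = c" if "c \<in> set (cols ?M)" for c
    using that finite_in_span[OF S(2) Sc] by blast
  then obtain q where q: "\<And>c. c \<in> set (cols ?M) \<Longrightarrow> lincomb (q c) S = c" by metis
  define idx where "idx = (\<lambda>a. THE i. i < ?n \<and> vs ! i = a)"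
  have idx: "idx (vs ! i) = i" if "i < ?n" for i
    unfolding idx_def using vs that by (auto simp: nth_eq_iff_index_eq)
  show ?thesis
  proof (rule rank_leI[OF S(2)])
    show "card S \<le> rank ?M" using rank by simp
    fix a b
    show "h a b = (\<Sum>s\<in>S. (if a \<in> set vs then s $ idx a else 0) *
       (if b \<in> set vs then q (col ?M (idx b)) s else 0))"
    proof (cases "a \<in> set vs \<and> b \<in> set vs")
      case True
      then obtain i j where ij: "i < ?n" "a = vs ! i" "j < ?n" "b = vs ! j"
        by (auto simp: in_set_conv_nth)
      have c: "col ?M j \<in> set (cols ?M)" using ij(3) by (auto simp: cols_def)
      have "h a b = col ?M j $ i" using ij by simp
      also have "\<dots> = lincomb (q (col ?M j)) S $ i" by (subst q[OF c]) simp
      also have "\<dots> = (\<Sum>s\<in>S. q (col ?M j) s * s $ i)" by (rule lincomb_index[OF ij(1) Sc])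
      finally show ?thesis using True ij by (simp add: idx mult.commute)
    next
      case False
      then have "h a b = 0" using h by blast
      then show ?thesis using False by auto
    qed
  qed
qed

section \<open>Components and the cyclomatic number of arc sets\<close>

text \<open>
  A graph is its arc set on a fixed vertex set \<open>V\<close>. Deleting vertices only deletes the arcs at
  them: the isolated vertices left behind change neither the rank nor the matching number nor the
  cyclomatic number. The latter is doubled below because every edge is counted as two arcs.
\<close>

definition simple_arcs :: "'a set \<Rightarrow> 'a rel \<Rightarrow> bool" where
  "simple_arcs V A \<longleftrightarrow> finite V \<and> A \<subseteq> V \<times> V \<and> sym A \<and> irrefl A"

definition avoiding :: "'a rel \<Rightarrow> 'a set \<Rightarrow> 'a rel" where
  "avoiding A S = {(a, b) \<in> A. a \<notin> S \<and> b \<notin> S}"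

definition components :: "'a set \<Rightarrow> 'a rel \<Rightarrow> 'a set set" where
  "components V A = V // A\<^sup>*"

definition double_cyclomatic :: "'a set \<Rightarrow> 'a rel \<Rightarrow> int" where
  "double_cyclomatic V A = int (card A) - 2 * int (card V) + 2 * int (card (components V A))"

lemma simple_arcs_finite: "simple_arcs V A \<Longrightarrow> finite A"
  unfolding simple_arcs_def by (meson finite_SigmaI finite_subset)

lemma simple_arcs_sym: "simple_arcs V A \<Longrightarrow> (a, b) \<in> A \<Longrightarrow> (b, a) \<in> A"
  by (auto simp: simple_arcs_def dest: symD)

lemma simple_arcs_neq: "simple_arcs V A \<Longrightarrow> (a, b) \<in> A \<Longrightarrow> a \<noteq> b"
  by (auto simp: simple_arcs_def irrefl_def)

lemma simple_arcs_subset: "simple_arcs V A \<Longrightarrow> B \<subseteq> A \<Longrightarrow> sym B \<Longrightarrow> simple_arcs V B"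
  by (auto simp: simple_arcs_def irrefl_def)

lemma avoiding_subset: "avoiding A S \<subseteq> A"
  by (auto simp: avoiding_def)

lemma avoiding_avoiding: "avoiding (avoiding A S) T = avoiding A (S \<union> T)"
  by (auto simp: avoiding_def)

lemma simple_arcs_avoiding: "simple_arcs V A \<Longrightarrow> simple_arcs V (avoiding A S)"
  by (rule simple_arcs_subset[OF _ avoiding_subset])
    (auto simp: simple_arcs_def avoiding_def sym_def)

lemma simple_arcs_remove_edge:
  "simple_arcs V A \<Longrightarrow> simple_arcs V (A - {(a, b), (b, a)})"
  by (rule simple_arcs_subset[of V A]) (auto simp: simple_arcs_def sym_def)

lemma card_remove_edge:
  assumes "simple_arcs V A" "(a, b) \<in> A"
  shows "card A = card (A - {(a, b), (b, a)}) + 2"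
proof -
  have "card {(a, b), (b, a)} = 2" using simple_arcs_neq[OF assms] by simp
  then show ?thesis
    using card_Diff_subset[of "{(a, b), (b, a)}" A] card_mono[of A "{(a, b), (b, a)}"]
      simple_arcs_sym[OF assms] assms simple_arcs_finite[OF assms(1)] by auto
qed

lemma rtrancl_class_eq: "sym A \<Longrightarrow> (x, y) \<in> A\<^sup>* \<Longrightarrow> A\<^sup>* `` {x} = A\<^sup>* `` {y}"
  using symD[OF sym_rtrancl, of A x y] by (auto intro: rtrancl_trans)

lemma rtrancl_class_eq_iff: "sym A \<Longrightarrow> A\<^sup>* `` {x} = A\<^sup>* `` {y} \<longleftrightarrow> (x, y) \<in> A\<^sup>*"
  by (metis Image_singleton_iff rtrancl.rtrancl_refl rtrancl_class_eq)

lemma finite_components: "finite V \<Longrightarrow> finite (components V A)"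
  by (simp add: components_def quotient_def)

text \<open>Sending a component to its closure under \<open>A\<close> maps the finer partition onto
  the coarser one; all comparisons of component numbers rest on this surjection.\<close>

lemma coarser_components:
  assumes "B \<subseteq> A"
  shows "(\<lambda>X. A\<^sup>* `` X) ` components V B = components V A"
proof -
  have "A\<^sup>* `` (B\<^sup>* `` {v}) = A\<^sup>* `` {v}" for v
    using rtrancl_mono[OF assms] by (auto intro: rtrancl_trans)
  then show ?thesis by (auto simp: components_def quotient_def)
qed

lemma card_components_antimono:
  assumes "finite V" "B \<subseteq> A"
  shows "card (components V A) \<le> card (components V B)"
  using card_image_le[OF finite_components[OF assms(1)], of "\<lambda>X. A\<^sup>* `` X" B]
  by (simp add: coarser_components[OF assms(2)])

lemma card_components_less:
  assumes "finite V" "B \<subseteq> A" "sym B" "a \<in> V" "b \<in> V" "(a, b) \<in> A\<^sup>*" "(a, b) \<notin> B\<^sup>*" "sym A"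
  shows "card (components V A) < card (components V B)"
proof -
  let ?f = "\<lambda>X. A\<^sup>* `` X"
  have ne: "B\<^sup>* `` {a} \<noteq> B\<^sup>* `` {b}" using rtrancl_class_eq_iff[OF assms(3)] assms(7) by blast
  have *: "A\<^sup>* `` (B\<^sup>* `` {v}) = A\<^sup>* `` {v}" for v
    using rtrancl_mono[OF assms(2)] by (auto intro: rtrancl_trans)
  have "?f (B\<^sup>* `` {a}) = ?f (B\<^sup>* `` {b})"
    unfolding * using rtrancl_class_eq[OF assms(8,6)] .
  moreover have "B\<^sup>* `` {a} \<in> components V B" "B\<^sup>* `` {b} \<in> components V B"
    using assms(4,5) by (auto simp: components_def quotient_def)
  ultimately have "\<not> inj_on ?f (components V B)" using ne by (auto simp: inj_on_def)
  then have "card (?f ` components V B) < card (components V B)"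
    using finite_components[OF assms(1)] card_image_le eq_card_imp_inj_on le_neq_implies_less by metis
  then show ?thesis by (simp add: coarser_components[OF assms(2)])
qed

text \<open>A walk that uses the deleted edge is free of it before the first and after the last use,
  which links both its start and its end to \<open>a\<close> or \<open>b\<close>.\<close>

lemma rtrancl_remove_edge:
  fixes a b :: 'a
  assumes "sym A" "(x, y) \<in> A\<^sup>*"
  defines "B \<equiv> A - {(a, b), (b, a)}"
  shows "(x, y) \<in> B\<^sup>* \<or> ((a, x) \<in> B\<^sup>* \<or> (b, x) \<in> B\<^sup>*) \<and> ((a, y) \<in> B\<^sup>* \<or> (b, y) \<in> B\<^sup>*)"
  using assms(2)
proof (induction rule: rtrancl_induct)
  case (step y z)
  have symB: "sym B" using assms(1) by (auto simp: B_def sym_def)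
  have rev: "(u, v) \<in> B\<^sup>* \<Longrightarrow> (v, u) \<in> B\<^sup>*" for u v using sym_rtrancl[OF symB] by (auto dest: symD)
  show ?case
  proof (cases "(y, z) \<in> B")
    case True
    then show ?thesis using step.IH by (meson rtrancl.rtrancl_into_rtrancl)
  next
    case False
    then have "(y = a \<and> z = b) \<or> (y = b \<and> z = a)" using step.hyps by (auto simp: B_def)
    then show ?thesis using step.IH rev by auto
  qed
qed auto

text \<open>At most one component splits, and into two pieces: once the component of
  \<open>b\<close> is set aside, two distinct components that merge in \<open>A\<close> would both
  have to contain \<open>a\<close>.\<close>

lemma card_components_remove_edge:
  assumes "finite V" "sym A"
  shows "card (components V (A - {(a, b), (b, a)})) \<le> card (components V A) + 1"
proof -
  let ?B = "A - {(a, b), (b, a)}"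
  let ?f = "\<lambda>X. A\<^sup>* `` X"
  let ?C = "components V ?B - {?B\<^sup>* `` {b}}"
  have symB: "sym ?B" using assms(2) by (auto simp: sym_def)
  have *: "A\<^sup>* `` (?B\<^sup>* `` {v}) = A\<^sup>* `` {v}" for v
    using rtrancl_mono[of ?B A] by (auto intro: rtrancl_trans)
  have "inj_on ?f ?C"
  proof (rule inj_onI)
    fix X Y assume XY: "X \<in> ?C" "Y \<in> ?C" "?f X = ?f Y"
    obtain x y where x: "X = ?B\<^sup>* `` {x}" and y: "Y = ?B\<^sup>* `` {y}"
      using XY by (auto simp: components_def quotient_def)
    have b: "(b, x) \<notin> ?B\<^sup>*" "(b, y) \<notin> ?B\<^sup>*"
      using XY(1,2) rtrancl_class_eq[OF symB] unfolding x y by blast+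
    have "(x, y) \<in> A\<^sup>*" using XY(3) unfolding x y * rtrancl_class_eq_iff[OF assms(2)] .
    from rtrancl_remove_edge[OF assms(2) this, of a b] b
    have "(x, y) \<in> ?B\<^sup>* \<or> (a, x) \<in> ?B\<^sup>* \<and> (a, y) \<in> ?B\<^sup>*" by blast
    then show "X = Y" unfolding x y using rtrancl_class_eq[OF symB] by metis
  qed
  then have "card ?C = card (?f ` ?C)" by (simp add: card_image)
  also have "\<dots> \<le> card (components V A)"
    by (rule card_mono[OF finite_components[OF assms(1)]])
      (use coarser_components[of ?B A V] in blast)
  finally show ?thesis by (simp add: card_Diff_singleton_if split: if_splits)
qed

lemma card_components_connected:
  assumes "sym A" "V \<noteq> {}" "\<And>a b. a \<in> V \<Longrightarrow> b \<in> V \<Longrightarrow> (a, b) \<in> A\<^sup>*"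
  shows "card (components V A) = 1"
proof -
  obtain r where r: "r \<in> V" using assms(2) by blast
  have "components V A \<subseteq> {A\<^sup>* `` {r}}"
    using rtrancl_class_eq[OF assms(1) assms(3)[OF _ r]] by (auto simp: components_def quotient_def)
  moreover have "A\<^sup>* `` {r} \<in> components V A" using r by (auto simp: components_def quotient_def)
  ultimately have "components V A = {A\<^sup>* `` {r}}" by blast
  then show ?thesis by simp
qed

section \<open>The cyclomatic number under deletion of edges\<close>

text \<open>An edge accounts for two arcs and its deletion creates at most one component, so the
  doubled number drops by an amount between 0 and 2.\<close>

lemma double_cyclomatic_remove_edge:
  assumes "simple_arcs V A" "(a, b) \<in> A"
  shows "double_cyclomatic V (A - {(a, b), (b, a)}) \<le> double_cyclomatic V A"
    and "double_cyclomatic V A \<le> double_cyclomatic V (A - {(a, b), (b, a)}) + 2"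
proof -
  have f: "finite V" "sym A" using assms(1) by (auto simp: simple_arcs_def)
  show "double_cyclomatic V (A - {(a, b), (b, a)}) \<le> double_cyclomatic V A"
    using card_components_remove_edge[OF f, of a b] card_remove_edge[OF assms]
    by (simp add: double_cyclomatic_def)
  show "double_cyclomatic V A \<le> double_cyclomatic V (A - {(a, b), (b, a)}) + 2"
    using card_components_antimono[OF f(1), of "A - {(a, b), (b, a)}" A] card_remove_edge[OF assms]
    by (simp add: double_cyclomatic_def)
qed

lemma double_cyclomatic_remove_connected_edge:
  assumes "simple_arcs V A" "(a, b) \<in> A" "(a, b) \<in> (A - {(a, b), (b, a)})\<^sup>*"
  shows "double_cyclomatic V (A - {(a, b), (b, a)}) = double_cyclomatic V A - 2"
proof -
  let ?B = "A - {(a, b), (b, a)}"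
  have symB: "sym ?B" using assms(1) by (auto simp: simple_arcs_def sym_def)
  have "(b, a) \<in> ?B\<^sup>*" using assms(3) sym_rtrancl[OF symB] by (auto dest: symD)
  then have "A \<subseteq> ?B\<^sup>*" using assms(3) by auto
  then have "A\<^sup>* = ?B\<^sup>*"
    by (metis Diff_subset rtrancl_subset)
  then show ?thesis using card_remove_edge[OF assms(1,2)]
    by (simp add: double_cyclomatic_def components_def)
qed

lemma double_cyclomatic_mono:
  assumes "simple_arcs V A" "B \<subseteq> A" "sym B"
  shows "double_cyclomatic V B \<le> double_cyclomatic V A"
  using assms
proof (induction "card A" arbitrary: A rule: less_induct)
  case less
  show ?case
  proof (cases "A = B")
    case False
    then obtain a b where ab: "(a, b) \<in> A" "(a, b) \<notin> B" using less.prems by auto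
    let ?A = "A - {(a, b), (b, a)}"
    \<comment> \<open>Symmetry of \<open>B\<close> keeps the reverse arc outside \<open>B\<close> as
      well.\<close>
    have "B \<subseteq> ?A" using less.prems ab by (auto dest: symD)
    moreover have "card ?A < card A" using card_remove_edge[OF less.prems(1) ab(1)] by simp
    ultimately have "double_cyclomatic V B \<le> double_cyclomatic V ?A"
      using less.hyps simple_arcs_remove_edge[OF less.prems(1)] less.prems(3) by blast
    then show ?thesis using double_cyclomatic_remove_edge(1)[OF less.prems(1) ab(1)] by simp
  qed simp
qed

lemma double_cyclomatic_empty: "double_cyclomatic V {} = 0"
proof -
  have "components V {} = (\<lambda>v. {v}) ` V" by (auto simp: components_def quotient_def)
  then have "card (components V {}) = card V" by (simp add: card_image)
  then show ?thesis by (simp add: double_cyclomatic_def)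
qed

lemma double_cyclomatic_nonneg: "simple_arcs V A \<Longrightarrow> 0 \<le> double_cyclomatic V A"
  using double_cyclomatic_mono[of V A "{}"] by (simp add: double_cyclomatic_empty sym_def)

text \<open>Deleting a bridge adds a component, which compensates for the two lost arcs.\<close>

lemma double_cyclomatic_remove_bridge:
  assumes "simple_arcs V A" "(a, b) \<in> A" "(a, b) \<notin> (A - {(a, b), (b, a)})\<^sup>*"
  shows "double_cyclomatic V A \<le> double_cyclomatic V (A - {(a, b), (b, a)})"
proof -
  have "card (components V A) < card (components V (A - {(a, b), (b, a)}))"
    using assms by (intro card_components_less[of _ _ _ a b]) (auto simp: simple_arcs_def sym_def)
  then show ?thesis using card_remove_edge[OF assms(1,2)]
    by (simp add: double_cyclomatic_def)
qed

section \<open>Cycles as periodic vertex sequences\<close>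

text \<open>Extending the vertices periodically to all of \<open>nat\<close> turns rotations into
  shifts and makes the closing edge an edge like any other.\<close>

definition periodic_cycle :: "'a rel \<Rightarrow> nat \<Rightarrow> (nat \<Rightarrow> 'a) \<Rightarrow> bool" where
  "periodic_cycle A l u \<longleftrightarrow> 3 \<le> l \<and> inj_on u {..<l} \<and> (\<forall>i. u (i + l) = u i) \<and>
     (\<forall>i. (u i, u (Suc i)) \<in> A)"

text \<open>The undirected edges depend neither on the starting point nor on the direction, so they
  serve as the identity of a cycle.\<close>

definition cycle_edges :: "(nat \<Rightarrow> 'a) \<Rightarrow> 'a set set" where
  "cycle_edges u = range (\<lambda>i. {u i, u (Suc i)})"

definition cycle_sets :: "'a rel \<Rightarrow> 'a set set" where
  "cycle_sets A = {range u | l u. periodic_cycle A l u}"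

definition cycles_apart :: "'a rel \<Rightarrow> bool" where
  "cycles_apart A \<longleftrightarrow> (\<forall>l u k w. periodic_cycle A l u \<and> periodic_cycle A k w \<and>
     cycle_edges u \<noteq> cycle_edges w \<longrightarrow> range u \<inter> range w = {})"

lemma periodic_cycle_mono: "periodic_cycle A l u \<Longrightarrow> A \<subseteq> B \<Longrightarrow> periodic_cycle B l u"
  by (auto simp: periodic_cycle_def)

lemma periodic_mod:
  fixes u :: "nat \<Rightarrow> 'a"
  assumes "\<And>i. u (i + l) = u i"
  shows "u (i mod l) = u i"
proof -
  have "u (j + k * l) = u j" for j k
  proof (induction k)
    case (Suc k)
    then show ?case using assms[of "j + k * l"] by (simp add: algebra_simps)
  qed simp
  from this[of "i mod l" "i div l"] show ?thesis by (simp add: mult.commute)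
qed

lemma periodic_cycle_eq_iff:
  assumes "periodic_cycle A l u"
  shows "u i = u j \<longleftrightarrow> i mod l = j mod l"
proof -
  have "u (i mod l) = u i" "u (j mod l) = u j"
    using assms by (auto intro: periodic_mod simp: periodic_cycle_def)
  moreover have "i mod l < l" "j mod l < l" using assms by (auto simp: periodic_cycle_def)
  ultimately show ?thesis using assms unfolding periodic_cycle_def inj_on_def
    by (metis lessThan_iff)
qed

lemma periodic_cycle_range:
  assumes "periodic_cycle A l u"
  shows "range u = u ` {..<l}"
proof -
  have "u i \<in> u ` {..<l}" for i
  proof -
    have "u (i mod l) = u i" "i mod l < l"
      using assms by (auto intro: periodic_mod simp: periodic_cycle_def)
    then show ?thesis by (metis imageI lessThan_iff)
  qed
  then show ?thesis by auto
qed

lemma periodic_cycle_card: "periodic_cycle A l u \<Longrightarrow> card (range u) = l"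
  unfolding periodic_cycle_range by (simp add: card_image periodic_cycle_def)

lemma periodic_cycle_finite: "periodic_cycle A l u \<Longrightarrow> finite (range u)"
  unfolding periodic_cycle_range by simp

lemma periodic_cycle_range_subset: "periodic_cycle A l u \<Longrightarrow> simple_arcs V A \<Longrightarrow> range u \<subseteq> V"
  by (auto simp: periodic_cycle_def simple_arcs_def)

text \<open>Lets a vertex of the cycle be written as \<open>u (Suc i)\<close>, so that its
  predecessor \<open>u i\<close> can be named. Adding the multiple \<open>k * l\<close> of the
  period keeps the subtraction of \<open>k\<close> within \<open>nat\<close>.\<close>

lemma periodic_index:
  assumes "periodic_cycle A l u"
  shows "\<exists>j. u i = u (j + k)"
proof -
  have "1 \<le> l" using assms by (simp add: periodic_cycle_def)
  then have "k \<le> k * l" by (metis mult.right_neutral mult_le_mono2)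
  then have "i + k * l - k + k = i + k * l" by (intro le_add_diff_inverse2 trans_le_add2)
  then have "u (i + k * l - k + k) = u (i + k * l)" by (simp only:)
  also have "\<dots> = u i" unfolding periodic_cycle_eq_iff[OF assms] by simp
  finally show ?thesis by metis
qed

lemma shift_range: "periodic_cycle A l u \<Longrightarrow> range (\<lambda>i. u (i + k)) = range u"
  using periodic_index[of A l u _ k] by (auto simp: image_iff)

lemma shift_cycle_edges:
  assumes "periodic_cycle A l u"
  shows "cycle_edges (\<lambda>i. u (i + k)) = cycle_edges u"
proof -
  have "{u i, u (Suc i)} \<in> cycle_edges (\<lambda>i. u (i + k))" for i
  proof -
    have "1 \<le> l" using assms by (simp add: periodic_cycle_def)
    then have "k \<le> k * l" by (metis mult.right_neutral mult_le_mono2)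
    then have "i + k * l - k + k = i + k * l" by (intro le_add_diff_inverse2 trans_le_add2)
    then obtain j where j: "j + k = i + k * l" by blast
    have "u (j + k) = u i" "u (Suc j + k) = u (Suc i)"
      unfolding periodic_cycle_eq_iff[OF assms] using j mod_mult_self1[of i k l] mod_mult_self1[of "Suc i" k l] by simp_all
    then show ?thesis unfolding cycle_edges_def by (intro range_eqI[of _ _ j]) simp
  qed
  then show ?thesis by (auto simp: cycle_edges_def)
qed

lemma periodic_cycle_shift:
  assumes "periodic_cycle A l u"
  shows "periodic_cycle A l (\<lambda>i. u (i + k))"
proof -
  have "inj_on (\<lambda>i. u (i + k)) {..<l}"
  proof (rule inj_onI)
    fix i j assume ij: "i \<in> {..<l}" "j \<in> {..<l}" "u (i + k) = u (j + k)"
    then have "(i + k) mod l = (j + k) mod l" using periodic_cycle_eq_iff[OF assms] by blast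
    then have "[i + k = j + k] (mod l)" by (simp add: cong_def)
    then have "[i = j] (mod l)" using cong_add_rcancel_nat by blast
    then show "i = j" using ij by (simp add: cong_def)
  qed
  moreover have "u (i + l + k) = u (i + k)" for i
    using assms unfolding periodic_cycle_def by (metis add.assoc add.commute)
  ultimately show ?thesis using assms by (auto simp: periodic_cycle_def)
qed

lemma Union_cycle_edges: "\<Union> (cycle_edges u) = range u"
  by (auto simp: cycle_edges_def)

lemma cycle_edgeI: "{u i, u (Suc i)} \<in> cycle_edges u"
  by (auto simp: cycle_edges_def)

lemma periodic_cycle_neq:
  assumes "periodic_cycle A l u"
  shows "u i \<noteq> u (Suc i)" "u i \<noteq> u (Suc (Suc i))"
proof -
  have "j = 0" if "u i = u (i + j)" "j < l" for j
  proof -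
    have "[i + 0 = i + j] (mod l)"
      using that(1) periodic_cycle_eq_iff[OF assms] by (simp add: cong_def)
    then have "[0 = j] (mod l)" using cong_add_lcancel_nat by blast
    then show ?thesis using that(2) by (simp add: cong_def)
  qed
  from this[of 1] this[of 2] assms show "u i \<noteq> u (Suc i)" "u i \<noteq> u (Suc (Suc i))"
    by (auto simp: periodic_cycle_def)
qed

lemma periodic_cycle_avoiding:
  "periodic_cycle (avoiding A S) l u \<longleftrightarrow> periodic_cycle A l u \<and> range u \<inter> S = {}"
  by (fastforce simp: periodic_cycle_def avoiding_def)

lemma periodic_cycle_remove_edge:
  "periodic_cycle (A - {(a, b), (b, a)}) l u \<longleftrightarrow> periodic_cycle A l u \<and> {a, b} \<notin> cycle_edges u"
  by (auto simp: periodic_cycle_def cycle_edges_def doubleton_eq_iff)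

lemma cycle_edges_at:
  assumes "periodic_cycle A l u" "e \<in> cycle_edges u" "u (Suc i) \<in> e"
  shows "e = {u i, u (Suc i)} \<or> e = {u (Suc i), u (Suc (Suc i))}"
proof -
  have Suc: "u (Suc j) = u (Suc k) \<longleftrightarrow> u j = u k" for j k
  proof -
    have "[j + 1 = k + 1] (mod l) \<longleftrightarrow> [j = k] (mod l)" by (rule cong_add_rcancel_nat)
    then show ?thesis unfolding periodic_cycle_eq_iff[OF assms(1)] by (simp add: cong_def)
  qed
  obtain j where e: "e = {u j, u (Suc j)}" using assms(2) by (auto simp: cycle_edges_def)
  then consider "u j = u (Suc i)" | "u (Suc j) = u (Suc i)" using assms(3) by auto
  then show ?thesis
  proof cases
    case 1
    then have "u (Suc j) = u (Suc (Suc i))" by (simp add: Suc)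
    then show ?thesis using 1 e by simp
  next
    case 2
    then have "u j = u i" by (simp add: Suc)
    then show ?thesis using 2 e by simp
  qed
qed

text \<open>The rest of the cycle, from \<open>u (Suc i)\<close> on to \<open>u (i + l)\<close>,
  joins the ends of the deleted edge.\<close>

lemma cycle_edge_connected:
  assumes "periodic_cycle A l u" "sym A"
  shows "(u i, u (Suc i)) \<in> (A - {(u i, u (Suc i)), (u (Suc i), u i)})\<^sup>*"
proof -
  let ?B = "A - {(u i, u (Suc i)), (u (Suc i), u i)}"
  have l: "3 \<le> l" using assms(1) by (simp add: periodic_cycle_def)
  have B: "(u (i + j), u (Suc (i + j))) \<in> ?B" if "1 \<le> j" "j < l" for j
  proof -
    have arc: "(u (i + j), u (Suc (i + j))) \<in> A" using assms(1) by (simp add: periodic_cycle_def)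
    have neq: "u (i + j) \<noteq> u i"
    proof
      assume "u (i + j) = u i"
      then have "[i + j = i + 0] (mod l)"
        using periodic_cycle_eq_iff[OF assms(1)] by (simp add: cong_def)
      then have "[j = 0] (mod l)" using cong_add_lcancel_nat by blast
      then show False using that by (simp add: cong_def)
    qed
    \<comment> \<open>This is where \<open>3 \<le> l\<close> matters: for \<open>l = 2\<close> the
      way back would be the deleted edge in reverse.\<close>
    have "\<not> (u (i + j) = u (Suc i) \<and> u (Suc (i + j)) = u i)"
    proof
      assume *: "u (i + j) = u (Suc i) \<and> u (Suc (i + j)) = u i"
      then have "[i + j = i + 1] (mod l)" "[i + (j + 1) = i + 0] (mod l)"
        using periodic_cycle_eq_iff[OF assms(1)] by (simp_all add: cong_def)
      then have "[j = 1] (mod l)" "[j + 1 = 0] (mod l)" using cong_add_lcancel_nat by blast+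
      then have "j = 1" "l dvd j + 1" using that l by (simp_all add: cong_def mod_eq_0_iff_dvd)
      then show False using l by (auto dest: dvd_imp_le)
    qed
    then show ?thesis using arc neq by auto
  qed
  have "(u (Suc i), u (i + Suc j)) \<in> ?B\<^sup>*" if "j < l" for j
    using that
  proof (induction j)
    case (Suc j)
    then have "(u (Suc i), u (i + Suc j)) \<in> ?B\<^sup>*" by simp
    moreover have "(u (i + Suc j), u (i + Suc (Suc j))) \<in> ?B" using B[of "Suc j"] Suc.prems by simp
    ultimately show ?case by (rule rtrancl_into_rtrancl)
  qed simp
  from this[of "l - 1"] have "(u (Suc i), u (i + l)) \<in> ?B\<^sup>*" using l by simp
  moreover have "u (i + l) = u i" using assms(1) by (simp add: periodic_cycle_def)
  moreover have "sym ?B" using assms(2) by (auto simp: sym_def)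
  ultimately show ?thesis using sym_rtrancl by (metis symD)
qed

lemma double_cyclomatic_remove_cycle_edge:
  assumes "simple_arcs V A" "periodic_cycle A l u" "{a, b} \<in> cycle_edges u"
  shows "double_cyclomatic V (A - {(a, b), (b, a)}) = double_cyclomatic V A - 2"
proof -
  obtain i where i: "{a, b} = {u i, u (Suc i)}" using assms(3) by (auto simp: cycle_edges_def)
  then have "{(a, b), (b, a)} = {(u i, u (Suc i)), (u (Suc i), u i)}" by (auto simp: doubleton_eq_iff)
  moreover have "(u i, u (Suc i)) \<in> A" using assms(2) by (simp add: periodic_cycle_def)
  ultimately show ?thesis
    using double_cyclomatic_remove_connected_edge[OF assms(1)] cycle_edge_connected[OF assms(2)]
      assms(1) by (simp add: simple_arcs_def)
qed

text \<open>Deleting a vertex of a cycle also deletes an edge of that cycle, and the loss of this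
  edge alone lowers the doubled number by 2.\<close>

lemma double_cyclomatic_avoid_cyclic_vertex:
  assumes "simple_arcs V A" "periodic_cycle A l u" "v \<in> range u"
  shows "double_cyclomatic V (avoiding A {v}) \<le> double_cyclomatic V A - 2"
proof -
  obtain i where v: "v = u i" using assms(3) by auto
  let ?B = "A - {(u i, u (Suc i)), (u (Suc i), u i)}"
  have "double_cyclomatic V (avoiding A {v}) \<le> double_cyclomatic V ?B"
    using simple_arcs_avoiding[OF assms(1), of "{v}"]
    by (intro double_cyclomatic_mono simple_arcs_remove_edge assms(1))
      (auto simp: avoiding_def v simple_arcs_def)
  then show ?thesis
    using double_cyclomatic_remove_cycle_edge[OF assms(1,2) cycle_edgeI] by simp
qed

text \<open>If every edge of \<open>w\<close> at a common vertex belongs to \<open>u\<close>, then \<open>w\<close> never leaves \<open>u\<close>.\<close>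

lemma cycle_edges_subset:
  assumes "periodic_cycle B k w" "z \<in> range u" "z \<in> range w"
    and "\<And>z e. z \<in> range u \<Longrightarrow> e \<in> cycle_edges w \<Longrightarrow> z \<in> e \<Longrightarrow> e \<in> cycle_edges u"
  shows "cycle_edges w \<subseteq> cycle_edges u"
proof -
  obtain i where i: "z = w i" using assms(3) by auto
  have "w (j + i) \<in> range u" for j
  proof (induction j)
    case (Suc j)
    have "{w (j + i), w (Suc (j + i))} \<in> cycle_edges u"
      by (rule assms(4)[OF Suc.IH cycle_edgeI]) simp
    then show ?case using Union_cycle_edges[of u] by auto
  qed (use assms(2) i in simp)
  then have "range (\<lambda>j. w (j + i)) \<subseteq> range u" by blast
  then have "range w \<subseteq> range u" unfolding shift_range[OF assms(1)] .
  then have "{w j, w (Suc j)} \<in> cycle_edges u" for j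
    using assms(4)[of "w j", OF _ cycle_edgeI] by blast
  then show ?thesis unfolding cycle_edges_def[of w] by blast
qed

text \<open>Two edges at \<open>z\<close> are removed in turn, each lying on a cycle at that moment:
  an edge of \<open>u\<close> outside \<open>w\<close>, whose removal leaves \<open>w\<close>
  intact, and then \<open>f\<close> on \<open>w\<close>.\<close>

lemma double_cyclomatic_two_cycles:
  assumes "simple_arcs V A" "periodic_cycle A l u" "periodic_cycle A k w"
    and "z \<in> range u" "f \<in> cycle_edges w" "z \<in> f" "f \<notin> cycle_edges u"
  shows "double_cyclomatic V (avoiding A {z}) \<le> double_cyclomatic V A - 4"
proof -
  obtain j where "z = u j" using assms(4) by auto
  then obtain i where i: "z = u (Suc i)" using periodic_index[OF assms(2), of j 1] by auto
  have "z \<in> range w" using assms(5,6) Union_cycle_edges[of w] by auto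
  then obtain j' where "z = w j'" by auto
  then obtain i' where i': "z = w (Suc i')" using periodic_index[OF assms(3), of j' 1] by auto
  let ?e1 = "{u i, u (Suc i)}" and ?e2 = "{u (Suc i), u (Suc (Suc i))}"
  have "?e1 \<noteq> ?e2" using periodic_cycle_neq[OF assms(2), of i] periodic_cycle_neq[OF assms(2), of "Suc i"]
    by (auto simp: doubleton_eq_iff)
  moreover have "?e1 \<noteq> f" "?e2 \<noteq> f" using assms(7) cycle_edgeI[of u] by auto
  moreover have "e \<in> {{w i', w (Suc i')}, {w (Suc i'), w (Suc (Suc i'))}}"
    if "e \<in> cycle_edges w" "z \<in> e" for e
    using cycle_edges_at[OF assms(3) that(1), of i'] that(2) i' by auto
  \<comment> \<open>\<open>w\<close> has two edges at \<open>z\<close>, one of them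
    \<open>f\<close>, so it cannot contain both edges of \<open>u\<close> there.\<close>
  ultimately have "?e1 \<notin> cycle_edges w \<or> ?e2 \<notin> cycle_edges w"
    using assms(5,6) i by (metis insertCI insertE singletonD)
  then obtain j where j: "{u j, u (Suc j)} \<notin> cycle_edges w" "z \<in> {u j, u (Suc j)}"
    using i by auto
  let ?B = "A - {(u j, u (Suc j)), (u (Suc j), u j)}"
  obtain a b where f: "f = {a, b}" using assms(5) by (auto simp: cycle_edges_def)
  let ?C = "?B - {(a, b), (b, a)}"
  have B: "simple_arcs V ?B" using assms(1) by (rule simple_arcs_remove_edge)
  have "double_cyclomatic V (avoiding A {z}) \<le> double_cyclomatic V ?C"
    using simple_arcs_avoiding[OF assms(1), of "{z}"] j(2) assms(6) f
    by (intro double_cyclomatic_mono simple_arcs_remove_edge assms(1))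
      (auto simp: avoiding_def simple_arcs_def)
  also have "\<dots> = double_cyclomatic V ?B - 2"
    using double_cyclomatic_remove_cycle_edge[OF B, of k w a b] assms(3,5) j(1) f
    by (simp add: periodic_cycle_remove_edge)
  also have "\<dots> = double_cyclomatic V A - 4"
    using double_cyclomatic_remove_cycle_edge[OF assms(1,2) cycle_edgeI, of j] by simp
  finally show ?thesis .
qed

text \<open>Of two different edge sets at least one is not contained in the other; that cycle leaves
  the other one at some common vertex, and deleting this vertex destroys both.\<close>

lemma not_cycles_apart_witness:
  assumes "simple_arcs V A" "\<not> cycles_apart A"
  shows "\<exists>z l u. periodic_cycle A l u \<and> z \<in> range u \<and>
    double_cyclomatic V (avoiding A {z}) \<le> double_cyclomatic V A - 4"
proof -
  have *: ?thesis if uw: "periodic_cycle A l u" "periodic_cycle A k w" "x \<in> range u" "x \<in> range w"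
    "\<not> cycle_edges w \<subseteq> cycle_edges u" for l u k w x
  proof -
    obtain z f where "z \<in> range u" "f \<in> cycle_edges w" "z \<in> f" "f \<notin> cycle_edges u"
      using cycle_edges_subset[OF uw(2,3,4)] uw(5) by blast
    from double_cyclomatic_two_cycles[OF assms(1) uw(1,2) this] \<open>z \<in> range u\<close> uw(1)
    show ?thesis by blast
  qed
  obtain l u k w x where uw: "periodic_cycle A l u" "periodic_cycle A k w"
    "cycle_edges u \<noteq> cycle_edges w" "x \<in> range u" "x \<in> range w"
    using assms(2) unfolding cycles_apart_def by blast
  show ?thesis
  proof (cases "cycle_edges w \<subseteq> cycle_edges u")
    case False
    then show ?thesis using * uw by blast
  next
    case True
    then have "\<not> cycle_edges u \<subseteq> cycle_edges w" using uw(3) by blast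
    then show ?thesis using * uw by blast
  qed
qed

section \<open>Existence of cycles and of pendant vertices\<close>

text \<open>A walk that never turns back can be continued for ever and revisits a vertex. A shortest
  return is a cycle; its length is neither 1, as there are no loops, nor 2, as the walk never
  reverses.\<close>

lemma exists_periodic_cycle:
  assumes "finite A" "A \<noteq> {}" "irrefl A"
    and nonpendant: "\<And>a b. (a, b) \<in> A \<Longrightarrow> \<exists>c. (b, c) \<in> A \<and> c \<noteq> a"
  shows "\<exists>l u. periodic_cycle A l u"
proof -
  have "\<exists>f. \<forall>n. f n \<in> A \<and> (fst (f (Suc n)) = snd (f n) \<and> snd (f (Suc n)) \<noteq> fst (f n))"
    by (rule dependent_nat_choice) (use assms(2) nonpendant in fastforce)+
  then obtain f where f: "\<And>n. f n \<in> A" "\<And>n. fst (f (Suc n)) = snd (f n)"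
    "\<And>n. snd (f (Suc n)) \<noteq> fst (f n)" by blast
  define v where "v = (\<lambda>n. fst (f n))"
  have arc: "(v n, v (Suc n)) \<in> A" for n using f(1)[of n] by (simp add: v_def f(2))
  have neq1: "v n \<noteq> v (Suc n)" for n using arc assms(3) by (metis irrefl_def)
  have neq2: "v n \<noteq> v (Suc (Suc n))" for n using f(3)[of n] f(2)[of "Suc n"] by (simp add: v_def)
  have "finite (range v)"
    by (rule finite_subset[of _ "fst ` A"]) (use f(1) assms(1) in \<open>auto simp: v_def\<close>)
  then have "\<not> inj v" using finite_imageD infinite_UNIV_nat by blast
  then obtain i j where "i < j" "v i = v j" by (metis injI linorder_neqE_nat)
  then have ex: "\<exists>d>0. \<exists>i. v i = v (i + d)" by (metis less_imp_add_positive)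
  \<comment> \<open>Least distance between two visits to the same vertex anywhere along the walk;
    minimality makes the vertices in between distinct.\<close>
  define d where "d = (LEAST d. 0 < d \<and> (\<exists>i. v i = v (i + d)))"
  have "0 < d \<and> (\<exists>i. v i = v (i + d))" unfolding d_def by (rule LeastI_ex) (use ex in blast)
  then obtain i where i: "0 < d" "v i = v (i + d)" by blast
  have least: "d \<le> e" if "0 < e" "v k = v (k + e)" for e k
    unfolding d_def by (rule Least_le) (use that in blast)
  have "d \<noteq> 1" "d \<noteq> 2" using i(2) neq1[of i] neq2[of i] by (auto simp: numeral_2_eq_2)
  then have d3: "3 \<le> d" using i(1) by simp
  define u where "u = (\<lambda>n. v (i + n mod d))"
  have "inj_on u {..<d}"
  proof -
    have "\<not> (m < n \<and> n < d \<and> u m = u n)" for m n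
      using least[of "n - m" "i + m"] by (auto simp: u_def)
    then show ?thesis by (metis inj_onI lessThan_iff linorder_neqE_nat)
  qed
  moreover have "(u n, u (Suc n)) \<in> A" for n
  proof (cases "Suc (n mod d) = d")
    case True
    have "u (Suc n) = v (i + Suc (n mod d))" using i(2) True by (simp add: u_def mod_Suc)
    then show ?thesis using arc by (simp add: u_def)
  next
    case False
    then have "u (Suc n) = v (Suc (i + n mod d))" by (simp add: u_def mod_Suc)
    then show ?thesis using arc by (simp add: u_def)
  qed
  ultimately have "periodic_cycle A d u" using d3 by (simp add: periodic_cycle_def u_def)
  then show ?thesis by blast
qed

lemma acyclic_pendant:
  assumes "simple_arcs V A" "A \<noteq> {}" "\<And>l u. \<not> periodic_cycle A l u"
  shows "\<exists>p w. (p, w) \<in> A \<and> (\<forall>x. (p, x) \<in> A \<longrightarrow> x = w)"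
proof (rule ccontr)
  assume *: "\<not> ?thesis"
  have "\<exists>c. (b, c) \<in> A \<and> c \<noteq> a" if "(a, b) \<in> A" for a b
    using * simple_arcs_sym[OF assms(1) that] by blast
  then have "\<exists>l u. periodic_cycle A l u"
    using exists_periodic_cycle[of A] assms simple_arcs_finite[OF assms(1)]
    by (auto simp: simple_arcs_def)
  then show False using assms(3) by blast
qed

text \<open>The edge at a pendant vertex is a bridge, so removing it does not lower the number, and
  pendant vertices exist until no arc is left.\<close>

lemma double_cyclomatic_acyclic:
  assumes "simple_arcs V A" "\<And>l u. \<not> periodic_cycle A l u"
  shows "double_cyclomatic V A \<le> 0"
  using assms
proof (induction "card A" arbitrary: A rule: less_induct)
  case less
  show ?case
  proof (cases "A = {}")
    case False
    obtain p w where pw: "(p, w) \<in> A" "\<And>x. (p, x) \<in> A \<Longrightarrow> x = w"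
      using acyclic_pendant[OF less.prems(1) False less.prems(2)] by blast
    let ?B = "A - {(p, w), (w, p)}"
    have "(p, w) \<notin> ?B\<^sup>*"
    proof
      assume "(p, w) \<in> ?B\<^sup>*"
      then obtain x where "(p, x) \<in> ?B"
        using simple_arcs_neq[OF less.prems(1) pw(1)] by (meson converse_rtranclE)
      then show False using pw(2) by blast
    qed
    then have "double_cyclomatic V A \<le> double_cyclomatic V ?B"
      by (rule double_cyclomatic_remove_bridge[OF less.prems(1) pw(1)])
    also have "\<dots> \<le> 0"
      using card_remove_edge[OF less.prems(1) pw(1)] less.prems
      by (intro less.hyps simple_arcs_remove_edge) (auto simp: periodic_cycle_remove_edge)
    finally show ?thesis .
  qed (simp add: double_cyclomatic_empty)
qed

section \<open>Graphs with pairwise vertex-disjoint cycles\<close>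

lemma cycles_apart_mono: "cycles_apart A \<Longrightarrow> B \<subseteq> A \<Longrightarrow> cycles_apart B"
  unfolding cycles_apart_def by (meson periodic_cycle_mono)

lemma cycles_apart_same_range:
  assumes "cycles_apart A" "periodic_cycle A l u" "periodic_cycle A k w" "range u \<inter> range w \<noteq> {}"
  shows "cycle_edges u = cycle_edges w" "range u = range w"
proof -
  show "cycle_edges u = cycle_edges w" using assms unfolding cycles_apart_def by blast
  then show "range u = range w" using Union_cycle_edges by metis
qed

lemma cycle_setsI: "periodic_cycle A l u \<Longrightarrow> range u \<in> cycle_sets A"
  unfolding cycle_sets_def by blast

lemma cycle_setsE:
  assumes "X \<in> cycle_sets A"
  obtains l u where "X = range u" "periodic_cycle A l u"
  using assms unfolding cycle_sets_def by blast

lemma finite_cycle_sets: "simple_arcs V A \<Longrightarrow> finite (cycle_sets A)"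
  by (rule finite_subset[of _ "Pow V"])
    (auto simp: cycle_sets_def simple_arcs_def periodic_cycle_def)

text \<open>An edge belongs to only one of the disjoint cycles, so cutting it destroys that cycle
  and no other.\<close>

lemma cycle_sets_remove_edge:
  assumes "cycles_apart A" "periodic_cycle A l u"
  shows "cycle_sets (A - {(u 0, u 1), (u 1, u 0)}) = cycle_sets A - {range u}"
proof -
  have e: "{u 0, u 1} \<in> cycle_edges u" using cycle_edgeI[of u 0] by simp
  have "{u 0, u 1} \<in> cycle_edges w \<longleftrightarrow> range w = range u" if "periodic_cycle A k w" for k w
  proof
    assume "{u 0, u 1} \<in> cycle_edges w"
    then have "u 0 \<in> range w" using Union_cycle_edges[of w] by auto
    then show "range w = range u"
      using cycles_apart_same_range(2)[OF assms(1) that assms(2)] by auto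
  next
    assume "range w = range u"
    then have "cycle_edges w = cycle_edges u"
      using cycles_apart_same_range(1)[OF assms(1) that assms(2)] by auto
    then show "{u 0, u 1} \<in> cycle_edges w" using e by simp
  qed
  then show ?thesis unfolding cycle_sets_def periodic_cycle_remove_edge by blast
qed

lemma cycle_sets_avoiding:
  assumes "cycles_apart A" "periodic_cycle A l u" "v \<in> range u"
  shows "cycle_sets (avoiding A {v}) = cycle_sets A - {range u}"
proof -
  have "v \<in> range w \<longleftrightarrow> range w = range u" if "periodic_cycle A k w" for k w
    using cycles_apart_same_range(2)[OF assms(1) that assms(2)] assms(3) by blast
  moreover have "X \<in> cycle_sets (avoiding A {v}) \<longleftrightarrow>
      (\<exists>k w. X = range w \<and> periodic_cycle A k w \<and> v \<notin> range w)" for X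
    unfolding cycle_sets_def periodic_cycle_avoiding by auto
  ultimately have "X \<in> cycle_sets (avoiding A {v}) \<longleftrightarrow>
      (\<exists>k w. X = range w \<and> periodic_cycle A k w \<and> range w \<noteq> range u)" for X by metis
  moreover have "X \<in> cycle_sets A - {range u} \<longleftrightarrow>
      (\<exists>k w. X = range w \<and> periodic_cycle A k w \<and> range w \<noteq> range u)" for X
    unfolding cycle_sets_def Diff_iff mem_Collect_eq singleton_iff by metis
  ultimately have "X \<in> cycle_sets (avoiding A {v}) \<longleftrightarrow> X \<in> cycle_sets A - {range u}" for X
    by (simp only:)
  then show ?thesis by blast
qed

text \<open>Cutting one edge of a cycle removes exactly one member of \<open>cycle_sets A\<close>
  and lowers the doubled number by at most 2; what remains in the end is acyclic.\<close>

lemma double_cyclomatic_le_cycle_sets: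
  assumes "simple_arcs V A" "cycles_apart A"
  shows "double_cyclomatic V A \<le> 2 * int (card (cycle_sets A))"
  using assms
proof (induction "card A" arbitrary: A rule: less_induct)
  case less
  show ?case
  proof (cases "\<exists>l u. periodic_cycle A l u")
    case False
    then show ?thesis using double_cyclomatic_acyclic[OF less.prems(1)] by force
  next
    case True
    then obtain l u where u: "periodic_cycle A l u" by blast
    then have arc: "(u 0, u 1) \<in> A" by (simp add: periodic_cycle_def)
    let ?B = "A - {(u 0, u 1), (u 1, u 0)}"
    have "double_cyclomatic V A \<le> double_cyclomatic V ?B + 2"
      by (rule double_cyclomatic_remove_edge(2)[OF less.prems(1) arc])
    moreover have "double_cyclomatic V ?B \<le> 2 * int (card (cycle_sets ?B))"
      using card_remove_edge[OF less.prems(1) arc]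
      by (intro less.hyps simple_arcs_remove_edge cycles_apart_mono[OF less.prems(2)] less.prems) auto
    moreover have "range u \<in> cycle_sets A" using u by (auto simp: cycle_sets_def)
    then have "card (cycle_sets A) = card (cycle_sets ?B) + 1"
      unfolding cycle_sets_remove_edge[OF less.prems(2) u]
      using finite_cycle_sets[OF less.prems(1)] by (metis Suc_eq_plus1 card_Suc_Diff1)
    ultimately show ?thesis by simp
  qed
qed

text \<open>A chord and a stretch of the cycle between its ends form a second cycle, which meets the
  first but has other edges.\<close>

lemma cycles_apart_chordless:
  assumes "simple_arcs V A" "cycles_apart A" "periodic_cycle A l u" "(u i, u j) \<in> A"
  shows "{u i, u j} \<in> cycle_edges u"
proof (rule ccontr)
  assume chord: "{u i, u j} \<notin> cycle_edges u"
  define w where "w = (\<lambda>n. u (n + i))"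
  have w: "periodic_cycle A l w" "cycle_edges w = cycle_edges u" "range w = range u"
    unfolding w_def
    using periodic_cycle_shift[OF assms(3)] shift_cycle_edges[OF assms(3)] shift_range[OF assms(3)]
    by auto
  obtain n where n: "n < l" "u j = w n" using periodic_cycle_range[OF w(1)] w(3) by blast
  have arc: "(w 0, w n) \<in> A" and chord: "{w 0, w n} \<notin> cycle_edges w"
    using assms(4) chord n(2) w(2) by (simp_all add: w_def)
  have l: "3 \<le> l" and per: "w (m + l) = w m" and step: "(w m, w (Suc m)) \<in> A" for m
    using w(1) by (auto simp: periodic_cycle_def)
  have "n \<noteq> 0" using simple_arcs_neq[OF assms(1) arc] by metis
  moreover have "n \<noteq> 1" using chord cycle_edgeI[of w 0] by auto
  ultimately have n2: "2 \<le> n" by simp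
  \<comment> \<open>The stretch from \<open>w 0\<close> to \<open>w n\<close>, closed by the
    chord.\<close>
  define x where "x = (\<lambda>m. w (m mod Suc n))"
  have "(x m, x (Suc m)) \<in> A" for m
  proof (cases "m mod Suc n = n")
    case True
    then show ?thesis using simple_arcs_sym[OF assms(1) arc] by (simp add: x_def mod_Suc)
  next
    case False
    then show ?thesis using step by (simp add: x_def mod_Suc)
  qed
  moreover have "inj_on x {..<Suc n}"
    using w(1) n(1) by (auto simp: x_def periodic_cycle_def inj_on_def)
  moreover have "x (m + Suc n) = x m" for m unfolding x_def mod_add_self2 ..
  ultimately have x: "periodic_cycle A (Suc n) x" using n2 by (simp add: periodic_cycle_def)
  have "{x n, x (Suc n)} \<in> cycle_edges x" by (rule cycle_edgeI)
  then have "{w 0, w n} \<in> cycle_edges x" by (simp add: x_def insert_commute)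
  moreover have "x 0 \<in> range w" by (simp add: x_def)
  ultimately show False using cycles_apart_same_range(1)[OF assms(2) x w(1)] chord by blast
qed

text \<open>A degree count: every nonisolated vertex has degree at least 2. For a set
  \<open>S\<close> of nonisolated vertices in different components, the cyclomatic bound gives
  \<open>card A + 2 * card S \<le> 2 * card (Domain A) + 2\<close>. With one vertex in
  \<open>S\<close> all degrees are 2, so no edge leaves the cycle; with a second vertex off the
  cycle there would be too few arcs for these degrees.\<close>

lemma no_pendant_unicyclic:
  assumes "simple_arcs V A" "periodic_cycle A l u" "double_cyclomatic V A \<le> 2"
    and nonpendant: "\<And>a b. (a, b) \<in> A \<Longrightarrow> \<exists>c. (b, c) \<in> A \<and> c \<noteq> a"
    and xy: "(x, y) \<in> A"
  shows "{x, y} \<in> cycle_edges u"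
proof -
  let ?D = "Domain A"
  let ?iso = "(\<lambda>v. {v}) ` (V - ?D)"
  have fin: "finite V" "finite A" "sym A" and DV: "?D \<subseteq> V"
    using assms(1) simple_arcs_finite[OF assms(1)] by (auto simp: simple_arcs_def)
  have finD: "finite ?D" using DV fin(1) finite_subset by blast
  have "A = Sigma ?D (\<lambda>v. A `` {v})" by auto
  then have cardA: "card A = (\<Sum>v\<in>?D. card (A `` {v}))"
    using card_SigmaI[OF finD, of "\<lambda>v. A `` {v}"] fin(2) by (simp add: finite_Image)
  have finI: "finite (A `` {v})" for v using fin(2) by (simp add: finite_Image)
  have deg: "2 \<le> card (A `` {v})" if "v \<in> ?D" for v
  proof -
    obtain b where b: "(v, b) \<in> A" using \<open>v \<in> ?D\<close> by blast
    obtain c where "(v, c) \<in> A" "c \<noteq> b"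
      using nonpendant[OF simple_arcs_sym[OF assms(1) b]] by blast
    then have "card {b, c} \<le> card (A `` {v})" using b finI by (intro card_mono) auto
    then show ?thesis using \<open>c \<noteq> b\<close> by simp
  qed
  have iso: "A\<^sup>* `` {v} = {v}" if "v \<notin> ?D" for v using that by (auto elim: converse_rtranclE)
  have comps: "?iso \<union> (\<lambda>v. A\<^sup>* `` {v}) ` S \<subseteq> components V A" if "S \<subseteq> ?D" for S
    using that DV iso by (auto simp: components_def quotient_def) (metis DiffI Domain.DomainI)
  have card_comps: "card (components V A) \<ge> card V - card ?D + card S"
    if S: "S \<subseteq> ?D" "inj_on (\<lambda>v. A\<^sup>* `` {v}) S" for S
  proof -
    have "?iso \<inter> (\<lambda>v. A\<^sup>* `` {v}) ` S = {}"
    proof -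
      have "{v} \<noteq> A\<^sup>* `` {w}" if "v \<notin> ?D" "w \<in> S" for v w
      proof
        assume eq: "{v} = A\<^sup>* `` {w}"
        have "w \<in> A\<^sup>* `` {w}" by simp
        then have "w = v" unfolding eq[symmetric] by simp
        then show False using that S(1) by blast
      qed
      then show ?thesis by blast
    qed
    moreover have "finite S" using S(1) finD finite_subset by blast
    ultimately have "card (?iso \<union> (\<lambda>v. A\<^sup>* `` {v}) ` S) = card ?iso + card S"
      using fin(1) S(2) by (subst card_Un_disjoint) (auto simp: card_image)
    also have "card ?iso = card V - card ?D"
      using DV finD by (simp add: card_image card_Diff_subset)
    finally show ?thesis using card_mono[OF finite_components[OF fin(1)] comps[OF S(1)]] by simp
  qed
  have cDV: "card ?D \<le> card V" using DV fin(1) by (simp add: card_mono)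
  have lower: "card A + 2 * card S \<le> 2 * card ?D + 2"
    if "S \<subseteq> ?D" "inj_on (\<lambda>v. A\<^sup>* `` {v}) S" for S
    using card_comps[OF that] assms(3) cDV unfolding double_cyclomatic_def by linarith
  have step: "(u i, u (Suc i)) \<in> A" for i using assms(2) by (simp add: periodic_cycle_def)
  have u0: "u 0 \<in> ?D" using step by blast
  have "card A \<le> 2 * card ?D" using lower[of "{u 0}"] u0 by simp
  then have "(\<Sum>v\<in>?D. card (A `` {v})) \<le> (\<Sum>v\<in>?D. 2)" using cardA by simp
  then have deg2: "card (A `` {v}) = 2" if "v \<in> ?D" for v
    using sum_mono_inv[of "\<lambda>_. 2" ?D "\<lambda>v. card (A `` {v})"] deg that finD
    by (metis (no_types, lifting) le_antisym sum_mono)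
  have nbrs: "A `` {u (Suc i)} = {u i, u (Suc (Suc i))}" for i
  proof (rule card_subset_eq[symmetric, OF finI])
    show "{u i, u (Suc (Suc i))} \<subseteq> A `` {u (Suc i)}"
      using step simple_arcs_sym[OF assms(1)] by auto
    show "card {u i, u (Suc (Suc i))} = card (A `` {u (Suc i)})"
      using periodic_cycle_neq(2)[OF assms(2), of i] deg2[of "u (Suc i)", OF DomainI[OF step[of "Suc i"]]]
      by simp
  qed
  have nbr: "\<exists>i. v = u (Suc i) \<and> (w = u i \<or> w = u (Suc (Suc i)))"
    if v: "v \<in> range u" "(v, w) \<in> A" for v w
  proof -
    obtain j where "v = u j" using v(1) by (rule imageE)
    then obtain i where i: "v = u (Suc i)" using periodic_index[OF assms(2), of j 1] by auto
    then have "w \<in> A `` {u (Suc i)}" using v(2) by simp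
    then show ?thesis unfolding nbrs using i by (intro exI[of _ i]) simp
  qed
  have closed: "w \<in> range u" if "v \<in> range u" "(v, w) \<in> A" for v w
    using nbr[OF that] by auto
  have "x \<in> range u"
  proof (rule ccontr)
    assume x: "x \<notin> range u"
    have reach: "v \<in> range u" if "(u 0, v) \<in> A\<^sup>*" for v
      using that by (induction rule: rtrancl_induct) (use closed in auto)
    then have "(u 0, x) \<notin> A\<^sup>*" using x by blast
    then have "inj_on (\<lambda>v. A\<^sup>* `` {v}) {u 0, x}"
      using rtrancl_class_eq_iff[OF fin(3), of "u 0" x] by auto
    moreover have "u 0 \<noteq> x" using x by blast
    ultimately have "card A + 4 \<le> 2 * card ?D + 2" using lower[of "{u 0, x}"] u0 xy by auto
    moreover have "2 * card ?D \<le> card A"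
      unfolding cardA using sum_mono[of ?D "\<lambda>_. 2" "\<lambda>v. card (A `` {v})"] deg by simp
    ultimately show False by simp
  qed
  then obtain i where "x = u (Suc i)" "y = u i \<or> y = u (Suc (Suc i))" using nbr[OF _ xy] by blast
  then show ?thesis using cycle_edgeI[of u i] cycle_edgeI[of u "Suc i"] by (auto simp: insert_commute)
qed

section \<open>Matchings\<close>

definition arc_matching :: "'a rel \<Rightarrow> 'a set set \<Rightarrow> bool" where
  "arc_matching A M \<longleftrightarrow> M \<subseteq> undirected A \<and> disjoint M"

definition arc_matching_number :: "'a rel \<Rightarrow> nat" where
  "arc_matching_number A = Max {card M | M. arc_matching A M}"

lemma undirected_iff: "simple_arcs V A \<Longrightarrow> {a, b} \<in> undirected A \<longleftrightarrow> (a, b) \<in> A"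
  by (auto simp: undirected_def doubleton_eq_iff dest: simple_arcs_sym)

lemma arc_matching_edge:
  assumes "arc_matching A M" "e \<in> M"
  obtains a b where "e = {a, b}" "(a, b) \<in> A"
  using assms by (auto simp: arc_matching_def undirected_def)

lemma arc_matching_finite:
  assumes "arc_matching A M" "simple_arcs V A"
  shows "finite M"
  using assms simple_arcs_finite[OF assms(2)] finite_subset
  by (auto simp: arc_matching_def undirected_def)

lemma card_Union_arc_matching:
  assumes "arc_matching A M" "simple_arcs V A"
  shows "card (\<Union> M) = 2 * card M"
proof -
  have "card e = 2" "finite e" if "e \<in> M" for e
    using arc_matching_edge[OF assms(1) that] simple_arcs_neq[OF assms(2)] by (metis card_2_iff finite.emptyI finite.insertI)+
  moreover have "card (\<Union> M) = sum card M"
    using assms(1) calculation(2) by (intro card_Union_disjoint)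
      (auto simp: arc_matching_def disjoint_def pairwise_def disjnt_def)
  ultimately show ?thesis by simp
qed

lemma arc_matching_disjoint: "arc_matching A M \<Longrightarrow> e \<in> M \<Longrightarrow> f \<in> M \<Longrightarrow> x \<in> e \<Longrightarrow> x \<in> f \<Longrightarrow> e = f"
  by (auto simp: arc_matching_def disjoint_def)

lemma finite_arc_matching_cards:
  assumes "simple_arcs V A"
  shows "finite {card M | M. arc_matching A M}"
proof -
  have "{card M | M. arc_matching A M} \<subseteq> card ` Pow (undirected A)"
    by (auto simp: arc_matching_def)
  moreover have "finite (undirected A)"
    using simple_arcs_finite[OF assms] by (simp add: undirected_def)
  ultimately show ?thesis by (meson finite_Pow_iff finite_imageI finite_subset)
qed

lemma arc_matching_empty: "arc_matching A {}"
  by (simp add: arc_matching_def disjoint_def)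

lemma arc_matching_number_ge:
  assumes "simple_arcs V A" "arc_matching A M"
  shows "card M \<le> arc_matching_number A"
  unfolding arc_matching_number_def
  by (rule Max_ge[OF finite_arc_matching_cards[OF assms(1)]]) (use assms(2) in blast)

lemma arc_matching_number_attained:
  assumes "simple_arcs V A"
  obtains M where "arc_matching A M" "card M = arc_matching_number A"
proof -
  have "arc_matching_number A \<in> {card M | M. arc_matching A M}"
    unfolding arc_matching_number_def
    using arc_matching_empty by (intro Max_in finite_arc_matching_cards[OF assms]) blast
  then show ?thesis using that by fastforce
qed

lemma arc_matching_avoiding_iff:
  "arc_matching (avoiding A S) M \<longleftrightarrow> arc_matching A M \<and> \<Union> M \<inter> S = {}"
proof -
  have "{a, b} \<in> undirected (avoiding A S) \<longleftrightarrow> {a, b} \<in> undirected A \<and> {a, b} \<inter> S = {}" for a b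
    by (auto simp: undirected_def avoiding_def doubleton_eq_iff) blast+
  moreover have "\<exists>a b. e = {a, b}" if "e \<in> undirected A \<or> e \<in> undirected (avoiding A S)" for e
    using that by (auto simp: undirected_def)
  ultimately have "e \<in> undirected (avoiding A S) \<longleftrightarrow> e \<in> undirected A \<and> e \<inter> S = {}" for e
    by metis
  then show ?thesis unfolding arc_matching_def by blast
qed

lemma arc_matching_subset: "arc_matching A M \<Longrightarrow> N \<subseteq> M \<Longrightarrow> arc_matching A N"
  unfolding arc_matching_def disjoint_def by (meson subset_iff)

lemma arc_matching_restrict:
  assumes "arc_matching A M" "simple_arcs V A"
  shows "arc_matching (avoiding A {v}) {e \<in> M. v \<notin> e}" "card M \<le> card {e \<in> M. v \<notin> e} + 1"
proof -
  show "arc_matching (avoiding A {v}) {e \<in> M. v \<notin> e}"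
    unfolding arc_matching_avoiding_iff using arc_matching_subset[OF assms(1)] by auto
  have fin: "finite M" using arc_matching_finite[OF assms] .
  have "card {e \<in> M. v \<in> e} \<le> 1"
    using arc_matching_disjoint[OF assms(1)] fin by (subst One_nat_def, subst card_le_Suc0_iff_eq) auto
  moreover have "card ({e \<in> M. v \<notin> e} \<union> {e \<in> M. v \<in> e}) \<le> card {e \<in> M. v \<notin> e} + card {e \<in> M. v \<in> e}"
    by (rule card_Un_le)
  moreover have "M = {e \<in> M. v \<notin> e} \<union> {e \<in> M. v \<in> e}" by auto
  ultimately show "card M \<le> card {e \<in> M. v \<notin> e} + 1" by simp
qed

lemma arc_matching_number_avoiding:
  assumes "simple_arcs V A"
  shows "arc_matching_number A \<le> arc_matching_number (avoiding A {v}) + 1"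
proof -
  obtain M where M: "arc_matching A M" "card M = arc_matching_number A"
    using arc_matching_number_attained[OF assms] by blast
  show ?thesis
    using arc_matching_restrict(2)[OF M(1) assms, of v] M(2)
      arc_matching_number_ge[OF simple_arcs_avoiding[OF assms] arc_matching_restrict(1)[OF M(1) assms, of v]]
    by linarith
qed

lemma arc_matching_union:
  assumes "arc_matching A M" "arc_matching A N" "\<Union> M \<inter> \<Union> N = {}"
  shows "arc_matching A (M \<union> N)"
proof -
  have "e = f" if "e \<in> M \<union> N" "f \<in> M \<union> N" "x \<in> e" "x \<in> f" for e f x
    using that(1,2)
  proof (elim UnE)
    assume "e \<in> M" "f \<in> N"
    then show ?thesis using that(3,4) assms(3) by blast
  next
    assume "e \<in> N" "f \<in> M"
    then show ?thesis using that(3,4) assms(3) by blast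
  qed (use that(3,4) arc_matching_disjoint[OF assms(1)] arc_matching_disjoint[OF assms(2)] in blast)+
  then have "disjoint (M \<union> N)" by (intro disjointI) blast
  then show ?thesis using assms(1,2) by (simp add: arc_matching_def)
qed

lemma card_arc_matching_union:
  assumes "arc_matching A M" "arc_matching A N" "\<Union> M \<inter> \<Union> N = {}" "simple_arcs V A"
  shows "card (M \<union> N) = card M + card N"
proof (rule card_Un_disjoint)
  show "finite M" "finite N" using assms arc_matching_finite by blast+
  have "e \<noteq> {}" if "e \<in> M" for e using arc_matching_edge[OF assms(1) that] by auto
  then show "M \<inter> N = {}" using assms(3) by blast
qed

text \<open>Pairs up the first \<open>2 * t\<close> vertices: a perfect matching of an even cycle if
  \<open>2 * t = l\<close>, and after a shift one of the path left by removing vertices.\<close>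

definition alternating_edges :: "(nat \<Rightarrow> 'a) \<Rightarrow> nat \<Rightarrow> 'a set set" where
  "alternating_edges u t = (\<lambda>k. {u (2 * k), u (Suc (2 * k))}) ` {..<t}"

lemma alternating_edges:
  assumes "periodic_cycle A l u" "2 * t \<le> l"
  shows "arc_matching A (alternating_edges u t)" "card (alternating_edges u t) = t"
    "\<Union> (alternating_edges u t) = u ` {..<2 * t}"
proof -
  have inj: "u i = u j \<longleftrightarrow> i = j" if "i < 2 * t" "j < 2 * t" for i j
    using assms that unfolding periodic_cycle_def by (meson inj_onD lessThan_iff less_le_trans)
  have eq: "j = k" if "j < t" "k < t" "{u (2 * j), u (Suc (2 * j))} \<inter> {u (2 * k), u (Suc (2 * k))} \<noteq> {}" for j k
  proof -
    have "2 * j < 2 * t" "Suc (2 * j) < 2 * t" "2 * k < 2 * t" "Suc (2 * k) < 2 * t" using that(1,2) by auto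
    with that(3) have "2 * j = 2 * k \<or> Suc (2 * j) = 2 * k \<or> 2 * j = Suc (2 * k) \<or> Suc (2 * j) = Suc (2 * k)"
      by (auto simp: inj)
    then show ?thesis by presburger
  qed
  show "arc_matching A (alternating_edges u t)"
    unfolding arc_matching_def
  proof
    show "alternating_edges u t \<subseteq> undirected A"
      using assms(1) by (fastforce simp: alternating_edges_def undirected_def periodic_cycle_def)
    show "disjoint (alternating_edges u t)"
    proof (rule disjointI)
      fix e f assume "e \<in> alternating_edges u t" "f \<in> alternating_edges u t" "e \<noteq> f"
      then obtain j k where jk: "j < t" "e = {u (2 * j), u (Suc (2 * j))}"
        "k < t" "f = {u (2 * k), u (Suc (2 * k))}" "j \<noteq> k" by (auto simp: alternating_edges_def)
      then show "e \<inter> f = {}" using eq by metis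
    qed
  qed
  have "inj_on (\<lambda>k. {u (2 * k), u (Suc (2 * k))}) {..<t}"
    by (rule inj_onI) (use eq in force)
  then show "card (alternating_edges u t) = t"
    by (simp add: alternating_edges_def card_image)
  have "\<exists>k<t. i = 2 * k \<or> i = Suc (2 * k)" if "i < 2 * t" for i
    using that by (intro exI[of _ "i div 2"]) linarith
  then show "\<Union> (alternating_edges u t) = u ` {..<2 * t}"
    by (fastforce simp: alternating_edges_def)
qed

section \<open>The rank of a gain graph\<close>

definition gain_entry :: "('a \<times> 'a \<Rightarrow> complex) \<Rightarrow> 'a rel \<Rightarrow> 'a \<Rightarrow> 'a \<Rightarrow> complex" where
  "gain_entry \<phi> A a b = (if (a, b) \<in> A then \<phi> (a, b) else 0)"

definition arc_rank :: "('a \<times> 'a \<Rightarrow> complex) \<Rightarrow> 'a rel \<Rightarrow> nat" where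
  "arc_rank \<phi> A = (LEAST k. rank_le (gain_entry \<phi> A) k)"

definition gain_on :: "('a \<times> 'a \<Rightarrow> complex) \<Rightarrow> 'a rel \<Rightarrow> bool" where
  "gain_on \<phi> A \<longleftrightarrow> (\<forall>(a, b)\<in>A. \<phi> (a, b) * \<phi> (b, a) = 1)"

lemma gain_on_subset: "gain_on \<phi> A \<Longrightarrow> B \<subseteq> A \<Longrightarrow> gain_on \<phi> B"
  by (auto simp: gain_on_def)

lemma gain_on_avoiding: "gain_on \<phi> A \<Longrightarrow> gain_on \<phi> (avoiding A S)"
  by (rule gain_on_subset[OF _ avoiding_subset])

lemma rank_le_arc_rank:
  assumes "simple_arcs V A"
  shows "rank_le (gain_entry \<phi> A) (arc_rank \<phi> A)"
proof -
  have fin: "finite V" and V: "A \<subseteq> V \<times> V" using assms by (auto simp: simple_arcs_def)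
  have "gain_entry \<phi> A a b = (\<Sum>v\<in>V. (if a = v then 1 else 0) * gain_entry \<phi> A v b)" for a b
  proof (cases "a \<in> V")
    case True
    have "(\<Sum>v\<in>V. (if a = v then 1 else 0) * gain_entry \<phi> A v b) =
        (\<Sum>v\<in>V. if v = a then gain_entry \<phi> A a b else 0)"
      by (rule sum.cong) auto
    then show ?thesis using True fin by simp
  next
    case False
    then have "gain_entry \<phi> A a b = 0" using V by (auto simp: gain_entry_def)
    moreover have "(\<Sum>v\<in>V. (if a = v then 1 else 0) * gain_entry \<phi> A v b) = 0"
      by (rule sum.neutral) (use False in auto)
    ultimately show ?thesis by simp
  qed
  then have "rank_le (gain_entry \<phi> A) (card V)" by (rule rank_leI[OF fin order_refl])
  then show ?thesis unfolding arc_rank_def by (rule LeastI)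
qed

lemma arc_rank_le: "rank_le (gain_entry \<phi> A) k \<Longrightarrow> arc_rank \<phi> A \<le> k"
  unfolding arc_rank_def by (rule Least_le)

text \<open>Clearing rows and columns is multiplication by 0-1 factors on both sides, which acts on
  the factors of each product.\<close>

lemma arc_rank_avoiding_le:
  assumes "simple_arcs V A"
  shows "arc_rank \<phi> (avoiding A S) \<le> arc_rank \<phi> A"
proof -
  have "gain_entry \<phi> (avoiding A S) =
      (\<lambda>a b. (if a \<in> S then 0 else 1) * gain_entry \<phi> A a b * (if b \<in> S then 0 else 1))"
    by (auto simp: gain_entry_def avoiding_def fun_eq_iff)
  then show ?thesis
    using arc_rank_le[of \<phi> "avoiding A S"]
      rank_le_scale[OF rank_le_arc_rank[OF assms], of "\<lambda>a. if a \<in> S then 0 else 1" \<phi>] by simp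
qed

text \<open>The row and the column of \<open>v\<close> contribute one product term each.\<close>

lemma arc_rank_le_avoiding_vertex:
  assumes "simple_arcs V A"
  shows "arc_rank \<phi> A \<le> arc_rank \<phi> (avoiding A {v}) + 2"
proof (rule arc_rank_le)
  let ?h = "gain_entry \<phi> A"
  have "rank_le (\<lambda>a b. (if a = v then 1 else 0) * ?h v b) 1"
    by (rule rank_leI[of "{()}" _ _ "\<lambda>_ a. if a = v then 1 else 0" "\<lambda>_. ?h v"]) auto
  \<comment> \<open>The entry at (v, v) already belongs to the row part; \<open>a \<noteq> v\<close>
    keeps it from being counted twice.\<close>
  moreover have "rank_le (\<lambda>a b. ?h a v * (if b = v \<and> a \<noteq> v then 1 else 0)) 1"
    by (rule rank_leI[of "{()}" _ _ "\<lambda>_ a. if a = v then 0 else ?h a v" "\<lambda>_ b. if b = v then 1 else 0"]) auto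
  ultimately have "rank_le (\<lambda>a b. (if a = v then 1 else 0) * ?h v b +
      ?h a v * (if b = v \<and> a \<noteq> v then 1 else 0)) (1 + 1)" by (rule rank_le_add)
  from rank_le_add[OF rank_le_arc_rank[OF simple_arcs_avoiding[OF assms], of \<phi> "{v}"] this]
  have "rank_le (\<lambda>a b. gain_entry \<phi> (avoiding A {v}) a b + ((if a = v then 1 else 0) * ?h v b +
      ?h a v * (if b = v \<and> a \<noteq> v then 1 else 0))) (arc_rank \<phi> (avoiding A {v}) + 2)" by simp
  moreover have "(\<lambda>a b. gain_entry \<phi> (avoiding A {v}) a b + ((if a = v then 1 else 0) * ?h v b +
      ?h a v * (if b = v \<and> a \<noteq> v then 1 else 0))) = ?h"
    by (auto simp: gain_entry_def avoiding_def fun_eq_iff)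
  ultimately show "rank_le ?h (arc_rank \<phi> (avoiding A {v}) + 2)" by (simp only:)
qed

lemma arc_rank_le_avoiding:
  assumes "simple_arcs V A" "finite K"
  shows "arc_rank \<phi> A \<le> arc_rank \<phi> (avoiding A K) + 2 * card K"
  using assms(2)
proof (induction K rule: finite_induct)
  case empty
  then show ?case by (simp add: avoiding_def)
next
  case (insert x K)
  have "avoiding A (insert x K) = avoiding (avoiding A K) {x}" by (auto simp: avoiding_def)
  then show ?case
    using arc_rank_le_avoiding_vertex[OF simple_arcs_avoiding[OF assms(1), of K], of \<phi> x] insert by simp
qed

text \<open>Row \<open>p\<close> and column \<open>p\<close> have their only nonzero entry at
  \<open>w\<close>, so clearing column \<open>w\<close> and then row \<open>w\<close> lowers the
  rank by one each time.\<close>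

lemma arc_rank_pendant:
  assumes "simple_arcs V A" "gain_on \<phi> A" "(p, w) \<in> A" "\<And>x. (p, x) \<in> A \<Longrightarrow> x = w"
  shows "arc_rank \<phi> (avoiding A {w}) + 2 \<le> arc_rank \<phi> A"
proof -
  let ?h = "gain_entry \<phi> A" and ?k = "arc_rank \<phi> A"
  have wp: "(w, p) \<in> A" using simple_arcs_sym[OF assms(1,3)] .
  have pw: "p \<noteq> w" using simple_arcs_neq[OF assms(1,3)] .
  have nz: "?h p w \<noteq> 0" "?h w p \<noteq> 0"
    using assms(2,3) wp by (auto simp: gain_on_def gain_entry_def)
  have col: "?h p b = 0" "?h b p = 0" if "b \<noteq> w" for b
    using that assms(4) simple_arcs_sym[OF assms(1)] by (auto simp: gain_entry_def)
  have h: "rank_le ?h ?k" by (rule rank_le_arc_rank[OF assms(1)])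
  let ?h1 = "\<lambda>a b. if b = w then 0 else ?h a b"
  have h1: "rank_le ?h1 (?k - 1)"
    by (rule rank_le_zero_column[OF h nz(1)]) (use col in auto)
  let ?h2 = "\<lambda>a b. if b = w then 0 else ?h1 b a"
  have "rank_le (\<lambda>a b. ?h1 b a) (?k - 1)" using rank_le_transpose h1 by blast
  then have "rank_le ?h2 (?k - 1 - 1)"
    by (rule rank_le_zero_column[of _ _ p]) (use nz pw col in auto)
  then have "rank_le (\<lambda>a b. ?h2 b a) (?k - 1 - 1)" using rank_le_transpose by blast
  moreover have "(\<lambda>a b. ?h2 b a) = gain_entry \<phi> (avoiding A {w})"
    by (auto simp: gain_entry_def avoiding_def fun_eq_iff)
  ultimately have "arc_rank \<phi> (avoiding A {w}) \<le> ?k - 1 - 1" using arc_rank_le[of \<phi> "avoiding A {w}"] by simp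
  \<comment> \<open>Subtraction on \<open>nat\<close> truncates, so both decrements must be shown to
    be genuine.\<close>
  moreover have "?k - 1 \<noteq> 0"
  proof
    assume "?k - 1 = 0"
    then have "?h1 w p = 0" using h1 by (simp add: rank_le_def)
    then show False using nz(2) pw by simp
  qed
  ultimately show ?thesis by linarith
qed

lemma arc_rank_lower_bound:
  assumes "simple_arcs V A" "gain_on \<phi> A"
  shows "2 * int (arc_matching_number A) - double_cyclomatic V A \<le> int (arc_rank \<phi> A)"
  using assms
proof (induction "card A" arbitrary: A rule: less_induct)
  case less
  note A = less.prems
  have IH: "2 * int (arc_matching_number (avoiding A {v})) - double_cyclomatic V (avoiding A {v})
      \<le> int (arc_rank \<phi> (avoiding A {v}))" if "(v, w) \<in> A" for v w
  proof (rule less.hyps[OF _ simple_arcs_avoiding[OF A(1)] gain_on_avoiding[OF A(2)]])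
    have "avoiding A {v} \<subset> A" using that by (auto simp: avoiding_def)
    then show "card (avoiding A {v}) < card A" using simple_arcs_finite[OF A(1)] psubset_card_mono by blast
  qed
  consider "A = {}" | l u where "periodic_cycle A l u" | "A \<noteq> {}" "\<And>l u. \<not> periodic_cycle A l u" by blast
  then show ?case
  proof cases
    case 1
    have "arc_matching_number A = 0"
    proof -
      obtain M where M: "arc_matching A M" "card M = arc_matching_number A"
        using arc_matching_number_attained[OF A(1)] by blast
      then have "M = {}" using 1 by (auto simp: arc_matching_def undirected_def)
      then show ?thesis using M(2) by simp
    qed
    then show ?thesis using 1 by (simp add: double_cyclomatic_empty)
  next
    case 2
    then have "(u 0, u 1) \<in> A" by (simp add: periodic_cycle_def)
    from IH[OF this] show ?thesis
      using double_cyclomatic_avoid_cyclic_vertex[OF A(1) 2, of "u 0"]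
        arc_matching_number_avoiding[OF A(1), of "u 0"] arc_rank_avoiding_le[OF A(1), of \<phi> "{u 0}"]
      by auto
  next
    case 3
    obtain p w where pw: "(p, w) \<in> A" "\<And>x. (p, x) \<in> A \<Longrightarrow> x = w"
      using acyclic_pendant[OF A(1) 3] by blast
    have "double_cyclomatic V (avoiding A {w}) \<le> double_cyclomatic V A"
      using simple_arcs_avoiding[OF A(1), of "{w}"]
      by (intro double_cyclomatic_mono[OF A(1)] avoiding_subset) (simp add: simple_arcs_def)
    then show ?thesis
      using IH[OF simple_arcs_sym[OF A(1) pw(1)]] arc_rank_pendant[OF A pw]
        arc_matching_number_avoiding[OF A(1), of w] by linarith
  qed
qed

section \<open>Graphs attaining the lower bound\<close>

definition rank_tight :: "'a set \<Rightarrow> ('a \<times> 'a \<Rightarrow> complex) \<Rightarrow> 'a rel \<Rightarrow> bool" where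
  "rank_tight V \<phi> A \<longleftrightarrow>
     int (arc_rank \<phi> A) = 2 * int (arc_matching_number A) - double_cyclomatic V A"

lemma rank_tight_avoid_cyclic_vertex:
  assumes "simple_arcs V A" "gain_on \<phi> A" "rank_tight V \<phi> A" "periodic_cycle A l u" "v \<in> range u"
  shows "rank_tight V \<phi> (avoiding A {v})"
    "arc_matching_number A = arc_matching_number (avoiding A {v}) + 1"
    "double_cyclomatic V (avoiding A {v}) = double_cyclomatic V A - 2"
  using arc_rank_lower_bound[OF simple_arcs_avoiding[OF assms(1), of "{v}"] gain_on_avoiding[OF assms(2)]]
    double_cyclomatic_avoid_cyclic_vertex[OF assms(1,4,5)]
    arc_matching_number_avoiding[OF assms(1), of v] arc_rank_avoiding_le[OF assms(1), of \<phi> "{v}"]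
    assms(3) unfolding rank_tight_def by linarith+

lemma rank_tight_cycles_apart:
  assumes "simple_arcs V A" "gain_on \<phi> A" "rank_tight V \<phi> A"
  shows "cycles_apart A"
proof (rule ccontr)
  assume "\<not> cycles_apart A"
  then obtain z l u where z: "periodic_cycle A l u" "z \<in> range u"
    "double_cyclomatic V (avoiding A {z}) \<le> double_cyclomatic V A - 4"
    using not_cycles_apart_witness[OF assms(1)] by blast
  show False using z(3) rank_tight_avoid_cyclic_vertex(3)[OF assms z(1,2)] by simp
qed

text \<open>For the last claim: with \<open>w\<close> on a cycle, the lower bound for the smaller
  graph would be at least the rank of the whole graph, although the rank falls by 2.\<close>

lemma rank_tight_pendant:
  assumes "simple_arcs V A" "gain_on \<phi> A" "rank_tight V \<phi> A"
    and "(p, w) \<in> A" "\<And>x. (p, x) \<in> A \<Longrightarrow> x = w"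
  shows "rank_tight V \<phi> (avoiding A {w})"
    "arc_matching_number A = arc_matching_number (avoiding A {w}) + 1"
    "periodic_cycle A l u \<Longrightarrow> w \<notin> range u"
proof -
  note lb = arc_rank_lower_bound[OF simple_arcs_avoiding[OF assms(1), of "{w}"] gain_on_avoiding[OF assms(2)]]
    and rk = arc_rank_pendant[OF assms(1,2,4,5)] and m = arc_matching_number_avoiding[OF assms(1), of w]
  have mono: "double_cyclomatic V (avoiding A {w}) \<le> double_cyclomatic V A"
    using simple_arcs_avoiding[OF assms(1), of "{w}"]
    by (intro double_cyclomatic_mono[OF assms(1)] avoiding_subset) (simp add: simple_arcs_def)
  show "rank_tight V \<phi> (avoiding A {w})"
    "arc_matching_number A = arc_matching_number (avoiding A {w}) + 1"
    using lb rk m mono assms(3) unfolding rank_tight_def by linarith+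
  show "w \<notin> range u" if "periodic_cycle A l u"
  proof
    assume w: "w \<in> range u"
    show False using double_cyclomatic_avoid_cyclic_vertex[OF assms(1) that w]
        lb rk m assms(3) unfolding rank_tight_def by linarith
  qed
qed

section \<open>Gains and maximum matchings at the cycles of a tight graph\<close>

text \<open>Condition (ii) for one cycle. The name refers to the rank of the cycle, which is then at
  most \<open>l - 2\<close>.\<close>

definition rank_dropping :: "('a \<times> 'a \<Rightarrow> complex) \<Rightarrow> nat \<Rightarrow> (nat \<Rightarrow> 'a) \<Rightarrow> bool" where
  "rank_dropping \<phi> l u \<longleftrightarrow> even l \<and> (\<Prod>i<l. \<phi> (u i, u (Suc i))) = (- 1) ^ (l div 2)"

lemma cycle_row_sum:
  assumes "simple_arcs V A" "periodic_cycle A l u"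
    and arcs: "\<And>a b. (a, b) \<in> A \<Longrightarrow> {a, b} \<in> cycle_edges u"
  shows "(\<Sum>b\<in>range u. gain_entry \<phi> A (u (Suc i)) b * x b) =
    \<phi> (u (Suc i), u i) * x (u i) + \<phi> (u (Suc i), u (Suc (Suc i))) * x (u (Suc (Suc i)))"
proof -
  have arc: "(u i, u (Suc i)) \<in> A" "(u (Suc i), u i) \<in> A" for i
    using assms(2) simple_arcs_sym[OF assms(1)] by (auto simp: periodic_cycle_def)
  have "(\<Sum>b\<in>range u. gain_entry \<phi> A (u (Suc i)) b * x b) =
      (\<Sum>b\<in>{u i, u (Suc (Suc i))}. gain_entry \<phi> A (u (Suc i)) b * x b)"
  proof (rule sum.mono_neutral_right)
    show "finite (range u)" by (rule periodic_cycle_finite[OF assms(2)])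
    show "\<forall>b\<in>range u - {u i, u (Suc (Suc i))}. gain_entry \<phi> A (u (Suc i)) b * x b = 0"
    proof
      fix b assume b: "b \<in> range u - {u i, u (Suc (Suc i))}"
      have "(u (Suc i), b) \<notin> A"
      proof
        assume "(u (Suc i), b) \<in> A"
        from cycle_edges_at[OF assms(2) arcs[OF this], of i] b show False
          by (auto simp: doubleton_eq_iff)
      qed
      then show "gain_entry \<phi> A (u (Suc i)) b * x b = 0" by (simp add: gain_entry_def)
    qed
  qed auto
  then show ?thesis
    using periodic_cycle_neq(2)[OF assms(2), of i] arc by (simp add: gain_entry_def)
qed

text \<open>The kernel equation at \<open>u (Suc i)\<close> links the values of \<open>x\<close> two
  positions apart; after \<open>l div 2\<close> such steps the walk is back at a vertex where
  \<open>x\<close> is nonzero and cancels.\<close>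

lemma cycle_gain_of_kernel_vector:
  assumes "simple_arcs V A" "gain_on \<phi> A" "periodic_cycle A l u" "even l"
    and arcs: "\<And>a b. (a, b) \<in> A \<Longrightarrow> {a, b} \<in> cycle_edges u"
    and ker: "\<And>a. (\<Sum>b\<in>range u. gain_entry \<phi> A a b * x b) = 0"
    and nz: "v \<in> range u" "x v \<noteq> 0"
  shows "(\<Prod>i<l. \<phi> (u i, u (Suc i))) = (- 1) ^ (l div 2)"
proof -
  define g where "g = (\<lambda>i. \<phi> (u i, u (Suc i)))"
  have inv_g: "g i * \<phi> (u (Suc i), u i) = 1" for i
    using assms(2,3) by (auto simp: gain_on_def g_def periodic_cycle_def)
  have recurrence: "x (u i) = - (g i * g (Suc i)) * x (u (Suc (Suc i)))" for i
  proof -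
    have "\<phi> (u (Suc i), u i) * x (u i) + g (Suc i) * x (u (Suc (Suc i))) = 0"
      using ker[of "u (Suc i)"] cycle_row_sum[OF assms(1,3) arcs, of \<phi> i x] by (simp add: g_def)
    then have "g i * \<phi> (u (Suc i), u i) * x (u i) = - (g i * g (Suc i)) * x (u (Suc (Suc i)))"
      by (simp add: mult.assoc flip: distrib_left eq_neg_iff_add_eq_0)
    then show ?thesis by (simp add: inv_g)
  qed
  have iterate: "x (u i) = (- 1) ^ k * (\<Prod>j<2 * k. g (i + j)) * x (u (i + 2 * k))" for i k
  proof (induction k)
    case (Suc k)
    then show ?case using recurrence[of "i + 2 * k"] by (simp add: mult.assoc)
  qed simp
  obtain i where i: "v = u i" using nz(1) by blast
  have l: "2 * (l div 2) = l" using assms(4) by simp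
  have "x (u i) = (- 1) ^ (l div 2) * (\<Prod>j<l. g (i + j)) * x (u i)"
    using iterate[of i "l div 2"] assms(3) unfolding l by (simp add: periodic_cycle_def)
  then have "(- 1) ^ (l div 2) * (\<Prod>j<l. g (i + j)) = 1" using nz(2) i by simp
  then have "(- 1) ^ (l div 2) * ((- 1) ^ (l div 2) * (\<Prod>j<l. g (i + j))) = (- 1) ^ (l div 2)" by simp
  then have prod: "(\<Prod>j<l. g (i + j)) = (- 1) ^ (l div 2)" by (simp flip: mult.assoc power_mult_distrib)
  have per: "g (n + l) = g n" for n
    using assms(3) unfolding periodic_cycle_def g_def by (metis add_Suc)
  \<comment> \<open>The walk starts where \<open>x\<close> is nonzero; rotation invariance moves the
    start of the product to index 0.\<close>
  have "(\<Prod>j<l. g (n + j)) = (\<Prod>j<l. g j)" for n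
  proof (induction n)
    case (Suc n)
    have "g n * (\<Prod>j<l. g (Suc n + j)) = (\<Prod>j<Suc l. g (n + j))"
      by (subst prod.lessThan_Suc_shift) simp
    also have "\<dots> = g n * (\<Prod>j<l. g (n + j))" using per by (simp add: mult.commute)
    finally show ?case using Suc inv_g[of n] by auto
  qed simp
  then show ?thesis using prod by (simp add: g_def)
qed

text \<open>Both claims share one induction because the deletions are the same: a vertex off
  \<open>u\<close>, either the neighbour of a pendant vertex or a vertex of another cycle, until the
  cycle \<open>u\<close> is all that is left. The matching claim covers all maximum matchings, since
  the restriction of a given one to the smaller graph cannot be prescribed.\<close>

lemma rank_tight_cycle:
  assumes "simple_arcs V A" "gain_on \<phi> A" "rank_tight V \<phi> A" "periodic_cycle A l u"
  shows "rank_dropping \<phi> l u \<and> (\<forall>M. arc_matching A M \<longrightarrow> card M = arc_matching_number A \<longrightarrow>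
    (\<forall>e\<in>M. e \<inter> range u \<noteq> {} \<longrightarrow> e \<subseteq> range u))"
  using assms
proof (induction "card A" arbitrary: A rule: less_induct)
  case less
  note A = less.prems
  have apart: "cycles_apart A" by (rule rank_tight_cycles_apart[OF A(1-3)])
  have IH: "rank_dropping \<phi> l u \<and> (\<forall>M. arc_matching (avoiding A {v}) M \<longrightarrow>
      card M = arc_matching_number (avoiding A {v}) \<longrightarrow>
      (\<forall>e\<in>M. e \<inter> range u \<noteq> {} \<longrightarrow> e \<subseteq> range u))"
    if "(v, x) \<in> A" "rank_tight V \<phi> (avoiding A {v})" "v \<notin> range u" for v x
  proof (rule less.hyps)
    have "avoiding A {v} \<subset> A" using that(1) by (auto simp: avoiding_def)
    then show "card (avoiding A {v}) < card A"
      using simple_arcs_finite[OF A(1)] by (intro psubset_card_mono)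
    show "periodic_cycle (avoiding A {v}) l u" using A(4) that(3) by (simp add: periodic_cycle_avoiding)
  qed (use A that simple_arcs_avoiding gain_on_avoiding in blast)+
  have restrict: "arc_matching (avoiding A {v}) {e \<in> M. v \<notin> e} \<and>
      card {e \<in> M. v \<notin> e} = arc_matching_number (avoiding A {v})"
    if "arc_matching A M" "card M = arc_matching_number A"
      "arc_matching_number A = arc_matching_number (avoiding A {v}) + 1" for M v
    using arc_matching_restrict[OF that(1) A(1), of v] that(2,3)
      arc_matching_number_ge[OF simple_arcs_avoiding[OF A(1)] arc_matching_restrict(1)[OF that(1) A(1), of v]]
    by linarith
  consider (pendant) p w where "(p, w) \<in> A" "\<And>x. (p, x) \<in> A \<Longrightarrow> x = w"
    | (other) k q where "periodic_cycle A k q" "range q \<noteq> range u"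
    | (unicyclic) "\<And>p w. (p, w) \<in> A \<Longrightarrow> \<exists>x. (p, x) \<in> A \<and> x \<noteq> w" "\<And>k q. periodic_cycle A k q \<Longrightarrow> range q = range u"
    by blast
  then show ?case
  proof cases
    case pendant
    have del: "rank_tight V \<phi> (avoiding A {w})"
      "arc_matching_number A = arc_matching_number (avoiding A {w}) + 1" and w: "w \<notin> range u"
      using rank_tight_pendant[OF A(1-3) pendant] A(4) by blast+
    note ih = IH[OF simple_arcs_sym[OF A(1) pendant(1)] del(1) w]
    have "e \<subseteq> range u" if M: "arc_matching A M" "card M = arc_matching_number A"
      and e: "e \<in> M" "e \<inter> range u \<noteq> {}" for M e
    proof (cases "w \<in> e")
      case False
      then show ?thesis using ih restrict[OF M del(2)] e by blast
    next
      case True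
      \<comment> \<open>The edge \<open>e\<close> would join \<open>w\<close> to a cycle vertex
        \<open>z\<close>. The other edges of \<open>M\<close> form a maximum matching of the graph
        without \<open>w\<close> and miss \<open>z\<close>, but deleting \<open>z\<close> from that
        tight graph lowers its matching number.\<close>
      let ?M = "{e \<in> M. w \<notin> e}"
      obtain z where z: "z \<in> e" "z \<in> range u" using e(2) by blast
      have "z \<notin> f" if "f \<in> ?M" for f
        using arc_matching_disjoint[OF M(1) e(1) _ z(1)] that True by blast
      then have "arc_matching (avoiding (avoiding A {w}) {z}) ?M"
        using restrict[OF M del(2)] unfolding arc_matching_avoiding_iff by blast
      then have "card ?M \<le> arc_matching_number (avoiding (avoiding A {w}) {z})"
        by (intro arc_matching_number_ge[of V] simple_arcs_avoiding A(1))
      moreover have "arc_matching_number (avoiding A {w}) = arc_matching_number (avoiding (avoiding A {w}) {z}) + 1"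
        using rank_tight_avoid_cyclic_vertex(2)[OF simple_arcs_avoiding[OF A(1)] gain_on_avoiding[OF A(2)] del(1) _ z(2)]
          A(4) w by (simp add: periodic_cycle_avoiding)
      ultimately show ?thesis using restrict[OF M del(2)] by simp
    qed
    then show ?thesis using ih by blast
  next
    case other
    have disj: "range q \<inter> range u = {}"
      using cycles_apart_same_range(2)[OF apart other(1) A(4)] other(2) by blast
    have del: "rank_tight V \<phi> (avoiding A {y})"
      "arc_matching_number A = arc_matching_number (avoiding A {y}) + 1"
      "y \<notin> range u" "\<exists>x. (y, x) \<in> A"
      if "y \<in> range q" for y
    proof -
      show "rank_tight V \<phi> (avoiding A {y})"
        "arc_matching_number A = arc_matching_number (avoiding A {y}) + 1"
        using rank_tight_avoid_cyclic_vertex(1,2)[OF A(1-3) other(1) that] by blast+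
      show "y \<notin> range u" using disj that by blast
      show "\<exists>x. (y, x) \<in> A" using that other(1) by (auto simp: periodic_cycle_def)
    qed
    note ih = IH[OF _ del(1,3)]
    have "e \<subseteq> range u" if M: "arc_matching A M" "card M = arc_matching_number A"
      and e: "e \<in> M" "e \<inter> range u \<noteq> {}" for M e
    proof -
      obtain c d where cd: "e = {c, d}" by (rule arc_matching_edge[OF M(1) e(1)])
      then have "c \<in> range u \<or> d \<in> range u" using e(2) by blast
      then obtain a b where ab: "e = {a, b}" "a \<in> range u" using cd insert_commute by metis
      \<comment> \<open>Since \<open>a\<close> is on \<open>u\<close>, only the end \<open>b\<close>
        of \<open>e\<close> can lie on \<open>q\<close>; one of two consecutive vertices of
        \<open>q\<close> is therefore off \<open>e\<close>.\<close>
      obtain y where y: "y \<in> range q" "y \<noteq> b"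
        using periodic_cycle_neq(1)[OF other(1), of 0] that[of "q 0"] that[of "q 1"] by force
      have "y \<noteq> a" using ab(2) y(1) disj by blast
      then have "y \<notin> e" using ab(1) y(2) by blast
      obtain x where "(y, x) \<in> A" using del(4)[OF y(1)] by blast
      from ih[OF this y(1) y(1)] restrict[OF M del(2)[OF y(1)]] e \<open>y \<notin> e\<close>
      show ?thesis by blast
    qed
    moreover obtain x where "(q 0, x) \<in> A" using del(4)[of "q 0"] by blast
    then have "rank_dropping \<phi> l u" using ih by blast
    ultimately show ?thesis by blast
  next
    case unicyclic
    have "X = range u" if "X \<in> cycle_sets A" for X
      using that by (rule cycle_setsE) (simp add: unicyclic(2))
    then have "cycle_sets A = {range u}" using cycle_setsI[OF A(4)] by blast
    then have le2: "double_cyclomatic V A \<le> 2"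
      using double_cyclomatic_le_cycle_sets[OF A(1) apart] by simp
    have "\<exists>c. (b, c) \<in> A \<and> c \<noteq> a" if "(a, b) \<in> A" for a b
      using unicyclic(1)[OF simple_arcs_sym[OF A(1) that]] .
    then have arcs: "{a, b} \<in> cycle_edges u" if "(a, b) \<in> A" for a b
      using no_pendant_unicyclic[OF A(1,4) le2 _ that] by simp
    have sub: "e \<subseteq> range u" if Me: "arc_matching A M" "e \<in> M" for M e
    proof -
      obtain a b where "e = {a, b}" "(a, b) \<in> A" by (rule arc_matching_edge[OF Me])
      then have "e \<in> cycle_edges u" using arcs by simp
      then show ?thesis using Union_cycle_edges[of u] by blast
    qed
    note del = rank_tight_avoid_cyclic_vertex[OF A rangeI[of u 0]]
    have le_half: "2 * arc_matching_number A \<le> l"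
    proof -
      obtain M where M: "arc_matching A M" "card M = arc_matching_number A"
        using arc_matching_number_attained[OF A(1)] by blast
      have "\<Union> M \<subseteq> range u" using sub[OF M(1)] by blast
      then have "card (\<Union> M) \<le> card (range u)" by (rule card_mono[OF periodic_cycle_finite[OF A(4)]])
      then show ?thesis
        using card_Union_arc_matching[OF M(1) A(1)] M(2) periodic_cycle_card[OF A(4)] by simp
    qed
    have "even l"
    proof (rule ccontr)
      assume odd: "odd l"
      \<comment> \<open>The \<open>l - 1\<close> vertices besides \<open>u 0\<close> form a path
        with a perfect matching. As deleting \<open>u 0\<close> lowers the matching number, a
        maximum matching would have to cover more than \<open>l\<close> vertices.\<close>
      let ?N = "alternating_edges (\<lambda>i. u (i + 1)) ((l - 1) div 2)"
      have N: "arc_matching A ?N" "card ?N = (l - 1) div 2" "\<Union> ?N = (\<lambda>i. u (i + 1)) ` {..<2 * ((l - 1) div 2)}"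
        by (rule alternating_edges[OF periodic_cycle_shift[OF A(4)]], simp)+
      have "u 0 \<notin> \<Union> ?N"
      proof
        assume "u 0 \<in> \<Union> ?N"
        then obtain i where i: "i < l - 1" "u 0 = u (i + 1)" using N(3) odd by auto
        then have "0 mod l = (i + 1) mod l" using periodic_cycle_eq_iff[OF A(4)] by blast
        then show False using i(1) by simp
      qed
      then have "arc_matching (avoiding A {u 0}) ?N" using N(1) by (simp add: arc_matching_avoiding_iff)
      then have "(l - 1) div 2 \<le> arc_matching_number (avoiding A {u 0})"
        using arc_matching_number_ge[OF simple_arcs_avoiding[OF A(1)]] N(2) by metis
      then have "2 * ((l - 1) div 2) + 2 \<le> l" using del(2) le_half by linarith
      then show False using odd A(4) by (auto simp: periodic_cycle_def elim: oddE)
    qed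
    have "0 \<le> double_cyclomatic V (avoiding A {u 0})"
      by (rule double_cyclomatic_nonneg[OF simple_arcs_avoiding[OF A(1)]])
    \<comment> \<open>By tightness the rank is at most \<open>l - 2\<close>, which leaves room for a
      kernel vector supported on the cycle.\<close>
    then have "int (arc_rank \<phi> A) < int l"
      using A(3) le_half del(3) unfolding rank_tight_def by linarith
    then have "arc_rank \<phi> A < card (range u)" using periodic_cycle_card[OF A(4)] by simp
    from rank_le_kernel_vector[OF rank_le_arc_rank[OF A(1)] periodic_cycle_finite[OF A(4)] this]
    obtain x v where "v \<in> range u" "x v \<noteq> 0" "\<And>a. (\<Sum>b\<in>range u. gain_entry \<phi> A a b * x b) = 0"
      by blast
    then have "rank_dropping \<phi> l u"
      unfolding rank_dropping_def
      using cycle_gain_of_kernel_vector[OF A(1,2,4) \<open>even l\<close> arcs] \<open>even l\<close> by blast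
    then show ?thesis using sub by blast
  qed
qed

section \<open>Matching numbers of tight graphs\<close>

definition cyclic_vertices :: "'a rel \<Rightarrow> 'a set" where
  "cyclic_vertices A = \<Union> (cycle_sets A)"

lemma cyclic_verticesI: "periodic_cycle A l u \<Longrightarrow> u i \<in> cyclic_vertices A"
  unfolding cyclic_vertices_def using cycle_setsI by blast

lemma cyclic_vertices_subset:
  assumes "simple_arcs V A"
  shows "cyclic_vertices A \<subseteq> V"
  unfolding cyclic_vertices_def
  using periodic_cycle_range_subset[OF _ assms] by (auto elim!: cycle_setsE)

lemma finite_cyclic_vertices: "simple_arcs V A \<Longrightarrow> finite (cyclic_vertices A)"
  using cyclic_vertices_subset[of V A] finite_subset by (auto simp: simple_arcs_def)

lemma cycle_sets_disjoint:
  assumes "cycles_apart A" "X \<in> cycle_sets A" "Y \<in> cycle_sets A" "X \<noteq> Y"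
  shows "X \<inter> Y = {}"
proof -
  obtain l u where u: "X = range u" "periodic_cycle A l u" by (rule cycle_setsE[OF assms(2)])
  obtain k w where w: "Y = range w" "periodic_cycle A k w" by (rule cycle_setsE[OF assms(3)])
  show ?thesis using cycles_apart_same_range(2)[OF assms(1) u(2) w(2)] u(1) w(1) assms(4) by blast
qed

lemma card_cyclic_vertices:
  assumes "simple_arcs V A" "cycles_apart A"
  shows "card (cyclic_vertices A) = sum card (cycle_sets A)"
  unfolding cyclic_vertices_def
proof (rule card_Union_disjoint)
  show "disjoint (cycle_sets A)" by (rule disjointI) (rule cycle_sets_disjoint[OF assms(2)])
  show "finite X" if "X \<in> cycle_sets A" for X
    using that periodic_cycle_finite by (auto elim!: cycle_setsE)
qed

lemma rank_tight_matching_number_le: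
  assumes "simple_arcs V A" "gain_on \<phi> A" "rank_tight V \<phi> A"
  shows "2 * arc_matching_number A \<le>
    2 * arc_matching_number (avoiding A (cyclic_vertices A)) + card (cyclic_vertices A)"
proof -
  let ?O = "cyclic_vertices A"
  obtain M where M: "arc_matching A M" "card M = arc_matching_number A"
    using arc_matching_number_attained[OF assms(1)] by blast
  let ?M1 = "{e \<in> M. e \<inter> ?O = {}}" and ?M2 = "{e \<in> M. e \<subseteq> ?O}"
  have "e \<subseteq> ?O" if e: "e \<in> M" "e \<inter> ?O \<noteq> {}" for e
  proof -
    obtain X where X: "X \<in> cycle_sets A" "e \<inter> X \<noteq> {}"
      using e(2) unfolding cyclic_vertices_def by blast
    obtain l u where u: "X = range u" "periodic_cycle A l u" by (rule cycle_setsE[OF X(1)])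
    have "e \<subseteq> X" using rank_tight_cycle[OF assms u(2)] M e(1) X(2) u(1) by blast
    then show ?thesis using X(1) unfolding cyclic_vertices_def by blast
  qed
  then have "M = ?M1 \<union> ?M2" by blast
  then have "card M \<le> card ?M1 + card ?M2" using card_Un_le[of ?M1 ?M2] by simp
  moreover have "arc_matching (avoiding A ?O) ?M1"
    unfolding arc_matching_avoiding_iff
  proof
    show "arc_matching A ?M1" by (rule arc_matching_subset[OF M(1)]) blast
    show "\<Union> ?M1 \<inter> ?O = {}" by blast
  qed
  then have "card ?M1 \<le> arc_matching_number (avoiding A ?O)"
    by (rule arc_matching_number_ge[OF simple_arcs_avoiding[OF assms(1)]])
  moreover have M2: "arc_matching A ?M2" by (rule arc_matching_subset[OF M(1)]) blast
  have "card (\<Union> ?M2) \<le> card ?O" by (rule card_mono[OF finite_cyclic_vertices[OF assms(1)]]) blast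
  then have "2 * card ?M2 \<le> card ?O" unfolding card_Union_arc_matching[OF M2 assms(1)] .
  ultimately show ?thesis using M(2) by linarith
qed

text \<open>
  The edges of \<open>M\<close> come from a matching of the contracted graph. On a cycle that \<open>M\<close> meets in \<open>s\<close>,
  deleting the successor of \<open>s\<close> keeps the graph tight and leaves an even path besides \<open>s\<close>.
\<close>

lemma rank_tight_matching_number_ge:
  assumes "simple_arcs V A" "gain_on \<phi> A" "rank_tight V \<phi> A"
    and "arc_matching A M" "\<And>X. X \<in> cycle_sets A \<Longrightarrow> \<exists>s. X \<inter> \<Union> M \<subseteq> {s}"
  shows "2 * card M + card (cyclic_vertices A) \<le> 2 * arc_matching_number A"
  using assms
proof (induction "card A" arbitrary: A M rule: less_induct)
  case less
  note A = less.prems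
  have apart: "cycles_apart A" by (rule rank_tight_cycles_apart[OF A(1-3)])
  show ?case
  proof (cases "cycle_sets A = {}")
    case True
    then show ?thesis using arc_matching_number_ge[OF A(1,4)] by (simp add: cyclic_vertices_def)
  next
    case False
    then obtain X where X: "X \<in> cycle_sets A" by blast
    obtain l w where w: "X = range w" "periodic_cycle A l w" by (rule cycle_setsE[OF X])
    obtain s where s: "X \<inter> \<Union> M \<subseteq> {s}" using A(5)[OF X] by blast
    \<comment> \<open>If \<open>M\<close> misses the cycle, \<open>s\<close> may lie elsewhere, and
      any vertex of the cycle serves instead.\<close>
    have "\<exists>i. X \<inter> \<Union> M \<subseteq> {w i}"
    proof (cases "s \<in> X")
      case True
      then show ?thesis using s w(1) by auto
    qed (use s in blast)
    then obtain i where i: "X \<inter> \<Union> M \<subseteq> {w i}" by blast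
    define u where "u = (\<lambda>j. w (j + i))"
    have u: "periodic_cycle A l u" "X = range u" "X \<inter> \<Union> M \<subseteq> {u 0}"
      using periodic_cycle_shift[OF w(2)] shift_range[OF w(2)] w(1) i by (auto simp: u_def)
    have l: "even l" "3 \<le> l"
      using rank_tight_cycle[OF A(1-3) u(1)] u(1) by (auto simp: rank_dropping_def periodic_cycle_def)
    \<comment> \<open>With \<open>u 0\<close> reserved for \<open>M\<close> and \<open>u 1\<close>
      deleted, the path from \<open>u 2\<close> to \<open>u (l - 1)\<close> has the even number
      \<open>l - 2\<close> of vertices and the perfect matching \<open>?N\<close>.\<close>
    let ?B = "avoiding A {u 1}" and ?N = "alternating_edges (\<lambda>j. u (j + 2)) ((l - 2) div 2)"
    have N: "arc_matching A ?N" "card ?N = (l - 2) div 2"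
      "\<Union> ?N = (\<lambda>j. u (j + 2)) ` {..<2 * ((l - 2) div 2)}"
      by (rule alternating_edges[OF periodic_cycle_shift[OF u(1)]], simp)+
    have far: "u (j + 2) \<noteq> u 0" "u (j + 2) \<noteq> u 1" if "j < l - 2" for j
      using that l(2) unfolding periodic_cycle_eq_iff[OF u(1)] by auto
    have NX: "\<Union> ?N \<subseteq> X - {u 0, u 1}"
      unfolding N(3) using far l(1) by (auto simp: u(2))
    have u01: "u 0 \<noteq> u 1" using periodic_cycle_neq(1)[OF u(1), of 0] by simp
    have del: "rank_tight V \<phi> ?B" "arc_matching_number A = arc_matching_number ?B + 1"
      using rank_tight_avoid_cyclic_vertex[OF A(1-3) u(1) rangeI] by blast+
    have sets: "cycle_sets ?B = cycle_sets A - {X}"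
      using cycle_sets_avoiding[OF apart u(1) rangeI] u(2) by simp
    have MN: "\<Union> M \<inter> \<Union> ?N = {}" using u(3) NX by blast
    have "u 1 \<in> X" unfolding u(2) by simp
    then have u1: "u 1 \<notin> \<Union> M" using subsetD[OF u(3), of "u 1"] u01 by auto
    have match: "arc_matching ?B (M \<union> ?N)"
      unfolding arc_matching_avoiding_iff
    proof
      show "arc_matching A (M \<union> ?N)" by (rule arc_matching_union[OF A(4) N(1) MN])
      show "\<Union> (M \<union> ?N) \<inter> {u 1} = {}" using u1 subsetD[OF NX, of "u 1"] by auto
    qed
    \<comment> \<open>The vertices \<open>u 0\<close> and \<open>u 1\<close>, which
      \<open>?N\<close> leaves out, are paid for by the drop of the matching number when
      \<open>u 1\<close> is deleted.\<close>
    have "2 * card (M \<union> ?N) + card (cyclic_vertices ?B) \<le> 2 * arc_matching_number ?B"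
    proof (rule less.hyps[OF _ simple_arcs_avoiding[OF A(1)] gain_on_avoiding[OF A(2)] del(1) match])
      have "(u 1, u 2) \<in> A" using u(1) by (metis Suc_1 periodic_cycle_def)
      then have "?B \<subset> A" by (auto simp: avoiding_def)
      then show "card ?B < card A" using simple_arcs_finite[OF A(1)] by (rule psubset_card_mono[rotated])
      fix Y assume "Y \<in> cycle_sets ?B"
      then have Y: "Y \<in> cycle_sets A" "Y \<inter> X = {}"
        using cycle_sets_disjoint[OF apart _ X] unfolding sets by blast+
      then have "Y \<inter> \<Union> (M \<union> ?N) = Y \<inter> \<Union> M" using NX by blast
      then show "\<exists>s. Y \<inter> \<Union> (M \<union> ?N) \<subseteq> {s}" using A(5)[OF Y(1)] by simp
    qed
    moreover have "card (M \<union> ?N) = card M + (l - 2) div 2"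
      using card_arc_matching_union[OF A(4) N(1) MN A(1)] N(2) by simp
    moreover have "card (cyclic_vertices A) = card X + card (cyclic_vertices ?B)"
      unfolding card_cyclic_vertices[OF A(1) apart] sets
        card_cyclic_vertices[OF simple_arcs_avoiding[OF A(1)] cycles_apart_mono[OF apart avoiding_subset]]
      by (rule sum.remove[OF finite_cycle_sets[OF A(1)] X])
    moreover have "card X = l" using periodic_cycle_card[OF u(1)] u(2) by simp
    moreover have "2 * ((l - 2) div 2) = l - 2" using l(1) by simp
    ultimately show ?thesis using del(2) l(2) by linarith
  qed
qed

section \<open>Sufficiency\<close>

text \<open>A maximum matching off the cycles is extended by a perfect matching of each cycle; these
  exist because the lengths are even and do not interfere because the cycles are disjoint.\<close>

lemma even_cycles_matching_number_ge:
  assumes "simple_arcs V A" "cycles_apart A" "\<And>l u. periodic_cycle A l u \<Longrightarrow> even l"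
  shows "2 * arc_matching_number (avoiding A (cyclic_vertices A)) + card (cyclic_vertices A)
    \<le> 2 * arc_matching_number A"
proof -
  let ?O = "cyclic_vertices A"
  obtain M where M: "arc_matching (avoiding A ?O) M" "card M = arc_matching_number (avoiding A ?O)"
    using arc_matching_number_attained[OF simple_arcs_avoiding[OF assms(1)]] by blast
  then have MA: "arc_matching A M" and MO: "\<Union> M \<inter> ?O = {}" by (auto simp: arc_matching_avoiding_iff)
  have "\<exists>N. arc_matching A N \<and> \<Union> N = \<Union> M \<union> \<Union> \<C>" if "\<C> \<subseteq> cycle_sets A" "finite \<C>" for \<C>
    using that(2,1)
  proof (induction \<C> rule: finite_induct)
    case empty
    show ?case using MA by auto
  next
    case (insert X \<C>)
    then obtain N where N: "arc_matching A N" "\<Union> N = \<Union> M \<union> \<Union> \<C>" by blast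
    obtain l u where u: "X = range u" "periodic_cycle A l u" using insert.prems by (blast elim: cycle_setsE)
    have l: "2 * (l div 2) = l" using assms(3)[OF u(2)] by simp
    let ?E = "alternating_edges u (l div 2)"
    have E: "arc_matching A ?E" "\<Union> ?E = X"
      using alternating_edges(1,3)[OF u(2), of "l div 2"] l periodic_cycle_range[OF u(2)] u(1) by auto
    have "Y \<inter> X = {}" if "Y \<in> \<C>" for Y
      using cycle_sets_disjoint[OF assms(2), of Y X] insert.prems insert.hyps(2) that by blast
    moreover have "X \<subseteq> ?O" using insert.prems unfolding cyclic_vertices_def by blast
    ultimately have "\<Union> N \<inter> \<Union> ?E = {}" unfolding N(2) E(2) using MO by blast
    then have "arc_matching A (N \<union> ?E)" by (rule arc_matching_union[OF N(1) E(1)])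
    moreover have "\<Union> (N \<union> ?E) = \<Union> M \<union> \<Union> (insert X \<C>)" using N(2) E(2) by auto
    ultimately show ?case by blast
  qed
  from this[OF order_refl finite_cycle_sets[OF assms(1)]]
  obtain N where N: "arc_matching A N" "\<Union> N = \<Union> M \<union> ?O" unfolding cyclic_vertices_def by blast
  have "finite (\<Union> M)" using card_Union_arc_matching[OF MA assms(1)] arc_matching_finite[OF MA assms(1)]
    arc_matching_edge[OF MA] by (metis finite.emptyI finite.insertI finite_Union)
  then have "card (\<Union> N) = card (\<Union> M) + card ?O"
    unfolding N(2) by (rule card_Un_disjoint[OF _ finite_cyclic_vertices[OF assms(1)] MO])
  then have "2 * card N = 2 * card M + card ?O"
    unfolding card_Union_arc_matching[OF N(1) assms(1)] card_Union_arc_matching[OF MA assms(1)] .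
  then show ?thesis using arc_matching_number_ge[OF assms(1) N(1)] M(2) by linarith
qed

text \<open>The kernel recurrence solved over the even positions from the value 1 at
  \<open>u 0\<close>; the gain condition is what makes the solution periodic with period
  \<open>l\<close>. The zeros at odd positions make it independent of the vector obtained from the
  shifted cycle.\<close>

lemma rank_dropping_kernel_vector:
  assumes "simple_arcs V A" "gain_on \<phi> A" "periodic_cycle A l u" "rank_dropping \<phi> l u"
    and arcs: "\<And>a b. (a, b) \<in> A \<Longrightarrow> {a, b} \<in> cycle_edges u"
  shows "\<exists>x. x (u 0) = 1 \<and> (\<forall>i. odd i \<longrightarrow> x (u i) = 0) \<and>
    (\<forall>a. (\<Sum>b\<in>range u. gain_entry \<phi> A a b * x b) = 0)"
proof -
  define g where "g = (\<lambda>i. \<phi> (u i, u (Suc i)))"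
  have inv_g: "g i * \<phi> (u (Suc i), u i) = 1" for i
    using assms(2,3) by (auto simp: gain_on_def g_def periodic_cycle_def)
  have nz: "g i \<noteq> 0" for i using inv_g[of i] by auto
  have "even l" and prod: "(\<Prod>i<l. g i) = (- 1) ^ (l div 2)"
    using assms(4) by (auto simp: rank_dropping_def g_def)
  have "u (Suc (n + l)) = u (Suc n)" "u (n + l) = u n" for n
    using assms(3) unfolding periodic_cycle_def by (metis add_Suc)+
  then have per_g: "g (n + l) = g n" for n by (simp add: g_def)
  define X where "X = (\<lambda>i. if even i then (- 1) ^ (i div 2) / (\<Prod>j<i. g j) else 0)"
  have "(\<Prod>j<i + l. g j) = (- 1) ^ (l div 2) * (\<Prod>j<i. g j)" for i
    by (induction i) (simp_all add: prod per_g)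
  then have per_X: "X (i + l) = X i" for i
    using \<open>even l\<close> by (auto simp: X_def power_add elim!: evenE)
  have X_step: "X i = - (g i * g (Suc i)) * X (Suc (Suc i))" for i
    using nz by (simp add: X_def)
  \<comment> \<open>Well defined on vertices: indices of the same vertex agree modulo
    \<open>l\<close>, and \<open>X\<close> has period \<open>l\<close>.\<close>
  define x where "x = (\<lambda>v. X (SOME i. u i = v))"
  have x: "x (u i) = X i" for i
  proof -
    have "u (SOME j. u j = u i) = u i" by (rule someI) simp
    then have "(SOME j. u j = u i) mod l = i mod l" unfolding periodic_cycle_eq_iff[OF assms(3)] .
    then show ?thesis unfolding x_def using periodic_mod[of X l, OF per_X] by metis
  qed
  have "(\<Sum>b\<in>range u. gain_entry \<phi> A a b * x b) = 0" for a
  proof (cases "a \<in> range u")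
    case False
    then have "(a, b) \<notin> A" for b using arcs[of a b] Union_cycle_edges[of u] by blast
    then show ?thesis by (simp add: gain_entry_def)
  next
    case True
    then obtain j where "a = u j" by blast
    then obtain i where a: "a = u (Suc i)" using periodic_index[OF assms(3), of j 1] by auto
    have "g i * (\<Sum>b\<in>range u. gain_entry \<phi> A a b * x b) =
        g i * \<phi> (u (Suc i), u i) * X i + g i * g (Suc i) * X (Suc (Suc i))"
      unfolding a cycle_row_sum[OF assms(1,3) arcs, simplified] by (simp add: x g_def algebra_simps)
    also have "\<dots> = 0" unfolding inv_g using X_step[of i] by simp
    finally show ?thesis using nz by simp
  qed
  moreover have "x (u 0) = 1" "odd i \<Longrightarrow> x (u i) = 0" for i by (simp_all add: x X_def)
  ultimately show ?thesis by blast
qed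

text \<open>Rotation trades the factor at index 0 for the one at index \<open>l\<close>; the two are
  equal and nonzero.\<close>

lemma rank_dropping_shift:
  assumes "periodic_cycle A l u" "gain_on \<phi> A" "rank_dropping \<phi> l u"
  shows "rank_dropping \<phi> l (\<lambda>i. u (i + 1))"
proof -
  have "\<phi> (u 0, u 1) * (\<Prod>i<l. \<phi> (u (Suc i), u (Suc (Suc i)))) = (\<Prod>i<Suc l. \<phi> (u i, u (Suc i)))"
    by (subst prod.lessThan_Suc_shift) simp
  moreover have "u l = u 0" "u (Suc l) = u 1"
    using assms(1) unfolding periodic_cycle_def by (metis add_0 add_Suc One_nat_def)+
  moreover have "(u 0, u 1) \<in> A" using assms(1) by (simp add: periodic_cycle_def)
  then have "\<phi> (u 0, u 1) \<noteq> 0" using assms(2) by (auto simp: gain_on_def)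
  ultimately show ?thesis using assms(3) by (auto simp: rank_dropping_def)
qed

text \<open>One kernel vector is 1 at \<open>u 0\<close> and 0 at \<open>u 1\<close>, the other has
  these values exchanged. They express the columns of \<open>u 0\<close> and \<open>u 1\<close>
  through the remaining \<open>l - 2\<close> columns.\<close>

lemma rank_le_rank_dropping_cycle:
  assumes "simple_arcs V A" "gain_on \<phi> A" "periodic_cycle A l u" "rank_dropping \<phi> l u"
    and arcs: "\<And>a b. (a, b) \<in> A \<Longrightarrow> {a, b} \<in> cycle_edges u"
  shows "rank_le (gain_entry \<phi> A) (l - 2)"
proof -
  let ?h = "gain_entry \<phi> A"
  obtain x where x: "x (u 0) = 1" "\<And>i. odd i \<Longrightarrow> x (u i) = 0" "\<And>a. (\<Sum>b\<in>range u. ?h a b * x b) = 0"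
    using rank_dropping_kernel_vector[OF assms(1-4) arcs] by blast
  let ?w = "\<lambda>i. u (i + 1)"
  have w: "periodic_cycle A l ?w" "cycle_edges ?w = cycle_edges u" "range ?w = range u"
    by (rule periodic_cycle_shift[OF assms(3)] shift_cycle_edges[OF assms(3)] shift_range[OF assms(3)])+
  obtain y where y: "y (?w 0) = 1" "\<And>i. odd i \<Longrightarrow> y (?w i) = 0" "\<And>a. (\<Sum>b\<in>range ?w. ?h a b * y b) = 0"
    using rank_dropping_kernel_vector[OF assms(1,2) w(1) rank_dropping_shift[OF assms(3,2,4)]] arcs
    unfolding w(2) by blast
  have l: "3 \<le> l" "even l" "u l = u 0"
    using assms(3,4) unfolding periodic_cycle_def rank_dropping_def by (auto simp: add_0 dest: spec[of _ 0])
  \<comment> \<open>\<open>u 0\<close> is position \<open>l - 1\<close> of the shifted cycle, an odd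
    index.\<close>
  have "y (u 0) = 0" using y(2)[of "l - 1"] l by simp
  have "x (u 1) = 0" using x(2)[of 1] by simp
  have neq: "u 0 \<noteq> u 1" using periodic_cycle_neq(1)[OF assms(3), of 0] by simp
  let ?I = "range u - {u 0, u 1}"
  have fin: "finite (range u)" by (rule periodic_cycle_finite[OF assms(3)])
  have split: "(\<Sum>b\<in>range u. F b) = F (u 0) + (F (u 1) + (\<Sum>b\<in>?I. F b))" for F :: "_ \<Rightarrow> complex"
  proof -
    have "?I = range u - {u 0} - {u 1}" by blast
    then show ?thesis using fin neq by (simp add: sum.remove[of "range u" "u 0"] sum.remove[of "range u - {u 0}" "u 1"])
  qed
  have col0: "?h a (u 0) = (\<Sum>c\<in>?I. ?h a c * - x c)" for a
    using x(1) x(3)[of a] \<open>x (u 1) = 0\<close> unfolding split by (simp add: sum_negf eq_neg_iff_add_eq_0)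
  have col1: "?h a (u 1) = (\<Sum>c\<in>?I. ?h a c * - y c)" for a
    using y(1) y(3)[of a] \<open>y (u 0) = 0\<close> unfolding w(3) split by (simp add: sum_negf eq_neg_iff_add_eq_0)
  show ?thesis
  proof (rule rank_leI)
    show "finite ?I" using fin by simp
    show "card ?I \<le> l - 2"
      using periodic_cycle_card[OF assms(3)] neq fin by (simp add: card_Diff_subset)
    fix a b
    let ?g = "\<lambda>c b. if b = u 0 then - x c else if b = u 1 then - y c else if b = c then 1 else 0"
    consider "b = u 0" | "b = u 1" | "b \<in> ?I" | "b \<notin> range u" by blast
    then show "?h a b = (\<Sum>c\<in>?I. ?h a c * ?g c b)"
    proof cases
      case 1
      then show ?thesis using col0 by simp
    next
      case 2
      then show ?thesis using col1 neq by simp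
    next
      case 3
      then have "(\<Sum>c\<in>?I. ?h a c * ?g c b) = (\<Sum>c\<in>?I. if c = b then ?h a b else 0)"
        by (intro sum.cong) auto
      then show ?thesis using 3 fin by simp
    next
      case 4
      then have "(a, b) \<notin> A" using arcs[of a b] Union_cycle_edges[of u] by blast
      moreover have "(\<Sum>c\<in>?I. ?h a c * ?g c b) = 0" using 4 by (intro sum.neutral) auto
      ultimately show ?thesis by (simp add: gain_entry_def)
    qed
  qed
qed

text \<open>Every arc joins two vertices of the same cycle, so the matrix is block diagonal with one
  block per cycle, of rank at most \<open>card X - 2\<close>; chordlessness identifies each block
  with the matrix of a cycle.\<close>

lemma rank_le_disjoint_cycles:
  assumes "simple_arcs V A" "gain_on \<phi> A" "cycles_apart A"
    and dropping: "\<And>l u. periodic_cycle A l u \<Longrightarrow> rank_dropping \<phi> l u"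
    and arcs: "\<And>a b. (a, b) \<in> A \<Longrightarrow> \<exists>l u. periodic_cycle A l u \<and> {a, b} \<in> cycle_edges u"
  shows "arc_rank \<phi> A + 2 * card (cycle_sets A) \<le> card (cyclic_vertices A)"
proof -
  let ?B = "\<lambda>X. A \<inter> X \<times> X"
  have "rank_le (gain_entry \<phi> (?B X)) (card X - 2)" if X: "X \<in> cycle_sets A" for X
  proof -
    obtain l u where u: "X = range u" "periodic_cycle A l u" by (rule cycle_setsE[OF X])
    have "simple_arcs V (?B X)"
      by (rule simple_arcs_subset[OF assms(1)]) (use assms(1) in \<open>auto simp: simple_arcs_def sym_def\<close>)
    moreover have "gain_on \<phi> (?B X)" by (rule gain_on_subset[OF assms(2)]) blast
    moreover have "periodic_cycle (?B X) l u" using u by (simp add: periodic_cycle_def)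
    moreover have "{a, b} \<in> cycle_edges u" if "(a, b) \<in> ?B X" for a b
      using that cycles_apart_chordless[OF assms(1,3) u(2)] u(1) by auto
    ultimately have "rank_le (gain_entry \<phi> (?B X)) (l - 2)"
      using rank_le_rank_dropping_cycle dropping[OF u(2)] by blast
    then show ?thesis using periodic_cycle_card[OF u(2)] u(1) by simp
  qed
  then have "rank_le (\<lambda>a b. \<Sum>X\<in>cycle_sets A. gain_entry \<phi> (?B X) a b) (\<Sum>X\<in>cycle_sets A. card X - 2)"
    by (rule rank_le_sum[OF finite_cycle_sets[OF assms(1)]])
  moreover have "(\<Sum>X\<in>cycle_sets A. gain_entry \<phi> (?B X) a b) = gain_entry \<phi> A a b" for a b
  proof (cases "(a, b) \<in> A")
    case True
    then obtain l u where u: "periodic_cycle A l u" "{a, b} \<in> cycle_edges u" using arcs by blast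
    have ab: "a \<in> range u" "b \<in> range u" using u(2) Union_cycle_edges[of u] by blast+
    have U: "range u \<in> cycle_sets A" by (rule cycle_setsI[OF u(1)])
    have "(\<Sum>X\<in>cycle_sets A. gain_entry \<phi> (?B X) a b) =
        (\<Sum>X\<in>cycle_sets A. if X = range u then \<phi> (a, b) else 0)"
    proof (rule sum.cong[OF refl])
      fix X assume X: "X \<in> cycle_sets A"
      have "a \<notin> X" if "X \<noteq> range u"
        using cycle_sets_disjoint[OF assms(3) X U that] ab(1) by blast
      then show "gain_entry \<phi> (?B X) a b = (if X = range u then \<phi> (a, b) else 0)"
        using True ab by (auto simp: gain_entry_def)
    qed
    then show ?thesis using U True finite_cycle_sets[OF assms(1)] by (simp add: gain_entry_def)
  qed (simp add: gain_entry_def)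
  ultimately have "rank_le (gain_entry \<phi> A) (\<Sum>X\<in>cycle_sets A. card X - 2)" by simp
  then have "arc_rank \<phi> A \<le> (\<Sum>X\<in>cycle_sets A. card X - 2)" by (rule arc_rank_le)
  moreover have "(\<Sum>X\<in>cycle_sets A. card X - 2) + 2 * card (cycle_sets A) = sum card (cycle_sets A)"
  proof -
    have "2 \<le> card X" if X: "X \<in> cycle_sets A" for X
    proof -
      obtain l u where "X = range u" "periodic_cycle A l u" by (rule cycle_setsE[OF X])
      then show ?thesis using periodic_cycle_card[of A l u] by (simp add: periodic_cycle_def)
    qed
    then have "sum card (cycle_sets A) = (\<Sum>X\<in>cycle_sets A. (card X - 2) + 2)"
      by (intro sum.cong refl) (metis le_add_diff_inverse2)
    then show ?thesis unfolding sum.distrib by simp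
  qed
  ultimately show ?thesis using card_cyclic_vertices[OF assms(1,3)] by linarith
qed

text \<open>With N cycles, the rank is at most 2|K| + |O| - 2N. The bound on \<open>card K\<close>
  and the even cycles bring this below 2m - 2N, which is at most 2m - 2c as c is at most N. The
  general lower bound gives the converse.\<close>

lemma rank_tight_sufficient:
  assumes "simple_arcs V A" "gain_on \<phi> A" "cycles_apart A"
    and dropping: "\<And>l u. periodic_cycle A l u \<Longrightarrow> rank_dropping \<phi> l u"
    and K: "finite K" "K \<inter> cyclic_vertices A = {}"
      "card K \<le> arc_matching_number (avoiding A (cyclic_vertices A))"
    and cover: "\<And>a b. (a, b) \<in> A \<Longrightarrow> a \<notin> K \<Longrightarrow> b \<notin> K \<Longrightarrow>
      \<exists>l u. periodic_cycle A l u \<and> {a, b} \<in> cycle_edges u"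
  shows "rank_tight V \<phi> A"
proof -
  let ?B = "avoiding A K"
  have cyc: "periodic_cycle ?B l u \<longleftrightarrow> periodic_cycle A l u" for l u
    using K(2) cyclic_verticesI[of A l u] unfolding periodic_cycle_avoiding by blast
  then have sets: "cycle_sets ?B = cycle_sets A" by (simp add: cycle_sets_def)
  have verts: "cyclic_vertices ?B = cyclic_vertices A" by (simp add: cyclic_vertices_def sets)
  have "arc_rank \<phi> ?B + 2 * card (cycle_sets ?B) \<le> card (cyclic_vertices ?B)"
  proof (rule rank_le_disjoint_cycles[OF simple_arcs_avoiding[OF assms(1)] gain_on_avoiding[OF assms(2)]
        cycles_apart_mono[OF assms(3) avoiding_subset]])
    show "\<exists>l u. periodic_cycle ?B l u \<and> {a, b} \<in> cycle_edges u" if "(a, b) \<in> ?B" for a b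
      unfolding cyc by (rule cover) (use that in \<open>auto simp: avoiding_def\<close>)
  qed (use dropping cyc in blast)
  moreover have "arc_rank \<phi> A \<le> arc_rank \<phi> ?B + 2 * card K"
    by (rule arc_rank_le_avoiding[OF assms(1) K(1)])
  moreover have "2 * arc_matching_number (avoiding A (cyclic_vertices A)) + card (cyclic_vertices A)
      \<le> 2 * arc_matching_number A"
    using dropping by (intro even_cycles_matching_number_ge[OF assms(1,3)]) (auto simp: rank_dropping_def)
  moreover have "double_cyclomatic V A \<le> 2 * int (card (cycle_sets A))"
    by (rule double_cyclomatic_le_cycle_sets[OF assms(1,3)])
  moreover have "2 * int (arc_matching_number A) - double_cyclomatic V A \<le> int (arc_rank \<phi> A)"
    by (rule arc_rank_lower_bound[OF assms(1,2)])
  ultimately have "arc_rank \<phi> A + 2 * card (cycle_sets A) \<le> 2 * arc_matching_number A"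
    "double_cyclomatic V A \<le> 2 * int (card (cycle_sets A))"
    "2 * int (arc_matching_number A) - double_cyclomatic V A \<le> int (arc_rank \<phi> A)"
    using K(3) unfolding sets verts by linarith+
  then show ?thesis unfolding rank_tight_def by linarith
qed

section \<open>Vertex covers of forests\<close>

text \<open>Koenig's equality for forests: the neighbour \<open>w\<close> of a pendant vertex
  \<open>p\<close> joins the cover, the edge between them joins the matching, and the induction
  continues without \<open>w\<close>.\<close>

lemma acyclic_vertex_cover:
  assumes "simple_arcs V A" "\<And>l u. \<not> periodic_cycle A l u"
  shows "\<exists>K M. finite K \<and> arc_matching A M \<and> card K \<le> card M \<and> avoiding A K = {}"
  using assms
proof (induction "card A" arbitrary: A rule: less_induct)
  case less
  note A = less.prems
  show ?case
  proof (cases "A = {}")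
    case True
    then show ?thesis using arc_matching_empty by (intro exI[of _ "{}"]) (auto simp: avoiding_def)
  next
    case False
    obtain p w where pw: "(p, w) \<in> A" "\<And>x. (p, x) \<in> A \<Longrightarrow> x = w"
      using acyclic_pendant[OF A(1) False A(2)] by blast
    let ?B = "avoiding A {w}"
    have "?B \<subset> A" using pw(1) by (auto simp: avoiding_def)
    then have "card ?B < card A" using simple_arcs_finite[OF A(1)] by (rule psubset_card_mono[rotated])
    moreover have "\<not> periodic_cycle ?B l u" for l u using A(2) unfolding periodic_cycle_avoiding by blast
    ultimately obtain K M where K: "finite K" "arc_matching ?B M" "card K \<le> card M" "avoiding ?B K = {}"
      using less.hyps simple_arcs_avoiding[OF A(1)] by blast
    have M: "arc_matching A M" "w \<notin> \<Union> M" using K(2) unfolding arc_matching_avoiding_iff by blast+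
    have "p \<notin> \<Union> M"
    proof
      assume "p \<in> \<Union> M"
      then obtain e where e: "e \<in> M" "p \<in> e" by blast
      obtain a b where "e = {a, b}" "(a, b) \<in> A" by (rule arc_matching_edge[OF M(1) e(1)])
      then have "w \<in> e" using e(2) pw(2) simple_arcs_sym[OF A(1)] by blast
      then show False using M(2) e(1) by blast
    qed
    have edge: "arc_matching A {{p, w}}"
      using pw(1) by (auto simp: arc_matching_def undirected_def)
    have disj: "\<Union> {{p, w}} \<inter> \<Union> M = {}" using M(2) \<open>p \<notin> \<Union> M\<close> by auto
    have match: "arc_matching A ({{p, w}} \<union> M)" "card ({{p, w}} \<union> M) = 1 + card M"
      using arc_matching_union[OF edge M(1) disj] card_arc_matching_union[OF edge M(1) disj A(1)] by simp_all
    have "card (insert w K) \<le> card ({{p, w}} \<union> M)"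
      using card_insert_le_m1[of "card K + 1" K w] K(3) match(2) by simp
    moreover have "avoiding A (insert w K) = {}" using K(4) by (simp add: avoiding_avoiding)
    ultimately show ?thesis using K(1) match(1) by blast
  qed
qed

section \<open>Contracting the cycles\<close>

text \<open>For disjoint cycles, a closed form of the equivalence classes that are the vertices of
  T_G: the cycle through \<open>v\<close>, or \<open>{v}\<close> if there is none.\<close>

definition cycle_class :: "'a rel \<Rightarrow> 'a \<Rightarrow> 'a set" where
  "cycle_class A v = insert v (\<Union> {X \<in> cycle_sets A. v \<in> X})"

definition contracted_arcs :: "'a rel \<Rightarrow> 'a set rel" where
  "contracted_arcs A = {(cycle_class A a, cycle_class A b) | a b.
     (a, b) \<in> A \<and> cycle_class A a \<noteq> cycle_class A b}"

lemma cycle_class_self: "v \<in> cycle_class A v"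
  by (simp add: cycle_class_def)

lemma cycle_class_cyclic:
  assumes "cycles_apart A" "X \<in> cycle_sets A" "v \<in> X"
  shows "cycle_class A v = X"
proof -
  have "{Y \<in> cycle_sets A. v \<in> Y} = {X}"
    using assms(2,3) cycle_sets_disjoint[OF assms(1), of _ X] by blast
  then show ?thesis using assms(3) by (auto simp: cycle_class_def)
qed

lemma cycle_class_noncyclic: "v \<notin> cyclic_vertices A \<Longrightarrow> cycle_class A v = {v}"
  unfolding cycle_class_def cyclic_vertices_def by blast

lemma cycle_class_eqI:
  assumes "cycles_apart A" "w \<in> cycle_class A v"
  shows "cycle_class A w = cycle_class A v"
proof (cases "v \<in> cyclic_vertices A")
  case True
  then obtain X where "X \<in> cycle_sets A" "v \<in> X" unfolding cyclic_vertices_def by blast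
  then show ?thesis using assms cycle_class_cyclic[OF assms(1)] by metis
next
  case False
  then show ?thesis using assms(2) cycle_class_noncyclic[OF False] by simp
qed

lemma contracted_arcsI:
  "(a, b) \<in> A \<Longrightarrow> cycle_class A a \<noteq> cycle_class A b \<Longrightarrow> (cycle_class A a, cycle_class A b) \<in> contracted_arcs A"
  unfolding contracted_arcs_def by blast

lemma simple_contracted_arcs:
  assumes "simple_arcs V A"
  shows "simple_arcs (cycle_class A ` V) (contracted_arcs A)"
  unfolding simple_arcs_def
proof (intro conjI)
  show "finite (cycle_class A ` V)" using assms by (simp add: simple_arcs_def)
  have "A \<subseteq> V \<times> V" using assms by (simp add: simple_arcs_def)
  then show "contracted_arcs A \<subseteq> cycle_class A ` V \<times> cycle_class A ` V"
    by (auto simp: contracted_arcs_def)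
  show "sym (contracted_arcs A)"
  proof (rule symI)
    fix X Y assume "(X, Y) \<in> contracted_arcs A"
    then obtain a b where "X = cycle_class A a" "Y = cycle_class A b" "(a, b) \<in> A"
      "cycle_class A a \<noteq> cycle_class A b" by (auto simp: contracted_arcs_def)
    then show "(Y, X) \<in> contracted_arcs A"
      using contracted_arcsI[OF simple_arcs_sym[OF assms]] by metis
  qed
  show "irrefl (contracted_arcs A)" by (auto simp: irrefl_def contracted_arcs_def)
qed

text \<open>A matching of the contracted graph lifts edge by edge. Lifted edges are disjoint because
  a common vertex would give a common class, and a cycle, being a single class, is met at most once.
  So the lower bound on the matching number applies and is compared with the upper one.\<close>

lemma rank_tight_contracted_matching:
  assumes "simple_arcs V A" "gain_on \<phi> A" "rank_tight V \<phi> A"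
  shows "arc_matching_number (contracted_arcs A) \<le> arc_matching_number (avoiding A (cyclic_vertices A))"
proof -
  have apart: "cycles_apart A" by (rule rank_tight_cycles_apart[OF assms])
  let ?c = "cycle_class A"
  obtain M where M: "arc_matching (contracted_arcs A) M" "card M = arc_matching_number (contracted_arcs A)"
    using arc_matching_number_attained[OF simple_contracted_arcs[OF assms(1)]] by blast
  have "\<exists>a b. E = {?c a, ?c b} \<and> (a, b) \<in> A \<and> ?c a \<noteq> ?c b" if E: "E \<in> M" for E
  proof -
    obtain X Y where "E = {X, Y}" "(X, Y) \<in> contracted_arcs A" by (rule arc_matching_edge[OF M(1) E])
    then show ?thesis by (auto simp: contracted_arcs_def)
  qed
  then obtain p q where pq: "\<And>E. E \<in> M \<Longrightarrow> E = {?c (p E), ?c (q E)}"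
    "\<And>E. E \<in> M \<Longrightarrow> (p E, q E) \<in> A" "\<And>E. E \<in> M \<Longrightarrow> ?c (p E) \<noteq> ?c (q E)" by metis
  define f where "f = (\<lambda>E. {p E, q E})"
  have mem: "?c x \<in> E" if "E \<in> M" "x \<in> f E" for x E
    using pq(1)[OF that(1)] that(2) by (auto simp: f_def)
  have meet: "E = E'" if "E \<in> M" "E' \<in> M" "x \<in> f E" "y \<in> f E'" "?c x = ?c y" for E E' x y
    using arc_matching_disjoint[OF M(1) that(1,2) mem[OF that(1,3)]] mem[OF that(2,4)] that(5) by simp
  have inj: "inj_on f M"
  proof (rule inj_onI)
    fix E E' assume E: "E \<in> M" "E' \<in> M" "f E = f E'"
    have "p E \<in> f E" by (simp add: f_def)
    then show "E = E'" using meet[OF E(1,2)] E(3) by blast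
  qed
  have match: "arc_matching A (f ` M)"
    unfolding arc_matching_def
  proof
    show "f ` M \<subseteq> undirected A" using pq(2) undirected_iff[OF assms(1)] by (auto simp: f_def)
    show "disjoint (f ` M)"
    proof (rule disjointI)
      fix e e' assume "e \<in> f ` M" "e' \<in> f ` M" "e \<noteq> e'"
      then obtain E E' where "E \<in> M" "E' \<in> M" "e = f E" "e' = f E'" "E \<noteq> E'" by auto
      then show "e \<inter> e' = {}" using meet[of E E'] by blast
    qed
  qed
  have "\<exists>s. X \<inter> \<Union> (f ` M) \<subseteq> {s}" if X: "X \<in> cycle_sets A" for X
  proof -
    have "x = y" if xy: "x \<in> X \<inter> \<Union> (f ` M)" "y \<in> X \<inter> \<Union> (f ` M)" for x y
    proof -
      have eq: "?c x = ?c y" using cycle_class_cyclic[OF apart X] xy by simp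
      obtain E E' where E: "E \<in> M" "x \<in> f E" "E' \<in> M" "y \<in> f E'" using xy by blast
      then have "E = E'" using meet[OF E(1,3,2,4) eq] by simp
      then show ?thesis using E eq pq(3)[OF E(1)] by (auto simp: f_def)
    qed
    then show ?thesis by blast
  qed
  from rank_tight_matching_number_ge[OF assms match this]
  have "2 * card M + card (cyclic_vertices A) \<le> 2 * arc_matching_number A"
    by (simp add: card_image[OF inj])
  then show ?thesis using rank_tight_matching_number_le[OF assms] M(2) by linarith
qed

lemma contracted_matching_of_noncyclic:
  assumes "simple_arcs V A" "arc_matching (avoiding A (cyclic_vertices A)) M"
  shows "arc_matching (contracted_arcs A) ((\<lambda>e. (\<lambda>v. {v}) ` e) ` M)"
    "card ((\<lambda>e. (\<lambda>v. {v}) ` e) ` M) = card M"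
proof -
  let ?s = "\<lambda>e. (\<lambda>v. {v}) ` e"
  have MA: "arc_matching A M" and MO: "\<Union> M \<inter> cyclic_vertices A = {}"
    using assms(2) by (auto simp: arc_matching_avoiding_iff)
  have s_inj: "?s e = ?s e' \<longleftrightarrow> e = e'" for e e' by (simp add: inj_image_eq_iff)
  show "card (?s ` M) = card M" by (rule card_image) (simp add: inj_on_def s_inj)
  show "arc_matching (contracted_arcs A) (?s ` M)"
    unfolding arc_matching_def
  proof
    show "?s ` M \<subseteq> undirected (contracted_arcs A)"
    proof
      fix E assume "E \<in> ?s ` M"
      then obtain e where e: "e \<in> M" "E = ?s e" by blast
      obtain a b where ab: "e = {a, b}" "(a, b) \<in> A" by (rule arc_matching_edge[OF MA e(1)])
      have "cycle_class A a = {a}" "cycle_class A b = {b}"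
        using MO e(1) ab(1) by (auto intro!: cycle_class_noncyclic)
      then have "({a}, {b}) \<in> contracted_arcs A"
        using contracted_arcsI[OF ab(2)] simple_arcs_neq[OF assms(1) ab(2)] by simp
      then show "E \<in> undirected (contracted_arcs A)"
        unfolding e(2) ab(1) using undirected_iff[OF simple_contracted_arcs[OF assms(1)]] by simp
    qed
    show "disjoint (?s ` M)"
    proof (rule disjointI)
      fix E E' assume "E \<in> ?s ` M" "E' \<in> ?s ` M" "E \<noteq> E'"
      then obtain e e' where "e \<in> M" "e' \<in> M" "E = ?s e" "E' = ?s e'" "e \<noteq> e'" by auto
      then show "E \<inter> E' = {}" using arc_matching_disjoint[OF MA, of e e'] by blast
    qed
  qed
qed

lemma noncyclic_matching_number_le_contracted:
  assumes "simple_arcs V A"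
  shows "arc_matching_number (avoiding A (cyclic_vertices A)) \<le> arc_matching_number (contracted_arcs A)"
proof -
  obtain M where M: "arc_matching (avoiding A (cyclic_vertices A)) M"
    "card M = arc_matching_number (avoiding A (cyclic_vertices A))"
    using arc_matching_number_attained[OF simple_arcs_avoiding[OF assms]] by blast
  show ?thesis
    using arc_matching_number_ge[OF simple_contracted_arcs[OF assms] contracted_matching_of_noncyclic(1)[OF assms M(1)]]
      contracted_matching_of_noncyclic(2)[OF assms M(1)] M(2) by simp
qed

lemma cycle_classes_eq:
  assumes "simple_arcs V A" "cycles_apart A"
  shows "cycle_class A ` V = cycle_sets A \<union> (\<lambda>v. {v}) ` (V - cyclic_vertices A)"
proof (intro subset_antisym subsetI)
  fix X assume "X \<in> cycle_class A ` V"
  then obtain v where v: "v \<in> V" "X = cycle_class A v" by blast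
  show "X \<in> cycle_sets A \<union> (\<lambda>v. {v}) ` (V - cyclic_vertices A)"
  proof (cases "v \<in> cyclic_vertices A")
    case True
    then obtain Y where "Y \<in> cycle_sets A" "v \<in> Y" unfolding cyclic_vertices_def by blast
    then show ?thesis using cycle_class_cyclic[OF assms(2)] v(2) by auto
  next
    case False
    then show ?thesis using cycle_class_noncyclic[OF False] v by simp
  qed
next
  fix X assume "X \<in> cycle_sets A \<union> (\<lambda>v. {v}) ` (V - cyclic_vertices A)"
  then show "X \<in> cycle_class A ` V"
  proof
    assume X: "X \<in> cycle_sets A"
    obtain l u where u: "X = range u" "periodic_cycle A l u" by (rule cycle_setsE[OF X])
    then have "u 0 \<in> V" "u 0 \<in> X" using periodic_cycle_range_subset[OF u(2) assms(1)] by auto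
    then show ?thesis using cycle_class_cyclic[OF assms(2) X] by (metis imageI)
  next
    assume "X \<in> (\<lambda>v. {v}) ` (V - cyclic_vertices A)"
    then show ?thesis using cycle_class_noncyclic by force
  qed
qed

lemma card_cycle_classes:
  assumes "simple_arcs V A" "cycles_apart A"
  shows "card (cycle_class A ` V) + card (cyclic_vertices A) = card V + card (cycle_sets A)"
proof -
  have fin: "finite V" using assms(1) by (simp add: simple_arcs_def)
  have "{v} \<notin> cycle_sets A" if "v \<notin> cyclic_vertices A" for v
    using that unfolding cyclic_vertices_def by blast
  then have "cycle_sets A \<inter> (\<lambda>v. {v}) ` (V - cyclic_vertices A) = {}" by blast
  then have "card (cycle_class A ` V) = card (cycle_sets A) + card ((\<lambda>v. {v}) ` (V - cyclic_vertices A))"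
    unfolding cycle_classes_eq[OF assms]
    using finite_cycle_sets[OF assms(1)] fin by (intro card_Un_disjoint) auto
  also have "card ((\<lambda>v. {v}) ` (V - cyclic_vertices A)) = card V - card (cyclic_vertices A)"
    using cyclic_vertices_subset[OF assms(1)] finite_cyclic_vertices[OF assms(1)]
    by (simp add: card_image card_Diff_subset)
  finally show ?thesis using card_mono[OF fin cyclic_vertices_subset[OF assms(1)]] by simp
qed

text \<open>Each vertex on a cycle has two neighbours in its own class, so at least twice as many
  arcs as cyclic vertices vanish in the contraction.\<close>

lemma card_contracted_arcs:
  assumes "simple_arcs V A" "cycles_apart A"
  shows "card (contracted_arcs A) + 2 * card (cyclic_vertices A) \<le> card A"
proof -
  let ?c = "cycle_class A" and ?O = "cyclic_vertices A"
  define inner where "inner = {(a, b) \<in> A. ?c a = ?c b}"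
  let ?N = "\<lambda>v. {w. (v, w) \<in> inner}"
  have finA: "finite A" by (rule simple_arcs_finite[OF assms(1)])
  have fin: "finite inner" by (rule finite_subset[OF _ finA]) (auto simp: inner_def)
  have "contracted_arcs A = (\<lambda>(a, b). (?c a, ?c b)) ` (A - inner)"
    by (auto simp: contracted_arcs_def inner_def image_iff)
  then have "card (contracted_arcs A) \<le> card (A - inner)"
    using card_image_le[of "A - inner"] finA by simp
  also have "\<dots> = card A - card inner"
    using fin by (intro card_Diff_subset) (auto simp: inner_def)
  finally have "card (contracted_arcs A) \<le> card A - card inner" .
  moreover have "card inner \<le> card A" by (rule card_mono[OF finA]) (auto simp: inner_def)
  ultimately have "card (contracted_arcs A) + card inner \<le> card A" by simp
  moreover have "2 * card ?O \<le> card inner"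
  proof -
    have finN: "finite (?N v)" for v
      by (rule finite_subset[of _ "snd ` inner"]) (use fin in force)+
    have deg: "2 \<le> card (?N v)" if v: "v \<in> ?O" for v
    proof -
      obtain X where X: "X \<in> cycle_sets A" "v \<in> X" using v unfolding cyclic_vertices_def by blast
      obtain l u where u: "X = range u" "periodic_cycle A l u" by (rule cycle_setsE[OF X(1)])
      obtain j where "v = u j" using X(2) u(1) by blast
      then obtain i where i: "v = u (Suc i)" using periodic_index[OF u(2), of j 1] by auto
      have c: "?c (u j) = X" for j using cycle_class_cyclic[OF assms(2) X(1)] u(1) by simp
      have "(u (Suc i), u i) \<in> A" "(u (Suc i), u (Suc (Suc i))) \<in> A"
        using u(2) simple_arcs_sym[OF assms(1)] by (auto simp: periodic_cycle_def)
      then have "{u i, u (Suc (Suc i))} \<subseteq> ?N v" by (simp add: inner_def i c)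
      then have "card {u i, u (Suc (Suc i))} \<le> card (?N v)" by (rule card_mono[OF finN])
      then show ?thesis using periodic_cycle_neq(2)[OF u(2), of i] by simp
    qed
    have "(\<Sum>v\<in>?O. 2) \<le> (\<Sum>v\<in>?O. card (?N v))" by (rule sum_mono) (rule deg)
    also have "\<dots> = card (Sigma ?O ?N)"
      using finite_cyclic_vertices[OF assms(1)] finN by (simp add: card_SigmaI)
    also have "\<dots> \<le> card inner" by (rule card_mono[OF fin]) auto
    finally show ?thesis by simp
  qed
  ultimately show ?thesis by linarith
qed

text \<open>Contraction replaces the cyclic vertices by one vertex per cycle and loses at least two
  arcs for each of them. As both graphs are connected, the doubled cyclomatic number falls by at
  least twice the number of cycles, hence to at most 0, while a cycle would make it at least
  2.\<close>

lemma contracted_arcs_acyclic: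
  assumes "simple_arcs V A" "cycles_apart A" "V \<noteq> {}"
    and connected: "\<And>a b. a \<in> V \<Longrightarrow> b \<in> V \<Longrightarrow> (a, b) \<in> A\<^sup>*"
  shows "\<not> periodic_cycle (contracted_arcs A) l u"
proof
  assume u: "periodic_cycle (contracted_arcs A) l u"
  let ?c = "cycle_class A" and ?T = "contracted_arcs A"
  have fin: "finite V" using assms(1) by (simp add: simple_arcs_def)
  obtain r where r: "r \<in> V" using assms(3) by blast
  have symA: "sym A" using assms(1) by (simp add: simple_arcs_def)
  have comps: "card (components V A) = 1" by (rule card_components_connected[OF symA assms(3) connected])
  have reach: "(?c a, ?c b) \<in> ?T\<^sup>*" if "(a, b) \<in> A\<^sup>*" for a b
    using that
  proof (induction rule: rtrancl_induct)
    case (step y z)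
    show ?case
    proof (cases "?c y = ?c z")
      case False
      then show ?thesis using step.IH contracted_arcsI[OF step.hyps(2)] by (simp add: rtrancl.rtrancl_into_rtrancl)
    qed (use step.IH in simp)
  qed simp
  have "sym ?T" using simple_contracted_arcs[OF assms(1)] by (simp add: simple_arcs_def)
  then have "?T\<^sup>* `` {?c a} = ?T\<^sup>* `` {?c r}" if "a \<in> V" for a
    by (rule rtrancl_class_eq[OF _ reach[OF connected[OF that r]]])
  then have "components (?c ` V) ?T \<subseteq> {?T\<^sup>* `` {?c r}}"
    by (auto simp: components_def quotient_def)
  then have "card (components (?c ` V) ?T) \<le> 1" using card_mono[of "{?T\<^sup>* `` {?c r}}"] by simp
  moreover have "double_cyclomatic V A \<le> 2 * int (card (cycle_sets A))"
    by (rule double_cyclomatic_le_cycle_sets[OF assms(1,2)])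
  ultimately have "double_cyclomatic (?c ` V) ?T \<le> 0"
    using card_cycle_classes[OF assms(1,2)] card_contracted_arcs[OF assms(1,2)] comps
    unfolding double_cyclomatic_def by linarith
  moreover have "0 \<le> double_cyclomatic (?c ` V) (avoiding ?T {u 0})"
    by (rule double_cyclomatic_nonneg[OF simple_arcs_avoiding[OF simple_contracted_arcs[OF assms(1)]]])
  ultimately show False
    using double_cyclomatic_avoid_cyclic_vertex[OF simple_contracted_arcs[OF assms(1)] u, of "u 0"] by simp
qed

lemma rank_tight_of_contracted_matching:
  assumes "simple_arcs V A" "gain_on \<phi> A" "cycles_apart A" "V \<noteq> {}"
    and connected: "\<And>a b. a \<in> V \<Longrightarrow> b \<in> V \<Longrightarrow> (a, b) \<in> A\<^sup>*"
    and dropping: "\<And>l u. periodic_cycle A l u \<Longrightarrow> rank_dropping \<phi> l u"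
    and matching: "arc_matching_number (contracted_arcs A)
      \<le> arc_matching_number (avoiding A (cyclic_vertices A))"
  shows "rank_tight V \<phi> A"
proof -
  let ?c = "cycle_class A" and ?T = "contracted_arcs A" and ?O = "cyclic_vertices A"
  have T: "simple_arcs (?c ` V) ?T" by (rule simple_contracted_arcs[OF assms(1)])
  obtain K N where K: "finite K" "arc_matching ?T N" "card K \<le> card N" "avoiding ?T K = {}"
    using acyclic_vertex_cover[OF T contracted_arcs_acyclic[OF assms(1,3,4) connected]] by blast
  obtain M where M: "arc_matching (avoiding A ?O) M" "card M = arc_matching_number (avoiding A ?O)"
    using arc_matching_number_attained[OF simple_arcs_avoiding[OF assms(1)]] by blast
  define M' where "M' = (\<lambda>e. (\<lambda>v. {v}) ` e) ` M"
  have TM: "arc_matching ?T M'" "card M' = card M"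
    unfolding M'_def by (rule contracted_matching_of_noncyclic[OF assms(1) M(1)])+
  have KM: "card K \<le> card M'"
    using K(3) arc_matching_number_ge[OF T K(2)] matching M(2) TM(2) by linarith
  have "\<exists>X. X \<in> E \<and> X \<in> K" if E: "E \<in> M'" for E
  proof -
    obtain X Y where "E = {X, Y}" "(X, Y) \<in> ?T" by (rule arc_matching_edge[OF TM(1) E])
    moreover have "(X, Y) \<notin> avoiding ?T K" using K(4) by simp
    ultimately show ?thesis by (auto simp: avoiding_def)
  qed
  then obtain f where f: "\<And>E. E \<in> M' \<Longrightarrow> f E \<in> E \<and> f E \<in> K" by metis
  have "inj_on f M'"
  proof (rule inj_onI)
    fix E E' assume E: "E \<in> M'" "E' \<in> M'" "f E = f E'"
    show "E = E'" using arc_matching_disjoint[OF TM(1) E(1,2), of "f E"] f[OF E(1)] f[OF E(2)] E(3) by simp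
  qed
  then have "card (f ` M') = card M'" by (rule card_image)
  moreover have "f ` M' \<subseteq> K" using f by blast
  \<comment> \<open>Every edge of \<open>M'\<close> meets \<open>K\<close> and \<open>K\<close> is
    no larger than \<open>M'\<close>; so \<open>K\<close> consists of one end of each edge of
    \<open>M'\<close>, and all these ends are singletons off the cycles.\<close>
  ultimately have "f ` M' = K" using K(1) KM by (metis card_seteq)
  then have "K \<subseteq> \<Union> M'" using f by blast
  moreover have "\<Union> M \<inter> ?O = {}" using M(1) by (simp add: arc_matching_avoiding_iff)
  ultimately have K_noncyclic: "\<exists>v. X = {v} \<and> v \<notin> ?O" if "X \<in> K" for X
    using that unfolding M'_def by blast
  define L where "L = {v. {v} \<in> K}"
  have KL: "K = (\<lambda>v. {v}) ` L" using K_noncyclic unfolding L_def by blast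
  have inj: "inj_on (\<lambda>v. {v}) L" by simp
  have "card L = card K" unfolding KL by (rule card_image[OF inj, symmetric])
  have "finite ((\<lambda>v. {v}) ` L)" using K(1) unfolding KL .
  then have "finite L" by (rule finite_imageD[OF _ inj])
  have L: "L \<inter> ?O = {}" using K_noncyclic unfolding L_def by blast
  have cardL: "card L \<le> arc_matching_number (avoiding A ?O)"
    using \<open>card L = card K\<close> KM TM(2) M(2) by simp
  \<comment> \<open>As \<open>K\<close> covers all contracted edges, an edge missed by
    \<open>L\<close> joins two vertices of one class, hence of one cycle, and is an edge of that
    cycle because there are no chords.\<close>
  have cover: "\<exists>l u. periodic_cycle A l u \<and> {a, b} \<in> cycle_edges u"
    if ab: "(a, b) \<in> A" "a \<notin> L" "b \<notin> L" for a b
  proof -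
    have notK: "?c v \<notin> K" if "v \<notin> L" for v
      using that K_noncyclic[of "?c v"] cycle_class_self[of v A] unfolding L_def by fastforce
    have "?c a = ?c b"
    proof (rule ccontr)
      assume "?c a \<noteq> ?c b"
      then have "(?c a, ?c b) \<in> avoiding ?T K"
        using contracted_arcsI[OF ab(1)] notK ab(2,3) by (simp add: avoiding_def)
      then show False using K(4) by simp
    qed
    have "a \<in> ?O"
    proof (rule ccontr)
      assume "a \<notin> ?O"
      then have "?c a = {a}" by (rule cycle_class_noncyclic)
      then show False using \<open>?c a = ?c b\<close> cycle_class_self[of b A] simple_arcs_neq[OF assms(1) ab(1)] by simp
    qed
    then obtain X where X: "X \<in> cycle_sets A" "a \<in> X" unfolding cyclic_vertices_def by blast
    then have "b \<in> X" using cycle_class_cyclic[OF assms(3) X] \<open>?c a = ?c b\<close> cycle_class_self[of b A] by simp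
    obtain l u where u: "X = range u" "periodic_cycle A l u" by (rule cycle_setsE[OF X(1)])
    obtain i j where ij: "a = u i" "b = u j" using X(2) \<open>b \<in> X\<close> u(1) by blast
    show ?thesis
      using cycles_apart_chordless[OF assms(1,3) u(2), of i j] ab(1) u(2) unfolding ij by blast
  qed
  show ?thesis
    by (rule rank_tight_sufficient[OF assms(1-3) dropping \<open>finite L\<close> L cardL cover])
qed

lemma rank_tight_iff:
  assumes "simple_arcs V A" "gain_on \<phi> A" "V \<noteq> {}"
    and "\<And>a b. a \<in> V \<Longrightarrow> b \<in> V \<Longrightarrow> (a, b) \<in> A\<^sup>*"
  shows "rank_tight V \<phi> A \<longleftrightarrow> cycles_apart A \<and>
    (\<forall>l u. periodic_cycle A l u \<longrightarrow> rank_dropping \<phi> l u) \<and>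
    arc_matching_number (contracted_arcs A) = arc_matching_number (avoiding A (cyclic_vertices A))"
  (is "_ \<longleftrightarrow> ?R")
proof
  assume tight: "rank_tight V \<phi> A"
  show ?R
  proof (intro conjI allI impI)
    show "cycles_apart A" by (rule rank_tight_cycles_apart[OF assms(1,2) tight])
    show "rank_dropping \<phi> l u" if "periodic_cycle A l u" for l u
      using rank_tight_cycle[OF assms(1,2) tight that] by blast
    show "arc_matching_number (contracted_arcs A) = arc_matching_number (avoiding A (cyclic_vertices A))"
      by (rule antisym[OF rank_tight_contracted_matching[OF assms(1,2) tight]
            noncyclic_matching_number_le_contracted[OF assms(1)]])
  qed
next
  assume ?R
  then show "rank_tight V \<phi> A"
    using rank_tight_of_contracted_matching[OF assms(1,2) _ assms(3,4)] by auto
qed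

section \<open>Gain graphs\<close>

lemma matching_number_eq: "matching_number H = arc_matching_number (arcs_ends H)"
  by (simp add: matching_number_def arc_matching_number_def matching_def arc_matching_def edges_def)

lemma arcs_ends_delete_verts:
  assumes "parcs G \<subseteq> pverts G \<times> pverts G"
  shows "arcs_ends (delete_verts G S) = avoiding (parcs G) S"
  using assms by (auto simp: delete_verts_def arcs_ends_conv avoiding_def)

lemma card_undirected:
  assumes "simple_arcs V A"
  shows "2 * card (undirected A) = card A"
  using assms
proof (induction "card A" arbitrary: A rule: less_induct)
  case less
  show ?case
  proof (cases "A = {}")
    case False
    then obtain a b where ab: "(a, b) \<in> A" by auto
    let ?B = "A - {(a, b), (b, a)}"
    have B: "simple_arcs V ?B" by (rule simple_arcs_remove_edge[OF less.prems])
    note card = card_remove_edge[OF less.prems ab]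
    have "undirected A = insert {a, b} (undirected ?B)"
      using ab simple_arcs_sym[OF less.prems ab] unfolding undirected_def
      by (auto simp: image_iff doubleton_eq_iff)
    moreover have "{a, b} \<notin> undirected ?B" unfolding undirected_iff[OF B] by simp
    moreover have "finite (undirected ?B)"
      using simple_arcs_finite[OF B] by (simp add: undirected_def)
    ultimately have "card (undirected A) = Suc (card (undirected ?B))" by simp
    then show ?thesis using less.hyps[OF _ B] card by simp
  qed (simp add: undirected_def)
qed

lemma gain_rank_eq:
  assumes "simple_arcs (set vs) (parcs G)" "distinct vs"
  shows "gain_rank G \<phi> vs = arc_rank \<phi> (parcs G)"
proof -
  let ?h = "gain_entry \<phi> (parcs G)"
  let ?M = "mat (length vs) (length vs) (\<lambda>(i, j). ?h (vs ! i) (vs ! j))"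
  have "rank_le ?h (vec_space.rank (length vs) ?M)"
    using assms by (intro rank_le_mat_rank) (auto simp: gain_entry_def simple_arcs_def split: if_splits)
  then have "arc_rank \<phi> (parcs G) \<le> vec_space.rank (length vs) ?M" by (rule arc_rank_le)
  moreover have "vec_space.rank (length vs) ?M \<le> arc_rank \<phi> (parcs G)"
    by (rule rank_le_imp_mat_rank_le[OF rank_le_arc_rank[OF assms(1)]])
  moreover have "adjacency_matrix G \<phi> vs = ?M"
    by (simp add: adjacency_matrix_def gain_entry_def)
  ultimately show ?thesis by (simp add: gain_rank_def)
qed

section \<open>Translation between cycles as arc lists and as periodic sequences\<close>

definition cycle_arcs :: "nat \<Rightarrow> (nat \<Rightarrow> 'a) \<Rightarrow> ('a \<times> 'a) list" where
  "cycle_arcs l u = map (\<lambda>i. (u i, u (Suc i))) [0..<l]"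

lemma pcas_arcs:
  "m \<le> n \<Longrightarrow> pcas (u m) (map (\<lambda>i. (u i, u (Suc i))) [m..<n]) (u n)"
  by (induction "n - m" arbitrary: m) (auto simp: upt_rec)

lemma tl_pawalk_verts: "tl (pawalk_verts x p) = map snd p" if "pcas x p y"
proof -
  have "pawalk_verts x p = x # map snd p" using that
    by (induction p arbitrary: x) auto
  then show ?thesis by simp
qed

lemma pcas_nth:
  assumes "pcas x p y" "p \<noteq> []"
  shows "fst (p ! 0) = x" "snd (p ! (length p - 1)) = y"
    "Suc i < length p \<Longrightarrow> snd (p ! i) = fst (p ! Suc i)"
proof -
  have "fst (p ! 0) = x \<and> snd (p ! (length p - 1)) = y \<and>
      (\<forall>i. Suc i < length p \<longrightarrow> snd (p ! i) = fst (p ! Suc i))"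
    using assms
  proof (induction p arbitrary: x)
    case (Cons e es)
    show ?case
    proof (cases "es = []")
      case False
      then have IH: "fst (es ! 0) = snd e" "snd (es ! (length es - 1)) = y"
        "\<And>i. Suc i < length es \<Longrightarrow> snd (es ! i) = fst (es ! Suc i)"
        using Cons.IH[of "snd e"] Cons.prems by auto
      have "snd ((e # es) ! i) = fst ((e # es) ! Suc i)" if "Suc i < length (e # es)" for i
        using IH that by (cases i) auto
      then show ?thesis using IH(2) Cons.prems False by (simp add: nth_Cons')
    qed (use Cons.prems in auto)
  qed simp
  then show "fst (p ! 0) = x" "snd (p ! (length p - 1)) = y"
    "Suc i < length p \<Longrightarrow> snd (p ! i) = fst (p ! Suc i)" by auto
qed

lemma graph_cycle_cycle_arcs:
  assumes "parcs G \<subseteq> pverts G \<times> pverts G" "periodic_cycle (parcs G) l u"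
  shows "graph_cycle G (cycle_arcs l u)"
proof -
  let ?p = "cycle_arcs l u"
  have l: "3 \<le> l" and step: "\<And>i. (u i, u (Suc i)) \<in> parcs G" and ul: "u l = u 0"
    using assms(2) unfolding periodic_cycle_def by (auto dest: spec[of _ 0])
  have cas: "pcas (u 0) ?p (u 0)"
    using pcas_arcs[of 0 l u] by (simp add: cycle_arcs_def ul)
  have "pre_digraph.awalk (with_proj G) (u 0) ?p (u 0)"
    using cas assms(1) step
    by (auto simp: pre_digraph.awalk_def cas_with_proj_eq cycle_arcs_def)
  moreover have "distinct (tl (pawalk_verts (u 0) ?p))"
  proof -
    \<comment> \<open>The vertices of the walk after its start are the targets of the arcs, that is,
      the sequence shifted by one.\<close>
    have "inj_on (\<lambda>i. u (i + 1)) {..<l}"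
      using periodic_cycle_shift[OF assms(2), of 1] unfolding periodic_cycle_def by blast
    then show ?thesis
      unfolding tl_pawalk_verts[OF cas] by (simp add: cycle_arcs_def distinct_map atLeast0LessThan o_def)
  qed
  ultimately show ?thesis
    using l unfolding graph_cycle_def pre_digraph.cycle_def awalk_verts_with_proj_eq
    by (auto simp: cycle_arcs_def)
qed

lemma graph_cycle_periodic:
  assumes "graph_cycle G p"
  shows "\<exists>u. periodic_cycle (parcs G) (length p) u \<and> p = cycle_arcs (length p) u"
proof -
  let ?l = "length p"
  obtain x where "pre_digraph.awalk (with_proj G) x p x" "distinct (tl (pawalk_verts x p))"
    using assms by (auto simp: graph_cycle_def pre_digraph.cycle_def awalk_verts_with_proj_eq)
  then have p: "set p \<subseteq> parcs G" "pcas x p x" "distinct (map snd p)"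
    by (auto simp: pre_digraph.awalk_def cas_with_proj_eq tl_pawalk_verts)
  have l: "3 \<le> ?l" using assms by (simp add: graph_cycle_def)
  then have pos: "0 < ?l" by linarith
  then have "p \<noteq> []" by simp
  note nth = pcas_nth[OF p(2) this]
  define u where "u = (\<lambda>i. fst (p ! (i mod ?l)))"
  have snd: "snd (p ! i) = u (Suc i)" if "i < ?l" for i
  proof (cases "Suc i = ?l")
    case True
    then have "i = ?l - 1" by simp
    then show ?thesis using nth(1,2) True l by (simp add: u_def)
  next
    case False
    then show ?thesis using nth(3)[of i] that by (simp add: u_def)
  qed
  have fst: "fst (p ! i) = u i" if "i < ?l" for i using that by (simp add: u_def)
  have "p = cycle_arcs ?l u"
    unfolding cycle_arcs_def by (rule nth_equalityI) (auto simp: fst snd prod_eq_iff)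
  moreover have "periodic_cycle (parcs G) ?l u"
    unfolding periodic_cycle_def
  proof (intro conjI allI)
    show "3 \<le> ?l" by (rule l)
    show per: "u (i + ?l) = u i" for i by (simp add: u_def)
    have mod: "u (i mod ?l) = u i" for i by (simp add: u_def)
    show "(u i, u (Suc i)) \<in> parcs G" for i
    proof -
      have i: "i mod ?l < ?l" by (rule mod_less_divisor[OF pos])
      have "u (Suc (i mod ?l)) = u (Suc i)" using mod[of "Suc i"] mod[of "Suc (i mod ?l)"] by (simp add: mod_Suc_eq)
      then have "p ! (i mod ?l) = (u i, u (Suc i))" using fst[OF i] snd[OF i] mod by (simp add: prod_eq_iff)
      then show ?thesis using p(1) nth_mem[OF i] by auto
    qed
    have shifted: "inj_on (\<lambda>i. u (Suc i)) {..<?l}"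
      using p(3) snd by (auto simp: distinct_conv_nth inj_on_def)
    show "inj_on u {..<?l}"
    proof (rule inj_onI)
      fix i j assume ij: "i \<in> {..<?l}" "j \<in> {..<?l}" "u i = u j"
      \<comment> \<open>Index of the arc that ends in \<open>u i\<close>: distinctness is known for
        the targets and has to be carried over to the sources; the arc preceding index 0 is the last
        one.\<close>
      let ?f = "\<lambda>i. if i = 0 then ?l - 1 else i - 1"
      have f: "u (Suc (?f i)) = u i" "?f i < ?l" if "i < ?l" for i
        using that l per[of 0] by (cases i; auto)+
      have "?f i = ?f j"
        by (rule inj_onD[OF shifted]) (use f[of i] f[of j] ij in auto)
      then show "i = j" using ij by (auto split: if_splits)
    qed
  qed
  ultimately show ?thesis by blast
qed

lemma set_cycle_arcs:
  assumes "periodic_cycle A l u"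
  shows "set (cycle_arcs l u) = range (\<lambda>i. (u i, u (Suc i)))"
proof -
  have "(u i, u (Suc i)) \<in> (\<lambda>i. (u i, u (Suc i))) ` {..<l}" for i
  proof -
    have "u (i mod l) = u i" "u (Suc (i mod l)) = u (Suc i)"
      unfolding periodic_cycle_eq_iff[OF assms] by (simp_all add: mod_Suc_eq)
    moreover have "i mod l < l" using assms by (simp add: periodic_cycle_def)
    ultimately show ?thesis by (intro image_eqI[of _ _ "i mod l"]) auto
  qed
  then have "range (\<lambda>i. (u i, u (Suc i))) = (\<lambda>i. (u i, u (Suc i))) ` {..<l}" by blast
  then show ?thesis by (simp add: cycle_arcs_def atLeast0LessThan)
qed

lemma prod_list_map_upt: "prod_list (map f [0..<n]) = (\<Prod>i<n. f i)"
  by (induction n) simp_all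

lemma cycle_arcs_simps:
  assumes "periodic_cycle A l u"
  shows "undirected (set (cycle_arcs l u)) = cycle_edges u" "cycle_verts (cycle_arcs l u) = range u"
    "cycle_gain \<phi> (cycle_arcs l u) = (\<Prod>i<l. \<phi> (u i, u (Suc i)))" "length (cycle_arcs l u) = l"
  unfolding undirected_def cycle_verts_def set_cycle_arcs[OF assms] cycle_edges_def
  by (simp_all add: image_image cycle_gain_def cycle_arcs_def o_def prod_list_map_upt)

context
  fixes G :: "'a pair_pre_digraph"
  assumes wf: "parcs G \<subseteq> pverts G \<times> pverts G"
begin

text \<open>The lists \<open>cycle_arcs l u\<close> exhaust the graph cycles, so every statement
  about all cycles transfers.\<close>

lemma all_graph_cycles_iff:
  "(\<forall>p. graph_cycle G p \<longrightarrow> Q p) \<longleftrightarrow> (\<forall>l u. periodic_cycle (parcs G) l u \<longrightarrow> Q (cycle_arcs l u))"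
  using graph_cycle_cycle_arcs[OF wf] graph_cycle_periodic by metis

lemma cycles_disjoint_iff: "cycles_disjoint G \<longleftrightarrow> cycles_apart (parcs G)"
proof -
  let ?Q = "\<lambda>p q. undirected (set p) \<noteq> undirected (set q) \<longrightarrow> cycle_verts p \<inter> cycle_verts q = {}"
  have "cycles_disjoint G \<longleftrightarrow> (\<forall>p. graph_cycle G p \<longrightarrow> (\<forall>q. graph_cycle G q \<longrightarrow> ?Q p q))"
    unfolding cycles_disjoint_def by blast
  also have "\<dots> \<longleftrightarrow> cycles_apart (parcs G)"
    unfolding all_graph_cycles_iff cycles_apart_def by (simp add: cycle_arcs_simps) metis
  finally show ?thesis .
qed

lemma same_cycle_eq: "same_cycle G = {(v, w). \<exists>X\<in>cycle_sets (parcs G). v \<in> X \<and> w \<in> X}"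
proof -
  have "(\<exists>p. graph_cycle G p \<and> v \<in> cycle_verts p \<and> w \<in> cycle_verts p) \<longleftrightarrow>
      (\<exists>l u. periodic_cycle (parcs G) l u \<and> v \<in> range u \<and> w \<in> range u)" for v w
    using all_graph_cycles_iff[of "\<lambda>p. \<not> (v \<in> cycle_verts p \<and> w \<in> cycle_verts p)"]
    by (metis (no_types, lifting) cycle_arcs_simps(2))
  moreover have "(\<exists>X\<in>cycle_sets (parcs G). v \<in> X \<and> w \<in> X) \<longleftrightarrow>
      (\<exists>l u. periodic_cycle (parcs G) l u \<and> v \<in> range u \<and> w \<in> range u)" for v w
    unfolding cycle_sets_def Bex_def mem_Collect_eq by metis
  ultimately show ?thesis unfolding same_cycle_def by simp
qed

lemma on_cycles_eq: "on_cycles G = cyclic_vertices (parcs G)"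
proof -
  have "v \<in> on_cycles G \<longleftrightarrow> (v, v) \<in> same_cycle G" for v
    by (auto simp: on_cycles_def same_cycle_def)
  then show ?thesis unfolding same_cycle_eq cyclic_vertices_def by blast
qed

text \<open>For disjoint cycles \<open>same_cycle G\<close> is already transitive, so its closure
  only adds the trivial classes of the vertices on no cycle.\<close>

lemma parcs_contract_cycles:
  assumes "cycles_apart (parcs G)"
  shows "parcs (contract_cycles G) = contracted_arcs (parcs G)"
proof -
  let ?c = "cycle_class (parcs G)"
  have cls: "(same_cycle G)\<^sup>* `` {v} = ?c v" for v
  proof (intro subset_antisym subsetI)
    fix w assume "w \<in> (same_cycle G)\<^sup>* `` {v}"
    then have "(v, w) \<in> (same_cycle G)\<^sup>*" by simp
    then show "w \<in> ?c v"
    proof (induction rule: rtrancl_induct)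
      case base
      show ?case by (rule cycle_class_self)
    next
      case (step y z)
      then obtain X where X: "X \<in> cycle_sets (parcs G)" "y \<in> X" "z \<in> X"
        unfolding same_cycle_eq by blast
      then have "z \<in> ?c y" using cycle_class_cyclic[OF assms X(1,2)] by simp
      then show ?case using cycle_class_eqI[OF assms step.IH] by simp
    qed
  next
    fix w assume "w \<in> ?c v"
    then have "w = v \<or> (v, w) \<in> same_cycle G" unfolding same_cycle_eq cycle_class_def by blast
    then show "w \<in> (same_cycle G)\<^sup>* `` {v}" by auto
  qed
  have V: "pverts G // (same_cycle G)\<^sup>* = ?c ` pverts G"
    by (auto simp: quotient_def cls)
  show ?thesis
  proof (intro subset_antisym subsetI)
    fix XY assume "XY \<in> parcs (contract_cycles G)"
    moreover obtain X Y where "XY = (X, Y)" by fastforce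
    ultimately obtain a b where XY: "XY = (X, Y)" "X \<in> ?c ` pverts G" "Y \<in> ?c ` pverts G" "X \<noteq> Y"
      "a \<in> X" "b \<in> Y" "(a, b) \<in> parcs G"
      unfolding contract_cycles_def V Let_def pair_pre_digraph.simps mem_Collect_eq prod.case by blast
    then have "X = ?c a" "Y = ?c b" using cycle_class_eqI[OF assms] by auto
    then show "XY \<in> contracted_arcs (parcs G)" using contracted_arcsI XY by metis
  next
    fix XY assume "XY \<in> contracted_arcs (parcs G)"
    then obtain a b where ab: "XY = (?c a, ?c b)" "(a, b) \<in> parcs G" "?c a \<noteq> ?c b"
      by (auto simp: contracted_arcs_def)
    moreover have "a \<in> pverts G" "b \<in> pverts G" using ab(2) wf by auto
    ultimately show "XY \<in> parcs (contract_cycles G)"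
      unfolding contract_cycles_def V Let_def using cycle_class_self[of _ "parcs G"] by auto
  qed
qed

end

lemma (in pair_graph) simple_arcs_parcs: "simple_arcs (pverts G) (parcs G)"
  unfolding simple_arcs_def
proof (intro conjI)
  show "finite (pverts G)" by (rule pair_finite_verts)
  show "parcs G \<subseteq> pverts G \<times> pverts G" using in_arcsD1 in_arcsD2 by auto
  show "sym (parcs G)" by (rule symI) (rule arcs_symmetric)
  show "irrefl (parcs G)" using no_loops' by (auto simp: irrefl_def)
qed

lemma (in gain_graph) gain_on_parcs: "gain_on \<phi> (parcs G)"
proof -
  have "\<phi> (u, v) * \<phi> (v, u) = 1" if uv: "(u, v) \<in> parcs G" for u v
  proof -
    have "\<phi> (v, u) \<noteq> 0" using gain_unit[OF arcs_symmetric[OF uv]] by auto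
    then show ?thesis using gain_inverse[OF uv] by simp
  qed
  then show ?thesis by (auto simp: gain_on_def)
qed

text \<open>Connectedness is strong connectedness of the symmetric closure, and symmetry of the arcs
  gives that closure the same reachability as the graph.\<close>

lemma (in pair_graph) connected_reachable:
  assumes "Digraph_Component.connected (with_proj G)"
  shows "pverts G \<noteq> {}" "u \<in> pverts G \<Longrightarrow> v \<in> pverts G \<Longrightarrow> u \<rightarrow>\<^sup>*\<^bsub>with_proj G\<^esub> v"
    "u \<in> pverts G \<Longrightarrow> v \<in> pverts G \<Longrightarrow> (u, v) \<in> (parcs G)\<^sup>*"
proof -
  have "strongly_connected (with_proj (mk_symmetric (with_proj G)))"
    using assms by (simp add: Digraph_Component.connected_def)
  then have "pverts G \<noteq> {}" and reach: "\<And>u v. u \<in> pverts G \<Longrightarrow> v \<in> pverts G \<Longrightarrow> u \<rightarrow>\<^sup>*\<^bsub>mk_symmetric (with_proj G)\<^esub> v"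
    by (auto simp: strongly_connected_def)
  then show "pverts G \<noteq> {}" by blast
  show *: "u \<rightarrow>\<^sup>*\<^bsub>with_proj G\<^esub> v" if "u \<in> pverts G" "v \<in> pverts G"
    using reach[OF that] reachable_mk_symmetric_eq[OF sym_arcs] by simp
  show "(u, v) \<in> (parcs G)\<^sup>*" if "u \<in> pverts G" "v \<in> pverts G"
    using reachable_rtranclI[OF *[OF that]] by simp
qed

text \<open>By connectedness both component counts are 1, and every edge is counted as two
  arcs.\<close>

lemma (in pair_graph) double_cyclomatic_number:
  assumes "Digraph_Component.connected (with_proj G)"
  shows "2 * cyclomatic_number (with_proj G) = double_cyclomatic (pverts G) (parcs G)"
proof -
  note conn = connected_reachable[OF assms]
  have in_verts: "v \<in> pverts G" if "u \<rightarrow>\<^sup>*\<^bsub>with_proj G\<^esub> v" for u v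
    using reachable_in_verts(2)[OF that] by simp
  have "pre_digraph.sccs_verts (with_proj G) = {pverts G}"
    unfolding pre_digraph.sccs_verts_def
  proof (intro subset_antisym subsetI)
    fix S assume "S \<in> {S. S \<noteq> {} \<and> (\<forall>u\<in>S. \<forall>v\<in>S. u \<rightarrow>\<^sup>*\<^bsub>with_proj G\<^esub> v) \<and>
      (\<forall>u\<in>S. \<forall>v. v \<notin> S \<longrightarrow> \<not> u \<rightarrow>\<^sup>*\<^bsub>with_proj G\<^esub> v \<or> \<not> v \<rightarrow>\<^sup>*\<^bsub>with_proj G\<^esub> u)}"
    then have S: "S \<noteq> {}" "\<And>u v. u \<in> S \<Longrightarrow> v \<in> S \<Longrightarrow> u \<rightarrow>\<^sup>*\<^bsub>with_proj G\<^esub> v"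
      "\<And>u v. u \<in> S \<Longrightarrow> v \<notin> S \<Longrightarrow> \<not> u \<rightarrow>\<^sup>*\<^bsub>with_proj G\<^esub> v \<or> \<not> v \<rightarrow>\<^sup>*\<^bsub>with_proj G\<^esub> u" by auto
    obtain s where "s \<in> S" using S(1) by blast
    moreover have "S \<subseteq> pverts G" using S(2) in_verts by blast
    ultimately have "S = pverts G" using S(3) conn(2) by blast
    then show "S \<in> {pverts G}" by simp
  next
    fix S assume "S \<in> {pverts G}"
    then show "S \<in> {S. S \<noteq> {} \<and> (\<forall>u\<in>S. \<forall>v\<in>S. u \<rightarrow>\<^sup>*\<^bsub>with_proj G\<^esub> v) \<and>
      (\<forall>u\<in>S. \<forall>v. v \<notin> S \<longrightarrow> \<not> u \<rightarrow>\<^sup>*\<^bsub>with_proj G\<^esub> v \<or> \<not> v \<rightarrow>\<^sup>*\<^bsub>with_proj G\<^esub> u)}"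
      using conn in_verts by blast
  qed
  moreover have "card (components (pverts G) (parcs G)) = 1"
    by (rule card_components_connected[OF _ conn(1,3)]) (use simple_arcs_parcs in \<open>simp add: simple_arcs_def\<close>)
  ultimately show ?thesis
    using card_undirected[OF simple_arcs_parcs]
    by (simp add: cyclomatic_number_def double_cyclomatic_def edges_def)
qed

theorem theorem1p11:
  fixes G :: "'a pair_pre_digraph" and \<phi> :: "'a \<times> 'a \<Rightarrow> complex" and vs :: "'a list"
  assumes "gain_graph G \<phi>"
    and "Digraph_Component.connected (with_proj G)"
    and "distinct vs" and "set vs = pverts G"
  shows "int (gain_rank G \<phi> vs)
           = 2 * int (matching_number (with_proj G)) - 2 * cyclomatic_number (with_proj G)
     \<longleftrightarrow> cycles_disjoint G
       \<and> (\<forall>p. graph_cycle G p \<longrightarrow>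
             even (length p) \<and> cycle_gain \<phi> p = (- 1) ^ (length p div 2))
       \<and> matching_number (with_proj (contract_cycles G))
           = matching_number (delete_verts G (on_cycles G))"
proof -
  interpret gain_graph G \<phi> by (rule assms(1))
  let ?A = "parcs G"
  note A = simple_arcs_parcs
  have wf: "?A \<subseteq> pverts G \<times> pverts G" using A by (simp add: simple_arcs_def)
  note conn = connected_reachable[OF assms(2)]
  have "int (gain_rank G \<phi> vs)
        = 2 * int (matching_number (with_proj G)) - 2 * cyclomatic_number (with_proj G)
      \<longleftrightarrow> rank_tight (pverts G) \<phi> ?A"
    using gain_rank_eq[of vs G \<phi>] A assms(3,4) double_cyclomatic_number[OF assms(2)]
    by (simp add: rank_tight_def matching_number_eq)
  also note rank_tight_iff[OF A gain_on_parcs conn(1,3)]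
  also have "(\<forall>l u. periodic_cycle ?A l u \<longrightarrow> rank_dropping \<phi> l u) \<longleftrightarrow>
      (\<forall>p. graph_cycle G p \<longrightarrow> even (length p) \<and> cycle_gain \<phi> p = (- 1) ^ (length p div 2))"
    unfolding all_graph_cycles_iff[OF wf] by (auto simp: cycle_arcs_simps rank_dropping_def)
  \<comment> \<open>The identification of the contracted graph holds under (i), which is a conjunct
    on both sides.\<close>
  finally show ?thesis
    using parcs_contract_cycles[OF wf]
    by (auto simp: cycles_disjoint_iff[OF wf] matching_number_eq on_cycles_eq[OF wf]
        arcs_ends_delete_verts[OF wf])
qed

end
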